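(* Let $f:\mathcal{C}(1)\to\mathcal{C}(2)$ be a morphism of regular exact couples of $R$-modules (with bidegrees $\mathbf{a},\mathbf{b},\mathbf{c}$, and $\sigma=\det[\mathbf{a}\ (\mathbf{b}+\mathbf{c})]$) such that for a given $n\in\mathbb{Z}$ the following hold: (i) For all $\mathbf{x}$ with $\det[\mathbf{a}\ \mathbf{x}]=n$ and $s=1,2$, $E^\infty_{\mathbf{x}+\mathbf{b}}(s)$ is stable. (ii) For all $\mathbf{x}$ with $\det[\mathbf{a}\ \mathbf{x}]=n$, the induced map $f^\infty:E^\infty_{\mathbf{x}+\mathbf{b}}(1)\to E^\infty_{\mathbf{x}+\mathbf{b}}(2)$ is an isomorphism. (iii) For all $r\in\mathbb{Z}$, the induced map $\varepsilon_{\mathbf{x}(n)+r\mathbf{a}}(1)\to\varepsilon_{\mathbf{x}(n)+r\mathbf{a}}(2)$ is an epimorphism or the induced map $\varepsilon^{\mathbf{x}(n+\sigma)+r\mathbf{a}}(1)\to\varepsilon^{\mathbf{x}(n+\sigma)+r\mathbf{a}}(2)$ is a monomorphism. (iv) $L_nf$ restricts to an isomorphism $\lim_rF_{\mathbf{x}(n)+r\mathbf{a}}(1)\to\lim_rF_{\mathbf{x}(n)+r\mathbf{a}}(2)$. (v) $L_nf$ induces a monomorphism $\lim^1_rF_{\mathbf{x}(n)+r\mathbf{a}}(1)\to\lim^1_rF_{\mathbf{x}(n)+r\mathbf{a}}(2)$. (vi) $L_{n+\sigma}f$ induces an isomorphism $\operatorname{im}(L^{n+\sigma}(1)\to L_{n+\sigma}(1))\to\operatorname{im}(L^{n+\sigma}(2)\to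 L_{n+\sigma}(2))$. Then $f$ induces isomorphisms $L_nf:L_n(1)\to L_n(2)$ and $L^{n+\sigma}f:L^{n+\sigma}(1)\to L^{n+\sigma}(2)$.
   Context: $R$ is a unital ring. A $(\mathbb{Z}\times\mathbb{Z})$-bigraded exact couple $(E,D,i,j,k)$ with bidegrees $\mathbf{a},\mathbf{b},\mathbf{c}\in\mathbb{Z}\times\mathbb{Z}$ consists of families of $R$-modules $D_{\mathbf{x}},E_{\mathbf{x}}$ ($\mathbf{x}\in\mathbb{Z}\times\mathbb{Z}$) and $R$-linear maps $i_{\mathbf{x}}:D_{\mathbf{x}}\to D_{\mathbf{x}+\mathbf{a}}$, $j_{\mathbf{x}}:D_{\mathbf{x}}\to E_{\mathbf{x}+\mathbf{b}}$, $k_{\mathbf{x}}:E_{\mathbf{x}}\to D_{\mathbf{x}+\mathbf{c}}$ such that $D_{\mathbf{x}-\mathbf{a}}\xrightarrow{i}D_{\mathbf{x}}\xrightarrow{j}E_{\mathbf{x}+\mathbf{b}}\xrightarrow{k}D_{\mathbf{x}+\mathbf{b}+\mathbf{c}}\xrightarrow{i}D_{\mathbf{x}+\mathbf{a}+\mathbf{b}+\mathbf{c}}$ is exact for all $\mathbf{x}$. It is regular if $\sigma:=\det[\mathbf{a}\ (\mathbf{b}+\mathbf{c})]\in\{1,-1\}$. A morphism of exact couples with equal bidegrees is a pair of families $D_{\mathbf{x}}(1)\to D_{\mathbf{x}}(2)$, $E_{\mathbf{x}}(1)\to E_{\mathbf{x}}(2)$ of $R$-linear maps commuting with $i,j,k$.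 Put $\mathbf{x}(m)=\sigma m(\mathbf{b}+\mathbf{c})$ for $m\in\mathbb{Z}$; then $\det[\mathbf{a}\ \mathbf{x}]=m$ iff $\mathbf{x}=\mathbf{x}(m)+r\mathbf{a}$ for some $r\in\mathbb{Z}$. Let $D(m)$ be the diagram $r\mapsto D_{\mathbf{x}(m)+r\mathbf{a}}$ ($r\in\mathbb{Z}$, structure maps $i$). Then $L_m:=\operatorname{colim}D(m)$, filtered by $F_{\mathbf{x}}=\operatorname{im}(D_{\mathbf{x}}\to L_m)$, with $\varepsilon_{\mathbf{x}}=F_{\mathbf{x}}/F_{\mathbf{x}-\mathbf{a}}$; and $L^m:=\lim D(m)$, filtered by $F^{\mathbf{x}}=\ker(L^m\to D_{\mathbf{x}})$, with $\varepsilon^{\mathbf{x}}=F^{\mathbf{x}+\mathbf{a}}/F^{\mathbf{x}}$. The map $L^m\to L_m$ is the composite $L^m\to D_{\mathbf{x}}\to L_m$ for any $\mathbf{x}$ with $\det[\mathbf{a}\ \mathbf{x}]=m$. $\lim_r$, $\lim^1_r$ denote the limit and its first derived functor for $\mathbb{Z}$-indexed diagrams. Morphisms of exact couples induce maps on all these objects. With $i^r_{\mathbf{x}}:D_{\mathbf{x}}\to D_{\mathbf{x}+r\mathbf{a}}$ the $r$-fold composite of $i$: $Z^r_{\mathbf{x}+\mathbf{b}}=k^{-1}(\operatorname{im}\,i^r_{\mathbf{x}+\mathbf{b}+\mathbf{c}-r\mathbf{a}})$, $B^r_{\mathbf{x}+\mathbf{b}}=j(\ker i^r_{\mathbf{x}})$,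 $B^\infty=\bigcup_rB^r$, $E^\infty_{\mathbf{x}+\mathbf{b}}=\bigcap_rZ^r_{\mathbf{x}+\mathbf{b}}/B^\infty_{\mathbf{x}+\mathbf{b}}$. For ordinals $\tau$ let $I^0_{\mathbf{x}}=D_{\mathbf{x}}$, $I^{\tau+1}_{\mathbf{x}}=i(I^\tau_{\mathbf{x}-\mathbf{a}})$, and intersections at limit ordinals; let $\bar{I}_{\mathbf{x}}$ be the value of $I^\tau_{\mathbf{x}}$ for all sufficiently large $\tau$. The stable $E$-object is $\bar{E}_{\mathbf{x}+\mathbf{b}}=k^{-1}(\bar{I}_{\mathbf{x}+\mathbf{b}+\mathbf{c}})/B^\infty_{\mathbf{x}+\mathbf{b}}\subseteq E^\infty_{\mathbf{x}+\mathbf{b}}$, and $E^\infty_{\mathbf{x}+\mathbf{b}}$ is called stable if this inclusion is an equality. *)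

theory Defs
  imports "HOL-Algebra.Module" "HOL-Algebra.AbelCoset" "HOL-Library.Product_Plus"
begin

section \<open>Modules over a unital ring\<close>

text \<open>The library's locale \<^locale>\<open>module\<close> asks for a commutative ring; the following is the same
  notion (left modules) over an arbitrary unital ring, on the same record type.\<close>

locale left_module = R?: ring R + M?: abelian_group M
  for R :: "('r, 't) ring_scheme" (structure) and M :: "('r, 'm) module" (structure) +
  assumes smult_closed: "\<lbrakk>a \<in> carrier R; x \<in> carrier M\<rbrakk> \<Longrightarrow> a \<odot>\<^bsub>M\<^esub> x \<in> carrier M"
    and smult_l_distr: "\<lbrakk>a \<in> carrier R; b \<in> carrier R; x \<in> carrier M\<rbrakk> \<Longrightarrow>
      (a \<oplus> b) \<odot>\<^bsub>M\<^esub> x = a \<odot>\<^bsub>M\<^esub> x \<oplus>\<^bsub>M\<^esub> b \<odot>\<^bsub>M\<^esub> x"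
    and smult_r_distr: "\<lbrakk>a \<in> carrier R; x \<in> carrier M; y \<in> carrier M\<rbrakk> \<Longrightarrow>
      a \<odot>\<^bsub>M\<^esub> (x \<oplus>\<^bsub>M\<^esub> y) = a \<odot>\<^bsub>M\<^esub> x \<oplus>\<^bsub>M\<^esub> a \<odot>\<^bsub>M\<^esub> y"
    and smult_assoc1: "\<lbrakk>a \<in> carrier R; b \<in> carrier R; x \<in> carrier M\<rbrakk> \<Longrightarrow>
      (a \<otimes> b) \<odot>\<^bsub>M\<^esub> x = a \<odot>\<^bsub>M\<^esub> (b \<odot>\<^bsub>M\<^esub> x)"
    and smult_one: "x \<in> carrier M \<Longrightarrow> \<one> \<odot>\<^bsub>M\<^esub> x = x"

definition mod_hom ::
  "('r, 't) ring_scheme \<Rightarrow> ('r, 'm) module \<Rightarrow> ('r, 'n) module \<Rightarrow> ('m \<Rightarrow> 'n) \<Rightarrow> bool" where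
  "mod_hom R M N h \<longleftrightarrow>
     (\<forall>x\<in>carrier M. h x \<in> carrier N) \<and>
     (\<forall>x\<in>carrier M. \<forall>y\<in>carrier M. h (x \<oplus>\<^bsub>M\<^esub> y) = h x \<oplus>\<^bsub>N\<^esub> h y) \<and>
     (\<forall>a\<in>carrier R. \<forall>x\<in>carrier M. h (a \<odot>\<^bsub>M\<^esub> x) = a \<odot>\<^bsub>N\<^esub> h x)"

definition mod_mono ::
  "('r, 't) ring_scheme \<Rightarrow> ('r, 'm) module \<Rightarrow> ('r, 'n) module \<Rightarrow> ('m \<Rightarrow> 'n) \<Rightarrow> bool" where
  "mod_mono R M N h \<longleftrightarrow> mod_hom R M N h \<and> inj_on h (carrier M)"

definition mod_epi ::
  "('r, 't) ring_scheme \<Rightarrow> ('r, 'm) module \<Rightarrow> ('r, 'n) module \<Rightarrow> ('m \<Rightarrow> 'n) \<Rightarrow> bool" where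
  "mod_epi R M N h \<longleftrightarrow> mod_hom R M N h \<and> h ` carrier M = carrier N"

definition mod_iso ::
  "('r, 't) ring_scheme \<Rightarrow> ('r, 'm) module \<Rightarrow> ('r, 'n) module \<Rightarrow> ('m \<Rightarrow> 'n) \<Rightarrow> bool" where
  "mod_iso R M N h \<longleftrightarrow> mod_hom R M N h \<and> bij_betw h (carrier M) (carrier N)"

abbreviation restrict_mod :: "('r, 'm) module \<Rightarrow> 'm set \<Rightarrow> ('r, 'm) module" where
  "restrict_mod M S \<equiv> M\<lparr>carrier := S\<rparr>"

text \<open>The fields \<open>mult\<close> and \<open>one\<close> come with the record type but play no role for modules.\<close>

definition quot_mod :: "('r, 'm) module \<Rightarrow> 'm set \<Rightarrow> ('r, 'm set) module" where
  "quot_mod M N = \<lparr>carrier = a_rcosets\<^bsub>M\<^esub> N, mult = (\<lambda>_ _. undefined), one = undefined,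
     zero = N, add = set_add M, smult = (\<lambda>a X. \<Union>x\<in>X. N +>\<^bsub>M\<^esub> (a \<odot>\<^bsub>M\<^esub> x))\<rparr>"

text \<open>The map \<open>M/N \<rightarrow> M'/N'\<close> induced by \<open>h : M \<rightarrow> M'\<close> with \<open>h(N) \<subseteq> N'\<close>: all cosets in the union
  are equal.\<close>

definition quot_map :: "('r, 'n) module \<Rightarrow> 'n set \<Rightarrow> ('m \<Rightarrow> 'n) \<Rightarrow> 'm set \<Rightarrow> 'n set" where
  "quot_map M' N' h X = (\<Union>x\<in>X. N' +>\<^bsub>M'\<^esub> h x)"


section \<open>Diagrams of modules indexed by the ordered set of integers\<close>

text \<open>A diagram consists of modules \<open>A r\<close> and maps \<open>g r : A r \<rightarrow> A (r + 1)\<close>.\<close>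

definition diagram ::
  "('r, 't) ring_scheme \<Rightarrow> (int \<Rightarrow> ('r, 'm) module) \<Rightarrow> (int \<Rightarrow> 'm \<Rightarrow> 'm) \<Rightarrow> bool" where
  "diagram R A g \<longleftrightarrow> (\<forall>r. left_module R (A r)) \<and> (\<forall>r. mod_hom R (A r) (A (r + 1)) (g r))"

definition diagram_hom ::
  "('r, 't) ring_scheme \<Rightarrow> (int \<Rightarrow> ('r, 'm) module) \<Rightarrow> (int \<Rightarrow> 'm \<Rightarrow> 'm) \<Rightarrow>
   (int \<Rightarrow> ('r, 'n) module) \<Rightarrow> (int \<Rightarrow> 'n \<Rightarrow> 'n) \<Rightarrow> (int \<Rightarrow> 'm \<Rightarrow> 'n) \<Rightarrow> bool" where
  "diagram_hom R A g B h f \<longleftrightarrow> (\<forall>r. mod_hom R (A r) (B r) (f r)) \<and>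
     (\<forall>r. \<forall>x\<in>carrier (A r). f (r + 1) (g r x) = h r (f r x))"

primrec trans_map :: "(int \<Rightarrow> 'm \<Rightarrow> 'm) \<Rightarrow> int \<Rightarrow> nat \<Rightarrow> 'm \<Rightarrow> 'm" where
  "trans_map g r 0 x = x"
| "trans_map g r (Suc p) x = g (r + int p) (trans_map g r p x)"

text \<open>The colimit is the set of germs. \<open>colim_in A g r x\<close> is the germ of \<open>x \<in> A r\<close>, that is, the set
  of all \<open>(s, y)\<close> such that \<open>x\<close> and \<open>y\<close> have the same image in some \<open>A t\<close>, \<open>t \<ge> r, s\<close>.\<close>

definition colim_in ::
  "(int \<Rightarrow> ('r, 'm) module) \<Rightarrow> (int \<Rightarrow> 'm \<Rightarrow> 'm) \<Rightarrow> int \<Rightarrow> 'm \<Rightarrow> (int \<times> 'm) set" where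
  "colim_in A g r x = {(s, y). y \<in> carrier (A s) \<and>
     (\<exists>p q. r + int p = s + int q \<and> trans_map g r p x = trans_map g s q y)}"

definition colim_mod ::
  "(int \<Rightarrow> ('r, 'm) module) \<Rightarrow> (int \<Rightarrow> 'm \<Rightarrow> 'm) \<Rightarrow> ('r, (int \<times> 'm) set) module" where
  "colim_mod A g = \<lparr>carrier = (\<Union>r. colim_in A g r ` carrier (A r)),
     mult = (\<lambda>_ _. undefined), one = undefined,
     zero = colim_in A g 0 \<zero>\<^bsub>A 0\<^esub>,
     add = (\<lambda>X Y. \<Union>{colim_in A g r (x \<oplus>\<^bsub>A r\<^esub> y) | r x y. (r, x) \<in> X \<and> (r, y) \<in> Y}),
     smult = (\<lambda>a X. \<Union>{colim_in A g r (a \<odot>\<^bsub>A r\<^esub> x) | r x. (r, x) \<in> X})\<rparr>"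

definition colim_map ::
  "(int \<Rightarrow> ('r, 'n) module) \<Rightarrow> (int \<Rightarrow> 'n \<Rightarrow> 'n) \<Rightarrow> (int \<Rightarrow> 'm \<Rightarrow> 'n) \<Rightarrow>
   (int \<times> 'm) set \<Rightarrow> (int \<times> 'n) set" where
  "colim_map B h f X = \<Union>{colim_in B h r (f r x) | r x. (r, x) \<in> X}"

definition prod_mod :: "(int \<Rightarrow> ('r, 'm) module) \<Rightarrow> ('r, int \<Rightarrow> 'm) module" where
  "prod_mod A = \<lparr>carrier = {\<phi>. \<forall>r. \<phi> r \<in> carrier (A r)},
     mult = (\<lambda>_ _. undefined), one = undefined,
     zero = (\<lambda>r. \<zero>\<^bsub>A r\<^esub>),
     add = (\<lambda>\<phi> \<psi> r. \<phi> r \<oplus>\<^bsub>A r\<^esub> \<psi> r),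
     smult = (\<lambda>a \<phi> r. a \<odot>\<^bsub>A r\<^esub> \<phi> r)\<rparr>"

definition lim_mod ::
  "(int \<Rightarrow> ('r, 'm) module) \<Rightarrow> (int \<Rightarrow> 'm \<Rightarrow> 'm) \<Rightarrow> ('r, int \<Rightarrow> 'm) module" where
  "lim_mod A g = restrict_mod (prod_mod A)
     {\<phi> \<in> carrier (prod_mod A). \<forall>r. g r (\<phi> r) = \<phi> (r + 1)}"

definition lim_map :: "(int \<Rightarrow> 'm \<Rightarrow> 'n) \<Rightarrow> (int \<Rightarrow> 'm) \<Rightarrow> int \<Rightarrow> 'n" where
  "lim_map f \<phi> = (\<lambda>r. f r (\<phi> r))"

text \<open>\<open>lim\<^sup>1\<close> is the cokernel of the difference map on the product, whose kernel is the limit. That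
  this is the first right derived functor of the limit is theorem \<open>lim1_derived\<close> below.\<close>

definition lim_diff ::
  "(int \<Rightarrow> ('r, 'm) module) \<Rightarrow> (int \<Rightarrow> 'm \<Rightarrow> 'm) \<Rightarrow> (int \<Rightarrow> 'm) \<Rightarrow> int \<Rightarrow> 'm" where
  "lim_diff A g \<phi> = (\<lambda>r. \<phi> r \<ominus>\<^bsub>A r\<^esub> g (r - 1) (\<phi> (r - 1)))"

definition lim_bound :: "(int \<Rightarrow> ('r, 'm) module) \<Rightarrow> (int \<Rightarrow> 'm \<Rightarrow> 'm) \<Rightarrow> (int \<Rightarrow> 'm) set" where
  "lim_bound A g = lim_diff A g ` carrier (prod_mod A)"

definition lim1_mod ::
  "(int \<Rightarrow> ('r, 'm) module) \<Rightarrow> (int \<Rightarrow> 'm \<Rightarrow> 'm) \<Rightarrow> ('r, (int \<Rightarrow> 'm) set) module" where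
  "lim1_mod A g = quot_mod (prod_mod A) (lim_bound A g)"

definition lim1_map ::
  "(int \<Rightarrow> ('r, 'n) module) \<Rightarrow> (int \<Rightarrow> 'n \<Rightarrow> 'n) \<Rightarrow> (int \<Rightarrow> 'm \<Rightarrow> 'n) \<Rightarrow>
   (int \<Rightarrow> 'm) set \<Rightarrow> (int \<Rightarrow> 'n) set" where
  "lim1_map B h f = quot_map (prod_mod B) (lim_bound B h) (lim_map f)"


section \<open>Exact couples\<close>

type_synonym bideg = "int \<times> int"

definition zscale :: "int \<Rightarrow> bideg \<Rightarrow> bideg" where
  "zscale m x = (m * fst x, m * snd x)"

definition det2 :: "bideg \<Rightarrow> bideg \<Rightarrow> int" where
  "det2 x y = fst x * snd y - snd x * fst y"

record ('r, 'd, 'e) exact_couple =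
  deg_a :: bideg
  deg_b :: bideg
  deg_c :: bideg
  obj_D :: "bideg \<Rightarrow> ('r, 'd) module"
  obj_E :: "bideg \<Rightarrow> ('r, 'e) module"
  map_i :: "bideg \<Rightarrow> 'd \<Rightarrow> 'd"
  map_j :: "bideg \<Rightarrow> 'd \<Rightarrow> 'e"
  map_k :: "bideg \<Rightarrow> 'e \<Rightarrow> 'd"

definition exact_couple :: "('r, 't) ring_scheme \<Rightarrow> ('r, 'd, 'e) exact_couple \<Rightarrow> bool" where
  "exact_couple R C \<longleftrightarrow>
     (\<forall>x. left_module R (obj_D C x)) \<and> (\<forall>x. left_module R (obj_E C x)) \<and>
     (\<forall>x. mod_hom R (obj_D C x) (obj_D C (x + deg_a C)) (map_i C x)) \<and>
     (\<forall>x. mod_hom R (obj_D C x) (obj_E C (x + deg_b C)) (map_j C x)) \<and>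
     (\<forall>x. mod_hom R (obj_E C x) (obj_D C (x + deg_c C)) (map_k C x)) \<and>
     (\<forall>x. map_i C (x - deg_a C) ` carrier (obj_D C (x - deg_a C))
          = a_kernel (obj_D C x) (obj_E C (x + deg_b C)) (map_j C x)) \<and>
     (\<forall>x. map_j C x ` carrier (obj_D C x)
          = a_kernel (obj_E C (x + deg_b C)) (obj_D C (x + deg_b C + deg_c C)) (map_k C (x + deg_b C))) \<and>
     (\<forall>x. map_k C (x + deg_b C) ` carrier (obj_E C (x + deg_b C))
          = a_kernel (obj_D C (x + deg_b C + deg_c C)) (obj_D C (x + deg_a C + deg_b C + deg_c C))
              (map_i C (x + deg_b C + deg_c C)))"

definition sigma :: "('r, 'd, 'e) exact_couple \<Rightarrow> int" where
  "sigma C = det2 (deg_a C) (deg_b C + deg_c C)"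

definition regular_couple :: "('r, 't) ring_scheme \<Rightarrow> ('r, 'd, 'e) exact_couple \<Rightarrow> bool" where
  "regular_couple R C \<longleftrightarrow> exact_couple R C \<and> sigma C \<in> {1, -1}"

definition couple_hom ::
  "('r, 't) ring_scheme \<Rightarrow> ('r, 'd, 'e) exact_couple \<Rightarrow> ('r, 'd', 'e') exact_couple \<Rightarrow>
   (bideg \<Rightarrow> 'd \<Rightarrow> 'd') \<Rightarrow> (bideg \<Rightarrow> 'e \<Rightarrow> 'e') \<Rightarrow> bool" where
  "couple_hom R C C' fD fE \<longleftrightarrow>
     deg_a C = deg_a C' \<and> deg_b C = deg_b C' \<and> deg_c C = deg_c C' \<and>
     (\<forall>x. mod_hom R (obj_D C x) (obj_D C' x) (fD x)) \<and>
     (\<forall>x. mod_hom R (obj_E C x) (obj_E C' x) (fE x)) \<and>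
     (\<forall>x. \<forall>d\<in>carrier (obj_D C x). fD (x + deg_a C) (map_i C x d) = map_i C' x (fD x d)) \<and>
     (\<forall>x. \<forall>d\<in>carrier (obj_D C x). fE (x + deg_b C) (map_j C x d) = map_j C' x (fD x d)) \<and>
     (\<forall>x. \<forall>e\<in>carrier (obj_E C x). fD (x + deg_c C) (map_k C x e) = map_k C' x (fE x e))"


subsection \<open>Limit and colimit abutments and their filtrations\<close>

text \<open>\<open>grid C m r\<close> is the point \<open>x(m) + r a\<close>; below, the objects belonging to it are indexed by the
  pair \<open>m, r\<close>.\<close>

definition grid :: "('r, 'd, 'e) exact_couple \<Rightarrow> int \<Rightarrow> int \<Rightarrow> bideg" where
  "grid C m r = zscale (sigma C * m) (deg_b C + deg_c C) + zscale r (deg_a C)"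

definition Dd :: "('r, 'd, 'e) exact_couple \<Rightarrow> int \<Rightarrow> int \<Rightarrow> ('r, 'd) module" where
  "Dd C m r = obj_D C (grid C m r)"

definition Di :: "('r, 'd, 'e) exact_couple \<Rightarrow> int \<Rightarrow> int \<Rightarrow> 'd \<Rightarrow> 'd" where
  "Di C m r = map_i C (grid C m r)"

definition Lco :: "('r, 'd, 'e) exact_couple \<Rightarrow> int \<Rightarrow> ('r, (int \<times> 'd) set) module" where
  "Lco C m = colim_mod (Dd C m) (Di C m)"

definition Lco_map ::
  "('r, 'd, 'e) exact_couple \<Rightarrow> ('r, 'd', 'e') exact_couple \<Rightarrow> (bideg \<Rightarrow> 'd \<Rightarrow> 'd') \<Rightarrow> int \<Rightarrow>
   (int \<times> 'd) set \<Rightarrow> (int \<times> 'd') set" where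
  "Lco_map C C' fD m = colim_map (Dd C' m) (Di C' m) (\<lambda>r. fD (grid C m r))"

definition Lli :: "('r, 'd, 'e) exact_couple \<Rightarrow> int \<Rightarrow> ('r, int \<Rightarrow> 'd) module" where
  "Lli C m = lim_mod (Dd C m) (Di C m)"

definition Lli_map ::
  "('r, 'd, 'e) exact_couple \<Rightarrow> (bideg \<Rightarrow> 'd \<Rightarrow> 'd') \<Rightarrow> int \<Rightarrow> (int \<Rightarrow> 'd) \<Rightarrow> int \<Rightarrow> 'd'" where
  "Lli_map C fD m = lim_map (\<lambda>r. fD (grid C m r))"

definition Fco_set :: "('r, 'd, 'e) exact_couple \<Rightarrow> int \<Rightarrow> int \<Rightarrow> (int \<times> 'd) set set" where
  "Fco_set C m r = colim_in (Dd C m) (Di C m) r ` carrier (Dd C m r)"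

definition Fco :: "('r, 'd, 'e) exact_couple \<Rightarrow> int \<Rightarrow> int \<Rightarrow> ('r, (int \<times> 'd) set) module" where
  "Fco C m r = restrict_mod (Lco C m) (Fco_set C m r)"

text \<open>The structure maps of the diagram \<open>r \<mapsto> F\<^bsub>x(m) + r a\<^esub>\<close> are the inclusions.\<close>

definition Fco_incl :: "int \<Rightarrow> (int \<times> 'd) set \<Rightarrow> (int \<times> 'd) set" where
  "Fco_incl r z = z"

definition eps_co ::
  "('r, 'd, 'e) exact_couple \<Rightarrow> int \<Rightarrow> int \<Rightarrow> ('r, (int \<times> 'd) set set) module" where
  "eps_co C m r = quot_mod (Fco C m r) (Fco_set C m (r - 1))"

definition eps_co_map ::
  "('r, 'd, 'e) exact_couple \<Rightarrow> ('r, 'd', 'e') exact_couple \<Rightarrow> (bideg \<Rightarrow> 'd \<Rightarrow> 'd') \<Rightarrow>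
   int \<Rightarrow> int \<Rightarrow> (int \<times> 'd) set set \<Rightarrow> (int \<times> 'd') set set" where
  "eps_co_map C C' fD m r = quot_map (Fco C' m r) (Fco_set C' m (r - 1)) (Lco_map C C' fD m)"

definition Fli_set :: "('r, 'd, 'e) exact_couple \<Rightarrow> int \<Rightarrow> int \<Rightarrow> (int \<Rightarrow> 'd) set" where
  "Fli_set C m r = a_kernel (Lli C m) (Dd C m r) (\<lambda>\<phi>. \<phi> r)"

definition Fli :: "('r, 'd, 'e) exact_couple \<Rightarrow> int \<Rightarrow> int \<Rightarrow> ('r, int \<Rightarrow> 'd) module" where
  "Fli C m r = restrict_mod (Lli C m) (Fli_set C m r)"

definition eps_li ::
  "('r, 'd, 'e) exact_couple \<Rightarrow> int \<Rightarrow> int \<Rightarrow> ('r, (int \<Rightarrow> 'd) set) module" where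
  "eps_li C m r = quot_mod (Fli C m (r + 1)) (Fli_set C m r)"

definition eps_li_map ::
  "('r, 'd, 'e) exact_couple \<Rightarrow> ('r, 'd', 'e') exact_couple \<Rightarrow> (bideg \<Rightarrow> 'd \<Rightarrow> 'd') \<Rightarrow>
   int \<Rightarrow> int \<Rightarrow> (int \<Rightarrow> 'd) set \<Rightarrow> (int \<Rightarrow> 'd') set" where
  "eps_li_map C C' fD m r = quot_map (Fli C' m (r + 1)) (Fli_set C' m r) (Lli_map C fD m)"

text \<open>The map from the limit to the colimit, through \<open>D\<^bsub>x(m) + 0 a\<^esub>\<close>; see \<open>li_to_co_indep\<close> for the
  independence of the choice.\<close>

definition li_to_co :: "('r, 'd, 'e) exact_couple \<Rightarrow> int \<Rightarrow> (int \<Rightarrow> 'd) \<Rightarrow> (int \<times> 'd) set" where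
  "li_to_co C m \<phi> = colim_in (Dd C m) (Di C m) 0 (\<phi> 0)"

definition im_li_co :: "('r, 'd, 'e) exact_couple \<Rightarrow> int \<Rightarrow> ('r, (int \<times> 'd) set) module" where
  "im_li_co C m = restrict_mod (Lco C m) (li_to_co C m ` carrier (Lli C m))"


subsection \<open>Cycles, boundaries and the limit page\<close>

primrec ipow :: "('r, 'd, 'e) exact_couple \<Rightarrow> nat \<Rightarrow> bideg \<Rightarrow> 'd \<Rightarrow> 'd" where
  "ipow C 0 x d = d"
| "ipow C (Suc r) x d = map_i C (x + zscale (int r) (deg_a C)) (ipow C r x d)"

text \<open>In the following, \<open>y\<close> is the index written \<open>x + b\<close> in the literature.\<close>

definition Zcyc :: "('r, 'd, 'e) exact_couple \<Rightarrow> nat \<Rightarrow> bideg \<Rightarrow> 'e set" where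
  "Zcyc C r y = {e \<in> carrier (obj_E C y).
     map_k C y e \<in> ipow C r (y + deg_c C - zscale (int r) (deg_a C)) `
                  carrier (obj_D C (y + deg_c C - zscale (int r) (deg_a C)))}"

definition Bbd :: "('r, 'd, 'e) exact_couple \<Rightarrow> nat \<Rightarrow> bideg \<Rightarrow> 'e set" where
  "Bbd C r y = map_j C (y - deg_b C) `
     a_kernel (obj_D C (y - deg_b C)) (obj_D C (y - deg_b C + zscale (int r) (deg_a C)))
       (ipow C r (y - deg_b C))"

definition Binf :: "('r, 'd, 'e) exact_couple \<Rightarrow> bideg \<Rightarrow> 'e set" where
  "Binf C y = (\<Union>r. Bbd C r y)"

definition Zinf :: "('r, 'd, 'e) exact_couple \<Rightarrow> bideg \<Rightarrow> 'e set" where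
  "Zinf C y = (\<Inter>r. Zcyc C r y)"

definition Einf :: "('r, 'd, 'e) exact_couple \<Rightarrow> bideg \<Rightarrow> ('r, 'e set) module" where
  "Einf C y = quot_mod (restrict_mod (obj_E C y) (Zinf C y)) (Binf C y)"

definition Einf_map ::
  "('r, 'd', 'e') exact_couple \<Rightarrow> (bideg \<Rightarrow> 'e \<Rightarrow> 'e') \<Rightarrow> bideg \<Rightarrow> 'e set \<Rightarrow> 'e' set" where
  "Einf_map C' fE y = quot_map (restrict_mod (obj_E C' y) (Zinf C' y)) (Binf C' y) (fE y)"


subsection \<open>The transfinite image filtration and the stable page\<close>

text \<open>Ordinals are the elements of the successor cardinal of the set of all pairs \<open>(x, d)\<close>, with
  its well-order \<open>ords\<close>. A descending family of subsets of the \<open>D\<^sub>x\<close> is constant from some such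
  ordinal on (theorem \<open>Iord_stabilizes\<close>), so larger ordinals contribute nothing.\<close>

type_synonym 'd ord = "(bideg \<times> 'd) suc"

definition ords :: "'d ord rel" where
  "ords = card_suc (card_of (UNIV :: (bideg \<times> 'd) set))"

definition is_pred :: "'o rel \<Rightarrow> 'o \<Rightarrow> 'o \<Rightarrow> bool" where
  "is_pred W \<rho> \<tau> \<longleftrightarrow> \<rho> \<in> underS W \<tau> \<and> (\<forall>\<upsilon>\<in>underS W \<tau>. (\<upsilon>, \<rho>) \<in> W)"

definition Iord_step ::
  "('r, 'd, 'e) exact_couple \<Rightarrow> ('d ord \<Rightarrow> bideg \<Rightarrow> 'd set) \<Rightarrow> 'd ord \<Rightarrow> bideg \<Rightarrow> 'd set" where
  "Iord_step C I \<tau> x =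
     (if underS ords \<tau> = {} then carrier (obj_D C x)
      else if \<exists>\<rho>. is_pred ords \<rho> \<tau> then map_i C (x - deg_a C) ` I (THE \<rho>. is_pred ords \<rho> \<tau>) (x - deg_a C)
      else (\<Inter>\<rho>\<in>underS ords \<tau>. I \<rho> x))"

definition Iord :: "('r, 'd, 'e) exact_couple \<Rightarrow> 'd ord \<Rightarrow> bideg \<Rightarrow> 'd set" where
  "Iord C = wo_rel.worec ords (Iord_step C)"

definition Ibar :: "('r, 'd, 'e) exact_couple \<Rightarrow> bideg \<Rightarrow> 'd set" where
  "Ibar C x = (THE S. \<exists>\<tau>\<^sub>0. \<forall>\<tau>. (\<tau>\<^sub>0, \<tau>) \<in> ords \<longrightarrow> Iord C \<tau> x = S)"

definition Ebar :: "('r, 'd, 'e) exact_couple \<Rightarrow> bideg \<Rightarrow> ('r, 'e set) module" where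
  "Ebar C y = quot_mod (restrict_mod (obj_E C y)
     {e \<in> carrier (obj_E C y). map_k C y e \<in> Ibar C (y + deg_c C)}) (Binf C y)"

definition stable_at :: "('r, 'd, 'e) exact_couple \<Rightarrow> bideg \<Rightarrow> bool" where
  "stable_at C y \<longleftrightarrow> carrier (Ebar C y) = carrier (Einf C y)"


section \<open>Facts about the definitions\<close>

lemma det2_grid:
  assumes "regular_couple R C"
  shows "det2 (deg_a C) x = m \<longleftrightarrow> (\<exists>r. x = grid C m r)"
proof
  obtain a1 a2 where a: "deg_a C = (a1, a2)" by force
  obtain d1 d2 where d: "deg_b C + deg_c C = (d1, d2)" by force
  have s: "sigma C = a1 * d2 - a2 * d1" "sigma C * sigma C = 1"
    using assms by (auto simp: regular_couple_def sigma_def det2_def a d)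
  {
    assume "det2 (deg_a C) x = m"
    then have m: "m = a1 * snd x - a2 * fst x" by (simp add: det2_def a)
    have "sigma C * m * d1 + sigma C * (fst x * d2 - snd x * d1) * a1 = sigma C * sigma C * fst x"
      unfolding m by (subst (3) s(1)) (simp add: algebra_simps)
    moreover have "sigma C * m * d2 + sigma C * (fst x * d2 - snd x * d1) * a2 = sigma C * sigma C * snd x"
      unfolding m by (subst (3) s(1)) (simp add: algebra_simps)
    ultimately have "x = grid C m (sigma C * (fst x * d2 - snd x * d1))"
      by (simp add: grid_def zscale_def a d s(2) prod_eq_iff)
    then show "\<exists>r. x = grid C m r" ..
  next
    assume "\<exists>r. x = grid C m r"
    then obtain r where "x = grid C m r" ..
    then have "det2 (deg_a C) x = sigma C * m * (a1 * d2 - a2 * d1)"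
      by (simp add: grid_def zscale_def det2_def a d algebra_simps)
    also have "\<dots> = sigma C * sigma C * m" by (simp add: s(1)[symmetric])
    finally show "det2 (deg_a C) x = m" by (simp add: s(2))
  }
qed

subsection \<open>Colimits and quotients\<close>

lemma mod_hom_closed: "mod_hom R M N h \<Longrightarrow> x \<in> carrier M \<Longrightarrow> h x \<in> carrier N"
  by (simp add: mod_hom_def)

lemma mod_hom_add: "mod_hom R M N h \<Longrightarrow> x \<in> carrier M \<Longrightarrow> y \<in> carrier M \<Longrightarrow>
    h (x \<oplus>\<^bsub>M\<^esub> y) = h x \<oplus>\<^bsub>N\<^esub> h y"
  by (simp add: mod_hom_def)

lemma mod_hom_smult: "mod_hom R M N h \<Longrightarrow> a \<in> carrier R \<Longrightarrow> x \<in> carrier M \<Longrightarrow>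
    h (a \<odot>\<^bsub>M\<^esub> x) = a \<odot>\<^bsub>N\<^esub> h x"
  by (simp add: mod_hom_def)

lemma left_module_abelian: "left_module R M \<Longrightarrow> abelian_group M"
  by (simp add: left_module_def)

lemma mod_hom_zero:
  assumes "left_module R M" "left_module R N" "mod_hom R M N h"
  shows "h \<zero>\<^bsub>M\<^esub> = \<zero>\<^bsub>N\<^esub>"
proof -
  interpret M: abelian_group M using assms(1) by (rule left_module_abelian)
  interpret N: abelian_group N using assms(2) by (rule left_module_abelian)
  have "h \<zero>\<^bsub>M\<^esub> \<oplus>\<^bsub>N\<^esub> h \<zero>\<^bsub>M\<^esub> = h \<zero>\<^bsub>M\<^esub>"
    using mod_hom_add[OF assms(3), of "\<zero>\<^bsub>M\<^esub>" "\<zero>\<^bsub>M\<^esub>"] by simp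
  then show ?thesis
    using mod_hom_closed[OF assms(3) M.zero_closed] by (metis N.add.l_cancel_one')
qed

lemma mod_hom_minus:
  assumes "left_module R M" "left_module R N" "mod_hom R M N h"
    and "x \<in> carrier M" "y \<in> carrier M"
  shows "h (x \<ominus>\<^bsub>M\<^esub> y) = h x \<ominus>\<^bsub>N\<^esub> h y"
proof -
  interpret M: abelian_group M using assms(1) by (rule left_module_abelian)
  interpret N: abelian_group N using assms(2) by (rule left_module_abelian)
  have c: "h x \<in> carrier N" "h y \<in> carrier N" "h (\<ominus>\<^bsub>M\<^esub> y) \<in> carrier N"
    using assms by (auto intro: mod_hom_closed)
  have "h y \<oplus>\<^bsub>N\<^esub> h (\<ominus>\<^bsub>M\<^esub> y) = \<zero>\<^bsub>N\<^esub>"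
    using mod_hom_add[OF assms(3), of y "\<ominus>\<^bsub>M\<^esub> y"] assms(5) mod_hom_zero[OF assms(1-3)]
    by (simp add: M.r_neg)
  then have "h (\<ominus>\<^bsub>M\<^esub> y) = \<ominus>\<^bsub>N\<^esub> h y" using c by (metis N.minus_equality N.add.m_comm)
  then show ?thesis
    using mod_hom_add[OF assms(3,4), of "\<ominus>\<^bsub>M\<^esub> y"] assms(5) by (simp add: a_minus_def)
qed

lemma trans_map_add: "trans_map g r (p + q) x = trans_map g (r + int p) q (trans_map g r p x)"
  by (induction q) (simp_all add: add.assoc)

lemma trans_map_closed:
  "diagram R A g \<Longrightarrow> x \<in> carrier (A r) \<Longrightarrow> trans_map g r p x \<in> carrier (A (r + int p))"
proof (induction p)
  case (Suc p)
  then have "g (r + int p) (trans_map g r p x) \<in> carrier (A (r + int p + 1))"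
    unfolding diagram_def by (meson mod_hom_closed)
  then show ?case by (simp add: ac_simps)
qed simp

lemma trans_map_hom:
  assumes "diagram R A g"
  shows "mod_hom R (A r) (A (r + int p)) (trans_map g r p)"
proof (induction p)
  case 0
  show ?case by (simp add: mod_hom_def)
next
  case (Suc p)
  have "mod_hom R (A (r + int p)) (A (r + int p + 1)) (g (r + int p))"
    using assms by (simp add: diagram_def)
  with Suc show ?case by (simp add: mod_hom_def ac_simps)
qed

lemma colim_in_self: "x \<in> carrier (A r) \<Longrightarrow> (r, x) \<in> colim_in A g r x"
  by (auto simp: colim_in_def)

lemma colim_in_subset:
  assumes "r + int p = s + int q" "trans_map g r p x = trans_map g s q y"
  shows "colim_in A g s y \<subseteq> colim_in A g r x"
proof (clarsimp simp: colim_in_def)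
  fix t z p' q'
  assume z: "z \<in> carrier (A t)" and e: "s + int p' = t + int q'"
    and t: "trans_map g s p' y = trans_map g t q' z"
  have "trans_map g r (p + p') x = trans_map g (s + int q) p' (trans_map g s q y)"
    using assms by (simp add: trans_map_add)
  also have "\<dots> = trans_map g s (p' + q) y" by (simp add: trans_map_add[symmetric] add.commute)
  also have "\<dots> = trans_map g t (q' + q) z"
    using e t by (simp add: trans_map_add)
  finally have "r + int (p + p') = t + int (q' + q) \<and>
      trans_map g r (p + p') x = trans_map g t (q' + q) z"
    using assms(1) e by simp
  then show "\<exists>p q. r + int p = t + int q \<and> trans_map g r p x = trans_map g t q z" by blast
qed

lemma colim_in_eq_iff:
  assumes "x \<in> carrier (A r)" "y \<in> carrier (A s)"
  shows "colim_in A g r x = colim_in A g s y \<longleftrightarrow>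
    (\<exists>p q. r + int p = s + int q \<and> trans_map g r p x = trans_map g s q y)"
proof
  assume "colim_in A g r x = colim_in A g s y"
  then have "(s, y) \<in> colim_in A g r x" using colim_in_self[where A = A and r = s, OF assms(2)] by simp
  then show "\<exists>p q. r + int p = s + int q \<and> trans_map g r p x = trans_map g s q y"
    by (simp add: colim_in_def)
next
  assume "\<exists>p q. r + int p = s + int q \<and> trans_map g r p x = trans_map g s q y"
  then obtain p q where "r + int p = s + int q" "trans_map g r p x = trans_map g s q y" by blast
  then show "colim_in A g r x = colim_in A g s y"
    using colim_in_subset[of r p s q g x y A] colim_in_subset[of s q r p g y x A] by simp
qed

lemma colim_in_shift:
  assumes "diagram R A g" "x \<in> carrier (A r)"
  shows "colim_in A g (r + 1) (g r x) = colim_in A g r x"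
proof -
  have "g r x \<in> carrier (A (r + 1))" using assms unfolding diagram_def by (meson mod_hom_closed)
  moreover have "\<exists>p q. r + int p = r + 1 + int q \<and> trans_map g r p x = trans_map g (r + 1) q (g r x)"
    by (intro exI[of _ "Suc 0"] exI[of _ 0]) simp
  ultimately show ?thesis
    using colim_in_eq_iff[where A = A and r = r and s = "r + 1" and g = g, OF assms(2)] by metis
qed

lemma colim_in_hom:
  assumes d: "diagram R A g"
  shows "mod_hom R (A r) (colim_mod A g) (colim_in A g r)"
  unfolding mod_hom_def
proof (intro conjI ballI)
  show "colim_in A g r x \<in> carrier (colim_mod A g)" if "x \<in> carrier (A r)" for x
    using that by (auto simp: colim_mod_def)
next
  fix x y assume x: "x \<in> carrier (A r)" and y: "y \<in> carrier (A r)"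
  have mod: "left_module R (A s)" for s using d by (simp add: diagram_def)
  have "colim_in A g s (x' \<oplus>\<^bsub>A s\<^esub> y') = colim_in A g r (x \<oplus>\<^bsub>A r\<^esub> y)"
    if x': "(s, x') \<in> colim_in A g r x" and y': "(s, y') \<in> colim_in A g r y" for s x' y'
  proof -
    from x' obtain p q where p: "r + int p = s + int q" "trans_map g r p x = trans_map g s q x'"
      and cx: "x' \<in> carrier (A s)" by (auto simp: colim_in_def)
    from y' obtain p' q' where p': "r + int p' = s + int q'" "trans_map g r p' y = trans_map g s q' y'"
      and cy: "y' \<in> carrier (A s)" by (auto simp: colim_in_def)
    have 1: "trans_map g r (p + p') x = trans_map g s (q + p') x'"
      using p by (simp add: trans_map_add)
    have 2: "trans_map g r (p' + p) y = trans_map g s (q' + p) y'"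
      using p' by (simp add: trans_map_add)
    have q: "q' + p = q + p'" using p(1) p'(1) by linarith
    have e: "r + int (p + p') = s + int (q + p')" using p(1) by simp
    have "trans_map g r (p + p') (x \<oplus>\<^bsub>A r\<^esub> y) =
        trans_map g r (p + p') x \<oplus>\<^bsub>A (s + int (q + p'))\<^esub> trans_map g r (p + p') y"
      using mod_hom_add[OF trans_map_hom[OF d, of r "p + p'"] x y] by (simp only: e)
    also have "\<dots> = trans_map g s (q + p') x' \<oplus>\<^bsub>A (s + int (q + p'))\<^esub> trans_map g s (q + p') y'"
      using 1 2 q by (simp only: add.commute[of p' p])
    also have "\<dots> = trans_map g s (q + p') (x' \<oplus>\<^bsub>A s\<^esub> y')"
      using mod_hom_add[OF trans_map_hom[OF d, of s "q + p'"] cx cy] by (simp only:)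
    finally have "trans_map g r (p + p') (x \<oplus>\<^bsub>A r\<^esub> y) = trans_map g s (q + p') (x' \<oplus>\<^bsub>A s\<^esub> y')" .
    moreover have "x \<oplus>\<^bsub>A r\<^esub> y \<in> carrier (A r)" "x' \<oplus>\<^bsub>A s\<^esub> y' \<in> carrier (A s)"
      using left_module_abelian[OF mod] x y cx cy
      by (simp_all add: abelian_group_def abelian_monoid.a_closed)
    ultimately show ?thesis using e by (metis colim_in_eq_iff)
  qed
  moreover have "(r, x) \<in> colim_in A g r x" "(r, y) \<in> colim_in A g r y"
    using x y by (auto intro: colim_in_self)
  ultimately have "{colim_in A g s (x' \<oplus>\<^bsub>A s\<^esub> y') |s x' y'. (s, x') \<in> colim_in A g r x \<and>
      (s, y') \<in> colim_in A g r y} = {colim_in A g r (x \<oplus>\<^bsub>A r\<^esub> y)}" by blast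
  then show "colim_in A g r (x \<oplus>\<^bsub>A r\<^esub> y) = colim_in A g r x \<oplus>\<^bsub>colim_mod A g\<^esub> colim_in A g r y"
    by (simp add: colim_mod_def)
next
  fix a x assume a: "a \<in> carrier R" and x: "x \<in> carrier (A r)"
  have mod: "left_module R (A s)" for s using d by (simp add: diagram_def)
  have "colim_in A g s (a \<odot>\<^bsub>A s\<^esub> x') = colim_in A g r (a \<odot>\<^bsub>A r\<^esub> x)"
    if x': "(s, x') \<in> colim_in A g r x" for s x'
  proof -
    from x' obtain p q where p: "r + int p = s + int q" "trans_map g r p x = trans_map g s q x'"
      and cx: "x' \<in> carrier (A s)" by (auto simp: colim_in_def)
    have "trans_map g r p (a \<odot>\<^bsub>A r\<^esub> x) = trans_map g s q (a \<odot>\<^bsub>A s\<^esub> x')"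
      using mod_hom_smult[OF trans_map_hom[OF d, of r p] a x]
        mod_hom_smult[OF trans_map_hom[OF d, of s q] a cx] p by simp
    moreover have "a \<odot>\<^bsub>A r\<^esub> x \<in> carrier (A r)" "a \<odot>\<^bsub>A s\<^esub> x' \<in> carrier (A s)"
      using mod a x cx by (auto intro: left_module.smult_closed)
    ultimately show ?thesis using p(1) by (metis colim_in_eq_iff)
  qed
  moreover have "(r, x) \<in> colim_in A g r x" using x by (auto intro: colim_in_self)
  ultimately have "{colim_in A g s (a \<odot>\<^bsub>A s\<^esub> x') |s x'. (s, x') \<in> colim_in A g r x}
      = {colim_in A g r (a \<odot>\<^bsub>A r\<^esub> x)}" by blast
  then show "colim_in A g r (a \<odot>\<^bsub>A r\<^esub> x) = a \<odot>\<^bsub>colim_mod A g\<^esub> colim_in A g r x"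
    by (simp add: colim_mod_def)
qed

lemma grid_Suc: "grid C m r + deg_a C = grid C m (r + 1)"
  by (simp add: grid_def zscale_def algebra_simps prod_eq_iff)

lemma diagram_D: "exact_couple R C \<Longrightarrow> diagram R (Dd C m) (Di C m)"
  unfolding exact_couple_def diagram_def Dd_def Di_def by (metis grid_Suc)

lemma li_to_co_indep:
  assumes ec: "exact_couple R C" and phi: "\<phi> \<in> carrier (Lli C m)"
  shows "colim_in (Dd C m) (Di C m) r (\<phi> r) = li_to_co C m \<phi>"
proof -
  have c: "\<phi> s \<in> carrier (Dd C m s)" and g: "Di C m s (\<phi> s) = \<phi> (s + 1)" for s
    using phi by (auto simp: Lli_def lim_mod_def prod_mod_def)
  have step: "colim_in (Dd C m) (Di C m) (s + 1) (\<phi> (s + 1)) = colim_in (Dd C m) (Di C m) s (\<phi> s)" for s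
    using colim_in_shift[OF diagram_D[OF ec] c] by (simp add: g)
  have "colim_in (Dd C m) (Di C m) r (\<phi> r) = colim_in (Dd C m) (Di C m) 0 (\<phi> 0)"
    by (induction r rule: int_induct[where k = 0]) (use step[of "_ - 1"] step in auto)
  then show ?thesis by (simp add: li_to_co_def)
qed

lemma left_module_a:
  assumes "left_module R M"
  shows "x \<in> carrier M \<Longrightarrow> y \<in> carrier M \<Longrightarrow> x \<oplus>\<^bsub>M\<^esub> y \<in> carrier M"
    and "\<zero>\<^bsub>M\<^esub> \<in> carrier M"
    and "x \<in> carrier M \<Longrightarrow> \<ominus>\<^bsub>M\<^esub> x \<in> carrier M"
    and "x \<in> carrier M \<Longrightarrow> y \<in> carrier M \<Longrightarrow> x \<ominus>\<^bsub>M\<^esub> y \<in> carrier M"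
    and "a \<in> carrier R \<Longrightarrow> x \<in> carrier M \<Longrightarrow> a \<odot>\<^bsub>M\<^esub> x \<in> carrier M"
proof -
  interpret M: left_module R M by (rule assms)
  show "x \<in> carrier M \<Longrightarrow> y \<in> carrier M \<Longrightarrow> x \<oplus>\<^bsub>M\<^esub> y \<in> carrier M" "\<zero>\<^bsub>M\<^esub> \<in> carrier M"
    "x \<in> carrier M \<Longrightarrow> \<ominus>\<^bsub>M\<^esub> x \<in> carrier M"
    "x \<in> carrier M \<Longrightarrow> y \<in> carrier M \<Longrightarrow> x \<ominus>\<^bsub>M\<^esub> y \<in> carrier M"
    "a \<in> carrier R \<Longrightarrow> x \<in> carrier M \<Longrightarrow> a \<odot>\<^bsub>M\<^esub> x \<in> carrier M"
    by (simp_all add: M.smult_closed)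
qed

lemma left_module_minus:
  assumes "left_module R M"
  shows "\<lbrakk>x \<in> carrier M; y \<in> carrier M; u \<in> carrier M; v \<in> carrier M\<rbrakk> \<Longrightarrow>
      (x \<oplus>\<^bsub>M\<^esub> y) \<ominus>\<^bsub>M\<^esub> (u \<oplus>\<^bsub>M\<^esub> v) = (x \<ominus>\<^bsub>M\<^esub> u) \<oplus>\<^bsub>M\<^esub> (y \<ominus>\<^bsub>M\<^esub> v)"
    and "\<lbrakk>a \<in> carrier R; x \<in> carrier M; u \<in> carrier M\<rbrakk> \<Longrightarrow>
      a \<odot>\<^bsub>M\<^esub> (x \<ominus>\<^bsub>M\<^esub> u) = (a \<odot>\<^bsub>M\<^esub> x) \<ominus>\<^bsub>M\<^esub> (a \<odot>\<^bsub>M\<^esub> u)"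
    and "\<lbrakk>x \<in> carrier M; u \<in> carrier M\<rbrakk> \<Longrightarrow> x \<ominus>\<^bsub>M\<^esub> u = \<zero>\<^bsub>M\<^esub> \<longleftrightarrow> x = u"
    and "\<lbrakk>x \<in> carrier M; u \<in> carrier M\<rbrakk> \<Longrightarrow> x \<ominus>\<^bsub>M\<^esub> (x \<ominus>\<^bsub>M\<^esub> u) = u"
    and "\<lbrakk>x \<in> carrier M; u \<in> carrier M\<rbrakk> \<Longrightarrow> (x \<ominus>\<^bsub>M\<^esub> u) \<oplus>\<^bsub>M\<^esub> u = x"
    and "x \<in> carrier M \<Longrightarrow> x \<ominus>\<^bsub>M\<^esub> \<zero>\<^bsub>M\<^esub> = x"
proof -
  interpret M: left_module R M by (rule assms)
  show add: "(x \<oplus>\<^bsub>M\<^esub> y) \<ominus>\<^bsub>M\<^esub> (u \<oplus>\<^bsub>M\<^esub> v) = (x \<ominus>\<^bsub>M\<^esub> u) \<oplus>\<^bsub>M\<^esub> (y \<ominus>\<^bsub>M\<^esub> v)"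
    if "x \<in> carrier M" "y \<in> carrier M" "u \<in> carrier M" "v \<in> carrier M"
    using that by (simp add: a_minus_def M.minus_add M.a_ac)
  show can: "(x \<ominus>\<^bsub>M\<^esub> u) \<oplus>\<^bsub>M\<^esub> u = x" if "x \<in> carrier M" "u \<in> carrier M" for x u
    using that by (simp add: a_minus_def M.a_assoc M.l_neg)
  have can2: "(x \<oplus>\<^bsub>M\<^esub> u) \<ominus>\<^bsub>M\<^esub> u = x" if "x \<in> carrier M" "u \<in> carrier M" for x u
    using that by (simp add: a_minus_def M.a_assoc M.r_neg)
  show "a \<odot>\<^bsub>M\<^esub> (x \<ominus>\<^bsub>M\<^esub> u) = (a \<odot>\<^bsub>M\<^esub> x) \<ominus>\<^bsub>M\<^esub> (a \<odot>\<^bsub>M\<^esub> u)"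
    if "a \<in> carrier R" "x \<in> carrier M" "u \<in> carrier M"
  proof -
    have "a \<odot>\<^bsub>M\<^esub> x = a \<odot>\<^bsub>M\<^esub> (x \<ominus>\<^bsub>M\<^esub> u) \<oplus>\<^bsub>M\<^esub> a \<odot>\<^bsub>M\<^esub> u"
      using M.smult_r_distr[of a "x \<ominus>\<^bsub>M\<^esub> u" u] that can by simp
    then show ?thesis using that can2 by (simp add: M.smult_closed)
  qed
  show "x \<ominus>\<^bsub>M\<^esub> u = \<zero>\<^bsub>M\<^esub> \<longleftrightarrow> x = u" if "x \<in> carrier M" "u \<in> carrier M"
    using that can[of x u] by (metis M.l_zero M.r_neg a_minus_def)
  show "x \<ominus>\<^bsub>M\<^esub> (x \<ominus>\<^bsub>M\<^esub> u) = u" if "x \<in> carrier M" "u \<in> carrier M"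
    using can2[of u "x \<ominus>\<^bsub>M\<^esub> u"] can[of x u] that M.a_comm by simp
  show "x \<ominus>\<^bsub>M\<^esub> \<zero>\<^bsub>M\<^esub> = x" if "x \<in> carrier M"
    using that by (simp add: a_minus_def)
qed

lemma left_moduleI:
  assumes "ring R" "abelian_group M"
    "\<And>a x. a \<in> carrier R \<Longrightarrow> x \<in> carrier M \<Longrightarrow> a \<odot>\<^bsub>M\<^esub> x \<in> carrier M"
    "\<And>a b x. a \<in> carrier R \<Longrightarrow> b \<in> carrier R \<Longrightarrow> x \<in> carrier M \<Longrightarrow>
      (a \<oplus>\<^bsub>R\<^esub> b) \<odot>\<^bsub>M\<^esub> x = a \<odot>\<^bsub>M\<^esub> x \<oplus>\<^bsub>M\<^esub> b \<odot>\<^bsub>M\<^esub> x"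
    "\<And>a x y. a \<in> carrier R \<Longrightarrow> x \<in> carrier M \<Longrightarrow> y \<in> carrier M \<Longrightarrow>
      a \<odot>\<^bsub>M\<^esub> (x \<oplus>\<^bsub>M\<^esub> y) = a \<odot>\<^bsub>M\<^esub> x \<oplus>\<^bsub>M\<^esub> a \<odot>\<^bsub>M\<^esub> y"
    "\<And>a b x. a \<in> carrier R \<Longrightarrow> b \<in> carrier R \<Longrightarrow> x \<in> carrier M \<Longrightarrow>
      (a \<otimes>\<^bsub>R\<^esub> b) \<odot>\<^bsub>M\<^esub> x = a \<odot>\<^bsub>M\<^esub> (b \<odot>\<^bsub>M\<^esub> x)"
    "\<And>x. x \<in> carrier M \<Longrightarrow> \<one>\<^bsub>R\<^esub> \<odot>\<^bsub>M\<^esub> x = x"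
  shows "left_module R M"
  using assms by (simp add: left_module_def left_module_axioms_def)

lemma prod_mod_left_module:
  assumes "\<And>r. left_module R (A r)"
  shows "left_module R (prod_mod A)"
proof (rule left_moduleI)
  show "ring R" using assms[of 0] by (simp add: left_module_def)
  show "abelian_group (prod_mod A)"
  proof (rule abelian_groupI)
    fix \<phi> assume p: "\<phi> \<in> carrier (prod_mod A)"
    show "\<exists>\<psi>\<in>carrier (prod_mod A). \<psi> \<oplus>\<^bsub>prod_mod A\<^esub> \<phi> = \<zero>\<^bsub>prod_mod A\<^esub>"
      using p left_module_abelian[OF assms]
      by (intro bexI[of _ "\<lambda>r. \<ominus>\<^bsub>A r\<^esub> \<phi> r"])
        (auto simp: prod_mod_def abelian_group.l_neg abelian_group.a_inv_closed)
  qed (use left_module_abelian[OF assms] in \<open>auto simp: prod_mod_def abelian_group_def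
      abelian_monoid.a_closed abelian_monoid.zero_closed abelian_monoid.a_assoc
      abelian_monoid.l_zero intro!: ext abelian_monoid.a_comm\<close>)
qed (use assms in \<open>auto simp: prod_mod_def left_module.smult_l_distr
      left_module.smult_assoc1 left_module.smult_one
      intro!: ext left_module.smult_closed left_module.smult_r_distr\<close>)

lemma submodI:
  assumes M: "left_module R M" and "N \<subseteq> carrier M" "\<zero>\<^bsub>M\<^esub> \<in> N"
    "\<And>x y. x \<in> N \<Longrightarrow> y \<in> N \<Longrightarrow> x \<ominus>\<^bsub>M\<^esub> y \<in> N"
    "\<And>a x. a \<in> carrier R \<Longrightarrow> x \<in> N \<Longrightarrow> a \<odot>\<^bsub>M\<^esub> x \<in> N"
  shows "submodule N R M"
proof -
  interpret M: left_module R M by (rule M)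
  have inv: "\<ominus>\<^bsub>M\<^esub> x \<in> N" if "x \<in> N" for x
    using assms(4)[OF assms(3) that] that assms(2) by (simp add: a_minus_def subset_iff)
  have "x \<oplus>\<^bsub>M\<^esub> y \<in> N" if "x \<in> N" "y \<in> N" for x y
    using assms(4)[OF that(1) inv[OF that(2)]] that assms(2) by (simp add: a_minus_def subset_iff)
  with inv assms show ?thesis
    by (auto simp: submodule_def submodule_axioms_def a_inv_def[symmetric] intro!: subgroup.intro)
qed

lemma submod_left_module:
  assumes M: "left_module R M" and N: "submodule N R M"
  shows "left_module R (restrict_mod M N)"
proof -
  interpret M: left_module R M by (rule M)
  interpret N: submodule N R M by (rule N)
  have sub: "x \<in> N \<Longrightarrow> x \<in> carrier M" for x using N.subset by auto
  show ?thesis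
  proof (rule left_moduleI)
    show "ring R" using M by (simp add: left_module_def)
    show "abelian_group (restrict_mod M N)"
    proof (rule abelian_groupI)
      fix x assume "x \<in> carrier (restrict_mod M N)"
      then show "\<exists>y\<in>carrier (restrict_mod M N). y \<oplus>\<^bsub>restrict_mod M N\<^esub> x = \<zero>\<^bsub>restrict_mod M N\<^esub>"
        using N.m_inv_closed sub by (intro bexI[of _ "\<ominus>\<^bsub>M\<^esub> x"]) (auto simp: M.l_neg a_inv_def)
    qed (use N.m_closed N.one_closed sub in \<open>auto simp: M.a_assoc intro: M.a_comm\<close>)
  qed (use sub in \<open>auto simp: M.smult_l_distr M.smult_r_distr M.smult_assoc1 M.smult_one\<close>)
qed

lemma hom_image_submod:
  assumes "left_module R M" "left_module R M'" "mod_hom R M M' h"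
  shows "submodule (h ` carrier M) R M'"
proof (rule submodI[OF assms(2)])
  show "h ` carrier M \<subseteq> carrier M'" using mod_hom_closed[OF assms(3)] by auto
  show "\<zero>\<^bsub>M'\<^esub> \<in> h ` carrier M"
    using mod_hom_zero[OF assms] left_module_a(2)[OF assms(1)] by (metis imageI)
  show "x \<ominus>\<^bsub>M'\<^esub> y \<in> h ` carrier M" if "x \<in> h ` carrier M" "y \<in> h ` carrier M" for x y
    using that mod_hom_minus[OF assms] left_module_a(4)[OF assms(1)] by (auto simp: image_iff) metis
  show "a \<odot>\<^bsub>M'\<^esub> x \<in> h ` carrier M" if "a \<in> carrier R" "x \<in> h ` carrier M" for a x
    using that mod_hom_smult[OF assms(3)] left_module_a(5)[OF assms(1)] by (auto simp: image_iff) metis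
qed

lemma quot_eq_iff:
  assumes M: "left_module R M" and N: "submodule N R M"
    and x: "x \<in> carrier M" and y: "y \<in> carrier M"
  shows "N +>\<^bsub>M\<^esub> x = N +>\<^bsub>M\<^esub> y \<longleftrightarrow> x \<ominus>\<^bsub>M\<^esub> y \<in> N"
proof -
  interpret M: left_module R M by (rule M)
  interpret N: submodule N R M by (rule N)
  have sg: "subgroup N (add_monoid M)" ..
  have sub: "z \<in> N \<Longrightarrow> z \<in> carrier M" for z using N.subset by auto
  have in_iff: "z \<in> N +>\<^bsub>M\<^esub> y \<longleftrightarrow> z \<ominus>\<^bsub>M\<^esub> y \<in> N" if "z \<in> carrier M" for z
  proof
    assume "z \<in> N +>\<^bsub>M\<^esub> y"
    then obtain n where "n \<in> N" "z = n \<oplus>\<^bsub>M\<^esub> y" by (auto simp: a_r_coset_def')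
    then show "z \<ominus>\<^bsub>M\<^esub> y \<in> N" using sub y by (simp add: a_minus_def M.a_assoc M.r_neg)
  next
    assume "z \<ominus>\<^bsub>M\<^esub> y \<in> N"
    moreover have "(z \<ominus>\<^bsub>M\<^esub> y) \<oplus>\<^bsub>M\<^esub> y = z" using left_module_minus(5)[OF M that y] .
    ultimately show "z \<in> N +>\<^bsub>M\<^esub> y" by (auto simp: a_r_coset_def') metis
  qed
  have self: "z \<in> N +>\<^bsub>M\<^esub> z" if "z \<in> carrier M" for z
    using that N.one_closed by (force simp: a_r_coset_def' intro: M.l_zero[symmetric])
  show ?thesis
    using in_iff[OF x] self[OF x] M.a_repr_independence[OF _ y sg, of x] by metis
qed

lemma quot_zero_iff:
  assumes M: "left_module R M" and N: "submodule N R M" and x: "x \<in> carrier M"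
  shows "N +>\<^bsub>M\<^esub> x = N \<longleftrightarrow> x \<in> N"
proof -
  interpret M: left_module R M by (rule M)
  interpret N: submodule N R M by (rule N)
  have "N +>\<^bsub>M\<^esub> \<zero>\<^bsub>M\<^esub> = N" by (rule M.a_coset_add_zero) (use N.subset in simp)
  then show ?thesis
    using quot_eq_iff[OF M N x M.zero_closed] left_module_minus(6)[OF M x] by simp
qed

lemma quot_hom:
  assumes M: "left_module R M" and N: "submodule N R M"
  shows "mod_hom R M (quot_mod M N) (\<lambda>x. N +>\<^bsub>M\<^esub> x)"
proof -
  interpret M: left_module R M by (rule M)
  interpret N: submodule N R M by (rule N)
  have sg: "subgroup N (add_monoid M)" ..
  have sub: "z \<in> N \<Longrightarrow> z \<in> carrier M" for z using N.subset by auto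
  interpret A: abelian_subgroup N M
    by (rule abelian_subgroupI3[OF additive_subgroupI[OF sg]]) (rule left_module_abelian[OF M])
  have "(\<Union>z\<in>N +>\<^bsub>M\<^esub> x. N +>\<^bsub>M\<^esub> (a \<odot>\<^bsub>M\<^esub> z)) = N +>\<^bsub>M\<^esub> (a \<odot>\<^bsub>M\<^esub> x)"
    if a: "a \<in> carrier R" and x: "x \<in> carrier M" for a x
  proof -
    have "N +>\<^bsub>M\<^esub> (a \<odot>\<^bsub>M\<^esub> z) = N +>\<^bsub>M\<^esub> (a \<odot>\<^bsub>M\<^esub> x)" if z: "z \<in> N +>\<^bsub>M\<^esub> x" for z
    proof -
      obtain n where n: "n \<in> N" "z = n \<oplus>\<^bsub>M\<^esub> x" using z by (auto simp: a_r_coset_def')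
      have "a \<odot>\<^bsub>M\<^esub> z = a \<odot>\<^bsub>M\<^esub> n \<oplus>\<^bsub>M\<^esub> a \<odot>\<^bsub>M\<^esub> x" using n sub a x by (simp add: M.smult_r_distr)
      then have "a \<odot>\<^bsub>M\<^esub> z \<in> N +>\<^bsub>M\<^esub> (a \<odot>\<^bsub>M\<^esub> x)" using n a by (auto simp: a_r_coset_def')
      then show ?thesis
        using M.a_repr_independence[OF _ M.smult_closed[OF a x] sg] by metis
    qed
    moreover have "x \<in> N +>\<^bsub>M\<^esub> x" using A.a_rcos_self[OF x] .
    ultimately show ?thesis by blast
  qed
  then show ?thesis
    unfolding mod_hom_def quot_mod_def
    using A.a_rcos_sum M.a_rcosetsI[OF A.a_subset] by simp
qed

lemma quot_carrier: "carrier (quot_mod M N) = (\<lambda>x. N +>\<^bsub>M\<^esub> x) ` carrier M"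
  by (auto simp: quot_mod_def A_RCOSETS_def')

lemma connecting_hom:
  fixes A :: "('r, 'a) module" and J :: "('r, 'j) module" and Q :: "('r, 'q) module"
  assumes A: "left_module R A" and J: "left_module R J" and Q: "left_module R Q"
    and u: "mod_hom R A J u" "inj_on u (carrier A)"
    and v: "mod_hom R J Q v" "v ` carrier J = carrier Q"
    and ex: "u ` carrier A = a_kernel J Q v"
    and dA: "mod_hom R A A dA" and dJ: "mod_hom R J J dJ" and dQ: "mod_hom R Q Q dQ"
    and cu: "\<And>x. x \<in> carrier A \<Longrightarrow> u (dA x) = dJ (u x)"
    and cv: "\<And>x. x \<in> carrier J \<Longrightarrow> v (dJ x) = dQ (v x)"
    and sur: "dJ ` carrier J = carrier J"
  shows "\<exists>\<delta>. mod_epi R (restrict_mod Q (a_kernel Q Q dQ)) (quot_mod A (dA ` carrier A)) \<delta> \<and>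
    a_kernel (restrict_mod Q (a_kernel Q Q dQ)) (quot_mod A (dA ` carrier A)) \<delta> = v ` a_kernel J J dJ \<and>
    (\<forall>\<psi>\<in>carrier J. \<forall>\<alpha>\<in>carrier A. u \<alpha> = dJ \<psi> \<longrightarrow> \<delta> (v \<psi>) = dA ` carrier A +>\<^bsub>A\<^esub> \<alpha>)"
proof -
  let ?N = "dA ` carrier A"
  have N: "submodule ?N R A" by (rule hom_image_submod[OF A A dA])
  note qh = quot_hom[OF A N]
  define T where "T \<psi> \<alpha> \<longleftrightarrow> \<psi> \<in> carrier J \<and> \<alpha> \<in> carrier A \<and> u \<alpha> = dJ \<psi>" for \<psi> \<alpha>
  have indep: "?N +>\<^bsub>A\<^esub> \<alpha> = ?N +>\<^bsub>A\<^esub> \<alpha>'" if T: "T \<psi> \<alpha>" "T \<psi>' \<alpha>'" "v \<psi> = v \<psi>'" for \<psi> \<alpha> \<psi>' \<alpha>'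
  proof -
    have c: "\<psi> \<in> carrier J" "\<psi>' \<in> carrier J" "\<alpha> \<in> carrier A" "\<alpha>' \<in> carrier A"
      and e: "u \<alpha> = dJ \<psi>" "u \<alpha>' = dJ \<psi>'" using T by (auto simp: T_def)
    have "v (\<psi> \<ominus>\<^bsub>J\<^esub> \<psi>') = \<zero>\<^bsub>Q\<^esub>"
      using mod_hom_minus[OF J Q v(1) c(1,2)] T(3) left_module_minus(3)[OF Q]
        mod_hom_closed[OF v(1) c(2)] by simp
    then have "\<psi> \<ominus>\<^bsub>J\<^esub> \<psi>' \<in> u ` carrier A"
      unfolding ex a_kernel_def' using left_module_a(4)[OF J c(1,2)] by simp
    then obtain \<beta> where b: "\<beta> \<in> carrier A" "u \<beta> = \<psi> \<ominus>\<^bsub>J\<^esub> \<psi>'" by auto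
    have "u (\<alpha> \<ominus>\<^bsub>A\<^esub> \<alpha>') = dJ (\<psi> \<ominus>\<^bsub>J\<^esub> \<psi>')"
      using mod_hom_minus[OF A J u(1) c(3,4)] mod_hom_minus[OF J J dJ c(1,2)] e by simp
    also have "\<dots> = u (dA \<beta>)" using b cu by simp
    finally have "\<alpha> \<ominus>\<^bsub>A\<^esub> \<alpha>' = dA \<beta>"
      using inj_onD[OF u(2)] left_module_a(4)[OF A c(3,4)] mod_hom_closed[OF dA b(1)] by blast
    then show ?thesis using quot_eq_iff[OF A N c(3,4)] b(1) by auto
  qed
  define \<delta> where "\<delta> \<phi> = ?N +>\<^bsub>A\<^esub> (SOME \<alpha>. \<exists>\<psi>. T \<psi> \<alpha> \<and> v \<psi> = \<phi>)" for \<phi>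
  have \<delta>: "\<delta> (v \<psi>) = ?N +>\<^bsub>A\<^esub> \<alpha>" if "T \<psi> \<alpha>" for \<psi> \<alpha>
  proof -
    let ?P = "\<lambda>\<beta>. \<exists>\<psi>'. T \<psi>' \<beta> \<and> v \<psi>' = v \<psi>"
    have "?P (SOME \<beta>. ?P \<beta>)" by (rule someI[of ?P \<alpha>]) (use that in blast)
    then show ?thesis unfolding \<delta>_def using indep[OF _ that] by blast
  qed
  have ex_T: "\<exists>\<psi> \<alpha>. T \<psi> \<alpha> \<and> v \<psi> = \<phi>" if "\<phi> \<in> a_kernel Q Q dQ" for \<phi>
  proof -
    have p: "\<phi> \<in> carrier Q" "dQ \<phi> = \<zero>\<^bsub>Q\<^esub>" using that by (auto simp: a_kernel_def')
    then obtain \<psi> where s: "\<psi> \<in> carrier J" "v \<psi> = \<phi>" using v(2) by (metis imageE)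
    have "dJ \<psi> \<in> u ` carrier A"
      unfolding ex a_kernel_def' using cv[OF s(1)] s p mod_hom_closed[OF dJ s(1)] by simp
    then obtain \<alpha> where "\<alpha> \<in> carrier A" "u \<alpha> = dJ \<psi>" by auto
    then have "T \<psi> \<alpha>" using s by (simp add: T_def)
    then show ?thesis using s by blast
  qed
  have v_ker: "v \<psi> \<in> a_kernel Q Q dQ" if "T \<psi> \<alpha>" for \<psi> \<alpha>
  proof -
    have c: "\<psi> \<in> carrier J" "\<alpha> \<in> carrier A" and e: "u \<alpha> = dJ \<psi>" using that by (auto simp: T_def)
    have "u \<alpha> \<in> a_kernel J Q v" using c(2) ex by blast
    then have "dQ (v \<psi>) = \<zero>\<^bsub>Q\<^esub>" using cv[OF c(1)] e by (simp add: a_kernel_def')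
    then show ?thesis using mod_hom_closed[OF v(1) c(1)] by (simp add: a_kernel_def')
  qed
  have hom: "mod_hom R (restrict_mod Q (a_kernel Q Q dQ)) (quot_mod A ?N) \<delta>"
    unfolding mod_hom_def
  proof (intro conjI ballI)
    fix \<phi> assume "\<phi> \<in> carrier (restrict_mod Q (a_kernel Q Q dQ))"
    then obtain \<psi> \<alpha> where t: "T \<psi> \<alpha>" "v \<psi> = \<phi>" using ex_T by force
    then show "\<delta> \<phi> \<in> carrier (quot_mod A ?N)"
      using \<delta>[OF t(1)] mod_hom_closed[OF qh, of \<alpha>] by (simp add: T_def)
    fix \<phi>' assume "\<phi>' \<in> carrier (restrict_mod Q (a_kernel Q Q dQ))"
    then obtain \<psi>' \<alpha>' where t': "T \<psi>' \<alpha>'" "v \<psi>' = \<phi>'" using ex_T by force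
    have "T (\<psi> \<oplus>\<^bsub>J\<^esub> \<psi>') (\<alpha> \<oplus>\<^bsub>A\<^esub> \<alpha>')"
      using t(1) t'(1) left_module_a(1)[OF J] left_module_a(1)[OF A]
        mod_hom_add[OF u(1)] mod_hom_add[OF dJ] by (simp add: T_def)
    moreover have "v (\<psi> \<oplus>\<^bsub>J\<^esub> \<psi>') = \<phi> \<oplus>\<^bsub>Q\<^esub> \<phi>'" using t t' mod_hom_add[OF v(1)] by (simp add: T_def)
    ultimately have "\<delta> (\<phi> \<oplus>\<^bsub>Q\<^esub> \<phi>') = ?N +>\<^bsub>A\<^esub> (\<alpha> \<oplus>\<^bsub>A\<^esub> \<alpha>')" using \<delta> by metis
    also have "\<dots> = \<delta> \<phi> \<oplus>\<^bsub>quot_mod A ?N\<^esub> \<delta> \<phi>'"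
      using mod_hom_add[OF qh, of \<alpha> \<alpha>'] \<delta>[OF t(1)] \<delta>[OF t'(1)] t t' by (simp add: T_def)
    finally show "\<delta> (\<phi> \<oplus>\<^bsub>restrict_mod Q (a_kernel Q Q dQ)\<^esub> \<phi>') = \<delta> \<phi> \<oplus>\<^bsub>quot_mod A ?N\<^esub> \<delta> \<phi>'" by simp
  next
    fix a \<phi> assume a: "a \<in> carrier R" and "\<phi> \<in> carrier (restrict_mod Q (a_kernel Q Q dQ))"
    then obtain \<psi> \<alpha> where t: "T \<psi> \<alpha>" "v \<psi> = \<phi>" using ex_T by force
    have "T (a \<odot>\<^bsub>J\<^esub> \<psi>) (a \<odot>\<^bsub>A\<^esub> \<alpha>)"
      using t(1) left_module_a(5)[OF J a] left_module_a(5)[OF A a]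
        mod_hom_smult[OF u(1) a] mod_hom_smult[OF dJ a] by (simp add: T_def)
    moreover have "v (a \<odot>\<^bsub>J\<^esub> \<psi>) = a \<odot>\<^bsub>Q\<^esub> \<phi>" using t mod_hom_smult[OF v(1) a] by (simp add: T_def)
    ultimately have "\<delta> (a \<odot>\<^bsub>Q\<^esub> \<phi>) = ?N +>\<^bsub>A\<^esub> (a \<odot>\<^bsub>A\<^esub> \<alpha>)" using \<delta> by metis
    also have "\<dots> = a \<odot>\<^bsub>quot_mod A ?N\<^esub> \<delta> \<phi>"
      using mod_hom_smult[OF qh a, of \<alpha>] \<delta>[OF t(1)] t by (simp add: T_def)
    finally show "\<delta> (a \<odot>\<^bsub>restrict_mod Q (a_kernel Q Q dQ)\<^esub> \<phi>) = a \<odot>\<^bsub>quot_mod A ?N\<^esub> \<delta> \<phi>" by simp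
  qed
  moreover have "\<delta> ` carrier (restrict_mod Q (a_kernel Q Q dQ)) = carrier (quot_mod A ?N)"
  proof
    show "\<delta> ` carrier (restrict_mod Q (a_kernel Q Q dQ)) \<subseteq> carrier (quot_mod A ?N)"
      using mod_hom_closed[OF hom] by blast
    show "carrier (quot_mod A ?N) \<subseteq> \<delta> ` carrier (restrict_mod Q (a_kernel Q Q dQ))"
    proof
      fix X assume "X \<in> carrier (quot_mod A ?N)"
      then obtain \<alpha> where a: "\<alpha> \<in> carrier A" "X = ?N +>\<^bsub>A\<^esub> \<alpha>" unfolding quot_carrier by blast
      obtain \<psi> where "\<psi> \<in> carrier J" "dJ \<psi> = u \<alpha>"
        using sur mod_hom_closed[OF u(1) a(1)] by (metis imageE)
      then have t: "T \<psi> \<alpha>" using a by (simp add: T_def)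
      then have "X = \<delta> (v \<psi>)" using a \<delta> by simp
      then show "X \<in> \<delta> ` carrier (restrict_mod Q (a_kernel Q Q dQ))" using v_ker[OF t] by simp
    qed
  qed
  moreover have "a_kernel (restrict_mod Q (a_kernel Q Q dQ)) (quot_mod A ?N) \<delta> = v ` a_kernel J J dJ"
  proof (intro Set.set_eqI iffI)
    fix \<phi> assume "\<phi> \<in> a_kernel (restrict_mod Q (a_kernel Q Q dQ)) (quot_mod A ?N) \<delta>"
    then have k: "\<phi> \<in> a_kernel Q Q dQ" and z: "\<delta> \<phi> = ?N"
      by (simp_all add: a_kernel_def' quot_mod_def)
    obtain \<psi> \<alpha> where t: "T \<psi> \<alpha>" "v \<psi> = \<phi>" using ex_T[OF k] by blast
    then have c: "\<psi> \<in> carrier J" "\<alpha> \<in> carrier A" "u \<alpha> = dJ \<psi>" by (auto simp: T_def)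
    have "\<alpha> \<in> ?N" using \<delta>[OF t(1)] z t(2) quot_zero_iff[OF A N c(2)] by simp
    then obtain \<beta> where b: "\<beta> \<in> carrier A" "\<alpha> = dA \<beta>" by blast
    have ub: "u \<beta> \<in> carrier J" "v (u \<beta>) = \<zero>\<^bsub>Q\<^esub>"
      using ex b(1) mod_hom_closed[OF u(1)] by (auto simp: a_kernel_def')
    have "dJ (\<psi> \<ominus>\<^bsub>J\<^esub> u \<beta>) = u \<alpha> \<ominus>\<^bsub>J\<^esub> u \<alpha>"
      using mod_hom_minus[OF J J dJ c(1) ub(1)] cu[OF b(1)] b c by simp
    then have "dJ (\<psi> \<ominus>\<^bsub>J\<^esub> u \<beta>) = \<zero>\<^bsub>J\<^esub>"
      using left_module_minus(3)[OF J] mod_hom_closed[OF u(1) c(2)] by simp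
    moreover have "v (\<psi> \<ominus>\<^bsub>J\<^esub> u \<beta>) = \<phi>"
      using mod_hom_minus[OF J Q v(1) c(1) ub(1)] ub t(2)
        left_module_minus(6)[OF Q mod_hom_closed[OF v(1) c(1)]] by simp
    ultimately show "\<phi> \<in> v ` a_kernel J J dJ"
      using left_module_a(4)[OF J c(1) ub(1)] by (force simp: a_kernel_def')
  next
    fix \<phi> assume "\<phi> \<in> v ` a_kernel J J dJ"
    then obtain \<psi> where s: "\<psi> \<in> carrier J" "dJ \<psi> = \<zero>\<^bsub>J\<^esub>" "\<phi> = v \<psi>" by (auto simp: a_kernel_def')
    have t: "T \<psi> \<zero>\<^bsub>A\<^esub>"
      using s mod_hom_zero[OF A J u(1)] left_module_a(2)[OF A] by (simp add: T_def)
    have "\<zero>\<^bsub>A\<^esub> \<in> ?N" using mod_hom_zero[OF A A dA] left_module_a(2)[OF A] by (metis imageI)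
    then have "\<delta> \<phi> = ?N"
      using \<delta>[OF t] s quot_zero_iff[OF A N left_module_a(2)[OF A]] by simp
    then show "\<phi> \<in> a_kernel (restrict_mod Q (a_kernel Q Q dQ)) (quot_mod A ?N) \<delta>"
      using v_ker[OF t] s by (simp add: a_kernel_def'[of "restrict_mod Q _"] quot_mod_def)
  qed
  ultimately show ?thesis using \<delta> by (intro exI[of _ \<delta>]) (simp add: mod_epi_def T_def)
qed


subsection \<open>The derived functor of the limit\<close>

text \<open>Injectivity is tested on monomorphisms from diagrams over the type \<open>'x\<close> to diagrams over \<open>'y\<close>.\<close>

definition injective_diagram ::
  "('x \<times> 'y) itself \<Rightarrow> ('r, 't) ring_scheme \<Rightarrow> (int \<Rightarrow> ('r, 'm) module) \<Rightarrow> (int \<Rightarrow> 'm \<Rightarrow> 'm) \<Rightarrow> bool"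
  where
  "injective_diagram T R J h \<longleftrightarrow> diagram R J h \<and>
     (\<forall>(X :: int \<Rightarrow> ('r, 'x) module) gX (Y :: int \<Rightarrow> ('r, 'y) module) gY u f.
        diagram R X gX \<and> diagram R Y gY \<and> diagram_hom R X gX Y gY u \<and>
        (\<forall>r. inj_on (u r) (carrier (X r))) \<and> diagram_hom R X gX J h f \<longrightarrow>
        (\<exists>f'. diagram_hom R Y gY J h f' \<and> (\<forall>r. \<forall>x\<in>carrier (X r). f' r (u r x) = f r x)))"

lemma lim_diff_hom:
  assumes d: "diagram R A g"
  shows "mod_hom R (prod_mod A) (prod_mod A) (lim_diff A g)"
proof -
  have m: "left_module R (A r)" for r using d by (simp add: diagram_def)
  have h: "mod_hom R (A (r - 1)) (A r) (g (r - 1))" for r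
    using d unfolding diagram_def by (metis diff_add_cancel)
  show ?thesis
    unfolding mod_hom_def
  proof (intro conjI ballI)
    fix \<phi> assume p: "\<phi> \<in> carrier (prod_mod A)"
    then have c: "\<phi> r \<in> carrier (A r)" "g (r - 1) (\<phi> (r - 1)) \<in> carrier (A r)" for r
      using mod_hom_closed[OF h[of r]] by (auto simp: prod_mod_def)
    show "lim_diff A g \<phi> \<in> carrier (prod_mod A)"
      using c left_module_a(4)[OF m] by (simp add: prod_mod_def lim_diff_def)
    show "lim_diff A g (a \<odot>\<^bsub>prod_mod A\<^esub> \<phi>) = a \<odot>\<^bsub>prod_mod A\<^esub> lim_diff A g \<phi>"
      if a: "a \<in> carrier R" for a
      using c left_module_minus(2)[OF m a] mod_hom_smult[OF h a]
      by (auto simp: prod_mod_def lim_diff_def)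
    fix \<psi> assume "\<psi> \<in> carrier (prod_mod A)"
    then have c': "\<psi> r \<in> carrier (A r)" "g (r - 1) (\<psi> (r - 1)) \<in> carrier (A r)" for r
      using mod_hom_closed[OF h[of r]] by (auto simp: prod_mod_def)
    show "lim_diff A g (\<phi> \<oplus>\<^bsub>prod_mod A\<^esub> \<psi>) = lim_diff A g \<phi> \<oplus>\<^bsub>prod_mod A\<^esub> lim_diff A g \<psi>"
      using c c' left_module_minus(1)[OF m] mod_hom_add[OF h]
      by (auto simp: prod_mod_def lim_diff_def)
  qed
qed

lemma lim_mod_ker:
  assumes d: "diagram R A g"
  shows "lim_mod A g = restrict_mod (prod_mod A) (a_kernel (prod_mod A) (prod_mod A) (lim_diff A g))"
proof -
  have m: "left_module R (A r)" for r using d by (simp add: diagram_def)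
  have h: "mod_hom R (A (r - 1)) (A r) (g (r - 1))" for r
    using d unfolding diagram_def by (metis diff_add_cancel)
  have eq: "(\<forall>r. g r (\<phi> r) = \<phi> (r + 1)) \<longleftrightarrow> lim_diff A g \<phi> = \<zero>\<^bsub>prod_mod A\<^esub>"
    if p: "\<phi> \<in> carrier (prod_mod A)" for \<phi>
  proof -
    have c: "\<phi> r \<in> carrier (A r)" "g (r - 1) (\<phi> (r - 1)) \<in> carrier (A r)" for r
      using p mod_hom_closed[OF h[of r]] by (auto simp: prod_mod_def)
    have "lim_diff A g \<phi> = \<zero>\<^bsub>prod_mod A\<^esub> \<longleftrightarrow> (\<forall>r. \<phi> r = g (r - 1) (\<phi> (r - 1)))"
      using left_module_minus(3)[OF m c] by (auto simp: lim_diff_def prod_mod_def fun_eq_iff)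
    also have "\<dots> \<longleftrightarrow> (\<forall>r. g r (\<phi> r) = \<phi> (r + 1))"
      by (metis add_diff_cancel_right' diff_add_cancel)
    finally show ?thesis by simp
  qed
  have "{\<phi> \<in> carrier (prod_mod A). \<forall>r. g r (\<phi> r) = \<phi> (r + 1)} =
      {\<phi> \<in> carrier (prod_mod A). lim_diff A g \<phi> = \<zero>\<^bsub>prod_mod A\<^esub>}"
    by (intro Collect_cong conj_cong refl eq)
  then show ?thesis unfolding lim_mod_def a_kernel_def' by simp
qed

lemma prod_hom:
  assumes "diagram_hom R A g B h f"
  shows "mod_hom R (prod_mod A) (prod_mod B) (lim_map f)"
proof -
  have f: "mod_hom R (A r) (B r) (f r)" for r using assms by (simp add: diagram_hom_def)
  show ?thesis
    unfolding mod_hom_def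
    using mod_hom_closed[OF f] mod_hom_add[OF f] mod_hom_smult[OF f]
    by (simp add: prod_mod_def lim_map_def)
qed

lemma lim_diff_natural:
  assumes "diagram R A g" "diagram R B h" "diagram_hom R A g B h f" "\<phi> \<in> carrier (prod_mod A)"
  shows "lim_map f (lim_diff A g \<phi>) = lim_diff B h (lim_map f \<phi>)"
proof
  fix r
  have c: "\<phi> s \<in> carrier (A s)" for s using assms(4) by (simp add: prod_mod_def)
  have c': "g (r - 1) (\<phi> (r - 1)) \<in> carrier (A r)"
    using assms(1) c unfolding diagram_def by (metis diff_add_cancel mod_hom_closed)
  have "f r (g (r - 1) (\<phi> (r - 1))) = h (r - 1) (f (r - 1) (\<phi> (r - 1)))"
    using assms(3) c unfolding diagram_hom_def by (metis diff_add_cancel)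
  moreover have "f r (\<phi> r \<ominus>\<^bsub>A r\<^esub> g (r - 1) (\<phi> (r - 1))) = f r (\<phi> r) \<ominus>\<^bsub>B r\<^esub> f r (g (r - 1) (\<phi> (r - 1)))"
    using assms c c' by (intro mod_hom_minus[of R]) (auto simp: diagram_def diagram_hom_def)
  ultimately show "lim_map f (lim_diff A g \<phi>) r = lim_diff B h (lim_map f \<phi>) r"
    by (simp add: lim_map_def lim_diff_def)
qed

lemma injective_lim_diff_surj:
  assumes inj: "injective_diagram TYPE('j \<times> (int \<Rightarrow> 'j)) R (J :: int \<Rightarrow> ('r, 'j) module) h"
  shows "lim_diff J h ` carrier (prod_mod J) = carrier (prod_mod J)"
proof
  have d: "diagram R J h" using inj by (simp add: injective_diagram_def)
  then have m: "left_module R (J r)" for r by (simp add: diagram_def)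
  note mP = prod_mod_left_module[of R J, OF m]
  have hom_h: "mod_hom R (J r) (J (r + 1)) (h r)" for r using d by (simp add: diagram_def)
  show "lim_diff J h ` carrier (prod_mod J) \<subseteq> carrier (prod_mod J)"
    using mod_hom_closed[OF lim_diff_hom[OF d]] by blast
  define K where "K r = {\<phi> \<in> carrier (prod_mod J). \<forall>s<r. \<phi> s = \<zero>\<^bsub>J s\<^esub>}" for r
  define Y where "Y r = restrict_mod (prod_mod J) (K r)" for r
  define p where "p r \<phi> = \<phi>(r := \<zero>\<^bsub>J r\<^esub>)" for r and \<phi> :: "int \<Rightarrow> 'j"
  define e where "e r x = (\<lambda>s. if r \<le> s then trans_map h r (nat (s - r)) x else \<zero>\<^bsub>J s\<^esub>)" for r x
  note z = left_module_a(2)[OF m]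
  have comp_minus: "(\<phi> \<ominus>\<^bsub>prod_mod J\<^esub> \<psi>) s = \<phi> s \<ominus>\<^bsub>J s\<^esub> \<psi> s"
    if "\<phi> \<in> carrier (prod_mod J)" "\<psi> \<in> carrier (prod_mod J)" for \<phi> \<psi> s
  proof -
    have "mod_hom R (prod_mod J) (J s) (\<lambda>\<phi>. \<phi> s)" by (simp add: mod_hom_def prod_mod_def)
    from mod_hom_minus[OF mP m this that] show ?thesis .
  qed
  have z_min: "\<zero>\<^bsub>J s\<^esub> \<ominus>\<^bsub>J s\<^esub> \<zero>\<^bsub>J s\<^esub> = \<zero>\<^bsub>J s\<^esub>" for s using left_module_minus(6)[OF m z] .
  have z_add: "\<zero>\<^bsub>J s\<^esub> \<oplus>\<^bsub>J s\<^esub> \<zero>\<^bsub>J s\<^esub> = \<zero>\<^bsub>J s\<^esub>" for s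
    using left_module_abelian[OF m, of s] z
    by (simp add: abelian_group_def abelian_monoid.l_zero)
  have z_sm: "a \<odot>\<^bsub>J s\<^esub> \<zero>\<^bsub>J s\<^esub> = \<zero>\<^bsub>J s\<^esub>" if "a \<in> carrier R" for a s
  proof -
    have c: "a \<odot>\<^bsub>J s\<^esub> \<zero>\<^bsub>J s\<^esub> \<in> carrier (J s)" by (rule left_module_a(5)[OF m that z])
    have "a \<odot>\<^bsub>J s\<^esub> \<zero>\<^bsub>J s\<^esub> \<ominus>\<^bsub>J s\<^esub> a \<odot>\<^bsub>J s\<^esub> \<zero>\<^bsub>J s\<^esub> = \<zero>\<^bsub>J s\<^esub>"
      using left_module_minus(3)[OF m c c] by simp
    then show ?thesis using left_module_minus(2)[OF m that z z, of s] z_min[of s] by metis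
  qed
  have K: "submodule (K r) R (prod_mod J)" for r
  proof (rule submodI[OF mP])
    show "\<zero>\<^bsub>prod_mod J\<^esub> \<in> K r" using z by (simp add: K_def prod_mod_def)
    show "x \<ominus>\<^bsub>prod_mod J\<^esub> y \<in> K r" if "x \<in> K r" "y \<in> K r" for x y
      using that left_module_a(4)[OF mP] comp_minus z_min by (simp add: K_def)
    show "a \<odot>\<^bsub>prod_mod J\<^esub> x \<in> K r" if "a \<in> carrier R" "x \<in> K r" for a x
      using that left_module_a(5)[OF m] z_sm by (simp add: K_def prod_mod_def)
  qed (auto simp: K_def)
  have mY: "left_module R (Y r)" for r
    unfolding Y_def by (rule submod_left_module[OF mP K])
  have dY: "diagram R Y p"
    unfolding diagram_def
  proof (intro conjI allI)
    show "left_module R (Y r)" for r by (rule mY)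
    show "mod_hom R (Y r) (Y (r + 1)) (p r)" for r
      unfolding mod_hom_def
    proof (intro conjI ballI)
      show "p r x \<in> carrier (Y (r + 1))" if "x \<in> carrier (Y r)" for x
        using that z by (simp add: Y_def K_def p_def prod_mod_def)
      show "p r (x \<oplus>\<^bsub>Y r\<^esub> y) = p r x \<oplus>\<^bsub>Y (r + 1)\<^esub> p r y" for x y
        by (rule ext) (simp add: Y_def p_def prod_mod_def z_add)
      show "p r (a \<odot>\<^bsub>Y r\<^esub> x) = a \<odot>\<^bsub>Y (r + 1)\<^esub> p r x" if "a \<in> carrier R" for a x
        by (rule ext) (simp add: Y_def p_def prod_mod_def z_sm[OF that])
    qed
  qed
  have tr: "mod_hom R (J r) (J s) (trans_map h r (nat (s - r)))" if "r \<le> s" for r s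
    using trans_map_hom[OF d, of r "nat (s - r)"] that by simp
  have e_hom: "mod_hom R (J r) (Y r) (e r)" for r
    unfolding mod_hom_def
  proof (intro conjI ballI)
    show "e r x \<in> carrier (Y r)" if "x \<in> carrier (J r)" for x
      using mod_hom_closed[OF tr that] z by (simp add: Y_def K_def e_def prod_mod_def)
    show "e r (x \<oplus>\<^bsub>J r\<^esub> y) = e r x \<oplus>\<^bsub>Y r\<^esub> e r y"
      if "x \<in> carrier (J r)" "y \<in> carrier (J r)" for x y
      by (rule ext) (simp add: Y_def e_def prod_mod_def z_add mod_hom_add[OF tr that])
    show "e r (a \<odot>\<^bsub>J r\<^esub> x) = a \<odot>\<^bsub>Y r\<^esub> e r x" if "a \<in> carrier R" "x \<in> carrier (J r)" for a x
      by (rule ext) (simp add: Y_def e_def prod_mod_def z_sm[OF that(1)] mod_hom_smult[OF tr that])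
  qed
  have e_comm: "e (r + 1) (h r x) = p r (e r x)" for r x
  proof
    fix s
    have "trans_map h (r + 1) (nat (s - (r + 1))) (h r x) = trans_map h r (nat (s - r)) x" if "r + 1 \<le> s"
    proof -
      have "nat (s - r) = Suc 0 + nat (s - (r + 1))" using that by simp
      then show ?thesis using trans_map_add[of h r "Suc 0" "nat (s - (r + 1))" x] by simp
    qed
    then show "e (r + 1) (h r x) s = p r (e r x) s" by (simp add: e_def p_def)
  qed
  have e_dh: "diagram_hom R J h Y p e" using e_hom e_comm by (simp add: diagram_hom_def)
  have e_inj: "inj_on (e r) (carrier (J r))" for r
  proof (rule inj_onI)
    fix x y assume "e r x = e r y"
    then have "e r x r = e r y r" by simp
    then show "x = y" by (simp add: e_def)
  qed
  have "diagram_hom R J h J h (\<lambda>_ x. x)" by (simp add: diagram_hom_def mod_hom_def)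
  then obtain \<rho> where rho: "diagram_hom R Y p J h \<rho>" and rho_e: "\<And>r x. x \<in> carrier (J r) \<Longrightarrow> \<rho> r (e r x) = x"
    using inj d dY e_dh e_inj unfolding injective_diagram_def by blast
  have rho_hom: "mod_hom R (Y r) (J r) (\<rho> r)" for r using rho by (simp add: diagram_hom_def)
  show "carrier (prod_mod J) \<subseteq> lim_diff J h ` carrier (prod_mod J)"
  proof
    fix \<phi> assume "\<phi> \<in> carrier (prod_mod J)"
    then have c: "\<phi> r \<in> carrier (J r)" for r by (simp add: prod_mod_def)
    have ec: "e r (\<phi> r) s \<in> carrier (J s)" for r s
      using mod_hom_closed[OF e_hom c] by (auto simp: Y_def K_def prod_mod_def)
    define S where "S s = rec_nat \<zero>\<^bsub>J s\<^esub> (\<lambda>n x. x \<ominus>\<^bsub>J s\<^esub> e (s - int n) (\<phi> (s - int n)) s)" for s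
    have S0: "S s 0 = \<zero>\<^bsub>J s\<^esub>" and S_Suc: "S s (Suc n) = S s n \<ominus>\<^bsub>J s\<^esub> e (s - int n) (\<phi> (s - int n)) s" for s n
      by (simp_all add: S_def)
    have Sc: "S s n \<in> carrier (J s)" for s n
      by (induction n) (use z ec left_module_a(4)[OF m] in \<open>simp_all add: S0 S_Suc\<close>)
    define \<Psi> where "\<Psi> r = (\<lambda>s. if r \<le> s then S s (nat (s - r)) else \<zero>\<^bsub>J s\<^esub>)" for r
    have Pc: "\<Psi> r \<in> carrier (Y r)" for r using Sc z by (simp add: \<Psi>_def Y_def K_def prod_mod_def)
    have pPc: "p (r - 1) (\<Psi> (r - 1)) \<in> carrier (Y r)" for r
      using dY Pc[of "r - 1"] unfolding diagram_def by (metis diff_add_cancel mod_hom_closed)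
    have incl: "mod_hom R (Y r) (prod_mod J) (\<lambda>x. x)" for r
      by (auto simp: mod_hom_def Y_def K_def)
    have diff: "\<Psi> r \<ominus>\<^bsub>Y r\<^esub> p (r - 1) (\<Psi> (r - 1)) = e r (\<phi> r)" for r
    proof
      fix s
      have "(\<Psi> r \<ominus>\<^bsub>Y r\<^esub> p (r - 1) (\<Psi> (r - 1))) s = \<Psi> r s \<ominus>\<^bsub>J s\<^esub> p (r - 1) (\<Psi> (r - 1)) s"
        using mod_hom_minus[OF mY mP incl Pc pPc] comp_minus
          mod_hom_closed[OF incl Pc] mod_hom_closed[OF incl pPc] by simp
      also have "\<dots> = e r (\<phi> r) s"
      proof (cases "r \<le> s")
        case True
        then have "nat (s - (r - 1)) = Suc (nat (s - r))" "s - int (nat (s - r)) = r" by simp_all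
        then show ?thesis using True left_module_minus(4)[OF m Sc ec]
          by (simp add: \<Psi>_def p_def S_Suc)
      next
        case False
        then show ?thesis by (auto simp: \<Psi>_def p_def e_def z_min)
      qed
      finally show "(\<Psi> r \<ominus>\<^bsub>Y r\<^esub> p (r - 1) (\<Psi> (r - 1))) s = e r (\<phi> r) s" .
    qed
    have "lim_diff J h (\<lambda>r. \<rho> r (\<Psi> r)) = \<phi>"
    proof
      fix r
      have "h (r - 1) (\<rho> (r - 1) (\<Psi> (r - 1))) = \<rho> r (p (r - 1) (\<Psi> (r - 1)))"
        using rho Pc[of "r - 1"] unfolding diagram_hom_def by (metis diff_add_cancel)
      then have "lim_diff J h (\<lambda>r. \<rho> r (\<Psi> r)) r = \<rho> r (\<Psi> r \<ominus>\<^bsub>Y r\<^esub> p (r - 1) (\<Psi> (r - 1)))"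
        using mod_hom_minus[OF mY m rho_hom Pc pPc] by (simp add: lim_diff_def)
      then show "lim_diff J h (\<lambda>r. \<rho> r (\<Psi> r)) r = \<phi> r" using diff rho_e[OF c] by simp
    qed
    moreover have "(\<lambda>r. \<rho> r (\<Psi> r)) \<in> carrier (prod_mod J)"
      using mod_hom_closed[OF rho_hom Pc] by (simp add: prod_mod_def)
    ultimately show "\<phi> \<in> lim_diff J h ` carrier (prod_mod J)" by (metis imageI)
  qed
qed

text \<open>If \<open>0 \<rightarrow> A \<rightarrow> J \<rightarrow> Q \<rightarrow> 0\<close> is exact with \<open>J\<close> injective, then \<open>lim\<^sup>1 A\<close> is the cokernel of
  \<open>lim J \<rightarrow> lim Q\<close>, by the connecting map \<open>\<delta>\<close>; the last clause determines \<open>\<delta>\<close>, and with it the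
  naturality in the exact sequence.\<close>

theorem lim1_derived:
  fixes A :: "int \<Rightarrow> ('r, 'a) module" and J :: "int \<Rightarrow> ('r, 'j) module" and Q :: "int \<Rightarrow> ('r, 'q) module"
  assumes dA: "diagram R A g" and dQ: "diagram R Q q"
    and inj: "injective_diagram TYPE('j \<times> (int \<Rightarrow> 'j)) R J h"
    and u: "diagram_hom R A g J h u" "\<And>r. inj_on (u r) (carrier (A r))"
    and v: "diagram_hom R J h Q q v" "\<And>r. v r ` carrier (J r) = carrier (Q r)"
    and ex: "\<And>r. u r ` carrier (A r) = a_kernel (J r) (Q r) (v r)"
  shows "\<exists>\<delta>. mod_epi R (lim_mod Q q) (lim1_mod A g) \<delta> \<and>
    a_kernel (lim_mod Q q) (lim1_mod A g) \<delta> = lim_map v ` carrier (lim_mod J h) \<and>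
    (\<forall>\<psi>\<in>carrier (prod_mod J). \<forall>\<alpha>\<in>carrier (prod_mod A). lim_map u \<alpha> = lim_diff J h \<psi> \<longrightarrow>
      \<delta> (lim_map v \<psi>) = lim_bound A g +>\<^bsub>prod_mod A\<^esub> \<alpha>)"
proof -
  have dJ: "diagram R J h" using inj by (simp add: injective_diagram_def)
  have m: "left_module R (A r)" "left_module R (J r)" "left_module R (Q r)" for r
    using dA dJ dQ by (simp_all add: diagram_def)
  have mP: "left_module R (prod_mod A)" "left_module R (prod_mod J)" "left_module R (prod_mod Q)"
    using m by (blast intro: prod_mod_left_module)+
  have sv: "lim_map v ` carrier (prod_mod J) = carrier (prod_mod Q)"
  proof
    show "lim_map v ` carrier (prod_mod J) \<subseteq> carrier (prod_mod Q)"
      using mod_hom_closed[OF prod_hom[OF v(1)]] by blast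
    show "carrier (prod_mod Q) \<subseteq> lim_map v ` carrier (prod_mod J)"
    proof
      fix \<phi> assume "\<phi> \<in> carrier (prod_mod Q)"
      then have "\<phi> r \<in> v r ` carrier (J r)" for r using v(2) by (simp add: prod_mod_def)
      then have "\<forall>r. \<exists>y. y \<in> carrier (J r) \<and> v r y = \<phi> r" by (metis imageE)
      then obtain \<psi> where "\<And>r. \<psi> r \<in> carrier (J r) \<and> v r (\<psi> r) = \<phi> r" by metis
      then show "\<phi> \<in> lim_map v ` carrier (prod_mod J)"
        by (intro image_eqI[of _ _ \<psi>]) (auto simp: prod_mod_def lim_map_def)
    qed
  qed
  have iu: "inj_on (lim_map u) (carrier (prod_mod A))"
  proof (rule inj_onI)
    fix x y assume xy: "x \<in> carrier (prod_mod A)" "y \<in> carrier (prod_mod A)" "lim_map u x = lim_map u y"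
    then have "u r (x r) = u r (y r)" for r by (metis lim_map_def)
    then have "x r = y r" for r
      using xy(1,2) by (intro inj_onD[OF u(2)]) (auto simp: prod_mod_def)
    then show "x = y" ..
  qed
  have exP: "lim_map u ` carrier (prod_mod A) = a_kernel (prod_mod J) (prod_mod Q) (lim_map v)"
  proof (intro Set.set_eqI iffI)
    fix \<psi> assume "\<psi> \<in> lim_map u ` carrier (prod_mod A)"
    then obtain \<alpha> where a: "\<And>r. \<alpha> r \<in> carrier (A r)" "\<psi> = lim_map u \<alpha>" by (auto simp: prod_mod_def)
    then have "\<psi> r \<in> a_kernel (J r) (Q r) (v r)" for r using ex[of r] by (auto simp: lim_map_def)
    then show "\<psi> \<in> a_kernel (prod_mod J) (prod_mod Q) (lim_map v)"
      by (auto simp: a_kernel_def' prod_mod_def lim_map_def)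
  next
    fix \<psi> assume "\<psi> \<in> a_kernel (prod_mod J) (prod_mod Q) (lim_map v)"
    then have "\<psi> r \<in> u r ` carrier (A r)" for r
      unfolding ex by (auto simp: a_kernel_def' prod_mod_def lim_map_def fun_eq_iff)
    then have "\<forall>r. \<exists>y. y \<in> carrier (A r) \<and> u r y = \<psi> r" by (metis imageE)
    then obtain \<alpha> where "\<And>r. \<alpha> r \<in> carrier (A r) \<and> u r (\<alpha> r) = \<psi> r" by metis
    then show "\<psi> \<in> lim_map u ` carrier (prod_mod A)"
      by (intro image_eqI[of _ _ \<alpha>]) (auto simp: prod_mod_def lim_map_def)
  qed
  have kJ: "carrier (lim_mod J h) = a_kernel (prod_mod J) (prod_mod J) (lim_diff J h)"
    by (simp add: lim_mod_ker[OF dJ])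
  show ?thesis
    unfolding lim_mod_ker[OF dQ] lim1_mod_def lim_bound_def kJ
  proof (rule connecting_hom[OF mP prod_hom[OF u(1)] iu prod_hom[OF v(1)] sv exP
        lim_diff_hom[OF dA] lim_diff_hom[OF dJ] lim_diff_hom[OF dQ]])
    show "lim_map u (lim_diff A g x) = lim_diff J h (lim_map u x)" if "x \<in> carrier (prod_mod A)" for x
      by (rule lim_diff_natural[OF dA dJ u(1) that])
    show "lim_map v (lim_diff J h x) = lim_diff Q q (lim_map v x)" if "x \<in> carrier (prod_mod J)" for x
      by (rule lim_diff_natural[OF dJ dQ v(1) that])
    show "lim_diff J h ` carrier (prod_mod J) = carrier (prod_mod J)"
      by (rule injective_lim_diff_surj[OF inj])
  qed
qed


subsection \<open>Stabilization of the transfinite image filtration\<close>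

context includes cardinal_syntax begin

lemma ords_wo: "wo_rel (ords :: 'd ord rel)"
proof -
  have "Card_order (ords :: 'd ord rel)"
    unfolding ords_def by (rule Card_order_card_suc[OF card_of_card_order_on])
  then show ?thesis by (simp add: wo_rel_def card_order_on_def)
qed

lemma ords_Field: "Field (ords :: 'd ord rel) = UNIV"
  unfolding ords_def by (rule Field_card_suc)

lemma ords_refl: "(\<tau>, \<tau>) \<in> ords"
  using wo_rel.REFL[OF ords_wo] ords_Field by (metis UNIV_I refl_onD)

lemma ords_trans: "(\<rho>, \<sigma>) \<in> ords \<Longrightarrow> (\<sigma>, \<tau>) \<in> ords \<Longrightarrow> (\<rho>, \<tau>) \<in> ords"
  using wo_rel.TRANS[OF ords_wo] by (meson transD)

lemma ords_antisym: "(\<rho>, \<sigma>) \<in> ords \<Longrightarrow> (\<sigma>, \<rho>) \<in> ords \<Longrightarrow> \<rho> = \<sigma>"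
  using wo_rel.ANTISYM[OF ords_wo] by (meson antisymD)

lemma ords_total: "(\<rho>, \<sigma>) \<in> ords \<or> (\<sigma>, \<rho>) \<in> ords"
  using wo_rel.TOTALS[OF ords_wo] by (auto simp: ords_Field)

lemma is_pred_unique: "is_pred ords \<rho> \<tau> \<Longrightarrow> is_pred ords \<rho>' \<tau> \<Longrightarrow> \<rho> = \<rho>'"
  unfolding is_pred_def by (meson ords_antisym)

lemma ords_no_top: "\<exists>\<tau>'. (\<tau>, \<tau>') \<in> ords \<and> \<tau>' \<noteq> (\<tau> :: 'd ord)"
proof -
  have c: "Card_order (ords :: 'd ord rel)"
    unfolding ords_def by (rule Card_order_card_suc[OF card_of_card_order_on])
  have inf: "infinite (UNIV :: (bideg \<times> 'd) set)"
    by (metis finite_prod infinite_UNIV_int)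
  have less: "card_of (UNIV :: (bideg \<times> 'd) set) <o (ords :: 'd ord rel)"
    unfolding ords_def by (rule card_suc_greater[OF card_of_card_order_on])
  have "infinite (Field (ords :: 'd ord rel))"
  proof
    assume "finite (Field (ords :: 'd ord rel))"
    moreover have "card_of (UNIV :: (bideg \<times> 'd) set) \<le>o card_of (Field (ords :: 'd ord rel))"
      using ordLess_imp_ordLeq[OF less] ordIso_symmetric[OF card_of_Field_ordIso[OF c]]
      by (rule ordLeq_ordIso_trans)
    ultimately have "finite (UNIV :: (bideg \<times> 'd) set)"
      using card_of_ordLeq_finite by blast
    then show False using inf by simp
  qed
  from infinite_Card_order_limit[OF c this, of \<tau>] show ?thesis by (auto simp: ords_Field)
qed

lemma ords_ex_succ: "\<exists>\<tau>'. is_pred ords (\<tau> :: 'd ord) \<tau>'"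
proof -
  interpret wo_rel "ords :: 'd ord rel" by (rule ords_wo)
  let ?Q = "{\<upsilon>. (\<tau>, \<upsilon>) \<in> ords \<and> \<upsilon> \<noteq> \<tau>}"
  obtain \<tau>'' where ne: "\<tau>'' \<in> ?Q" using ords_no_top[of \<tau>] by blast
  have "\<exists>\<tau>'\<in>?Q. \<forall>y. (y, \<tau>') \<in> ords - Id \<longrightarrow> y \<notin> ?Q"
    by (rule WF[unfolded wf_eq_minimal, rule_format, OF ne])
  then obtain \<tau>' where t: "\<tau>' \<in> ?Q" and m: "\<forall>y. (y, \<tau>') \<in> ords - Id \<longrightarrow> y \<notin> ?Q" ..
  have "is_pred ords \<tau> \<tau>'"
    unfolding is_pred_def underS_def
  proof (intro conjI ballI)
    show "\<tau> \<in> {b. b \<noteq> \<tau>' \<and> (b, \<tau>') \<in> ords}" using t by auto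
    fix y assume "y \<in> {b. b \<noteq> \<tau>' \<and> (b, \<tau>') \<in> ords}"
    then have "y \<notin> ?Q" using m by simp
    then show "(y, \<tau>) \<in> ords" using ords_total[of y \<tau>] ords_refl[of \<tau>] by auto
  qed
  then show ?thesis ..
qed

lemma Iord_rec: "Iord C = Iord_step C (Iord (C :: ('r, 'd, 'e) exact_couple))"
proof -
  interpret wo_rel "ords :: 'd ord rel" by (rule ords_wo)
  have "adm_wo (Iord_step C)"
    unfolding adm_wo_def
  proof (intro allI impI ext)
    fix f g :: "'d ord \<Rightarrow> bideg \<Rightarrow> 'd set" and \<tau> x
    assume eq: "\<forall>\<rho>\<in>underS \<tau>. f \<rho> = g \<rho>"
    have "f (THE \<rho>. is_pred ords \<rho> \<tau>) = g (THE \<rho>. is_pred ords \<rho> \<tau>)"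
      if "\<exists>\<rho>. is_pred ords \<rho> \<tau>"
    proof -
      from that obtain \<rho> where p: "is_pred ords \<rho> \<tau>" ..
      then have "(THE \<rho>. is_pred ords \<rho> \<tau>) = \<rho>" by (blast intro: is_pred_unique)
      then show ?thesis using eq p by (simp add: is_pred_def)
    qed
    then show "Iord_step C f \<tau> x = Iord_step C g \<tau> x"
      unfolding Iord_step_def using eq by simp
  qed
  from worec_fixpoint[OF this] show ?thesis unfolding Iord_def .
qed

lemma Iord_zero: "underS ords \<tau> = {} \<Longrightarrow> Iord C \<tau> x = carrier (obj_D C x)"
  by (subst Iord_rec) (simp add: Iord_step_def)

lemma Iord_succ:
  assumes "is_pred ords \<rho> \<tau>"
  shows "Iord C \<tau> x = map_i C (x - deg_a C) ` Iord C \<rho> (x - deg_a C)"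
proof -
  have "(THE \<rho>. is_pred ords \<rho> \<tau>) = \<rho>" using assms by (blast intro: is_pred_unique)
  moreover have "underS ords \<tau> \<noteq> {}" using assms by (auto simp: is_pred_def)
  ultimately show ?thesis using assms by (subst Iord_rec) (auto simp: Iord_step_def)
qed

lemma Iord_limit:
  "underS ords \<tau> \<noteq> {} \<Longrightarrow> \<nexists>\<rho>. is_pred ords \<rho> \<tau> \<Longrightarrow> Iord C \<tau> x = (\<Inter>\<rho>\<in>underS ords \<tau>. Iord C \<rho> x)"
  by (subst Iord_rec) (simp add: Iord_step_def)

lemma couple_i_closed:
  "exact_couple R C \<Longrightarrow> d \<in> carrier (obj_D C (x - deg_a C)) \<Longrightarrow>
   map_i C (x - deg_a C) d \<in> carrier (obj_D C x)"
  unfolding exact_couple_def mod_hom_def by (metis diff_add_cancel)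

lemma Iord_props:
  assumes ec: "exact_couple R C"
  shows "(\<forall>x. Iord C \<tau> x \<subseteq> carrier (obj_D C x)) \<and>
    (\<forall>\<rho>. (\<rho>, \<tau>) \<in> ords \<longrightarrow> (\<forall>x. Iord C \<tau> x \<subseteq> Iord C \<rho> x)) \<and>
    (\<forall>x. map_i C (x - deg_a C) ` Iord C \<tau> (x - deg_a C) \<subseteq> Iord C \<tau> x)"
proof (induction \<tau> rule: wo_rel.well_order_induct[OF ords_wo])
  case (1 \<tau>)
  have IH1: "\<And>\<rho> x. \<rho> \<in> underS ords \<tau> \<Longrightarrow> Iord C \<rho> x \<subseteq> carrier (obj_D C x)"
    and IH2: "\<And>\<rho> \<upsilon> x. \<rho> \<in> underS ords \<tau> \<Longrightarrow> (\<upsilon>, \<rho>) \<in> ords \<Longrightarrow> Iord C \<rho> x \<subseteq> Iord C \<upsilon> x"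
    and IH3: "\<And>\<rho> x. \<rho> \<in> underS ords \<tau> \<Longrightarrow>
      map_i C (x - deg_a C) ` Iord C \<rho> (x - deg_a C) \<subseteq> Iord C \<rho> x"
    using 1 by (simp_all only: underS_def mem_Collect_eq) blast+
  consider (z) "underS ords \<tau> = {}" | (s) \<rho> where "is_pred ords \<rho> \<tau>"
    | (l) "underS ords \<tau> \<noteq> {}" "\<nexists>\<rho>. is_pred ords \<rho> \<tau>" by blast
  then show ?case
  proof cases
    case z
    then have "\<And>\<rho>. (\<rho>, \<tau>) \<in> ords \<Longrightarrow> \<rho> = \<tau>" by (auto simp: underS_def)
    then show ?thesis using couple_i_closed[OF ec] Iord_zero[OF z] by blast
  next
    case s
    then have r: "\<rho> \<in> underS ords \<tau>" and top: "\<And>\<upsilon>. \<upsilon> \<in> underS ords \<tau> \<Longrightarrow> (\<upsilon>, \<rho>) \<in> ords"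
      by (auto simp: is_pred_def)
    have sub: "Iord C \<tau> x \<subseteq> Iord C \<rho> x" for x
      using IH3[OF r] by (simp add: Iord_succ[OF s])
    have "Iord C \<tau> x \<subseteq> Iord C \<upsilon> x" if "(\<upsilon>, \<tau>) \<in> ords" for \<upsilon> x
    proof (cases "\<upsilon> = \<tau>")
      case False
      then have "(\<upsilon>, \<rho>) \<in> ords" using that top by (simp add: underS_def)
      then show ?thesis using IH2[OF r] sub by blast
    qed simp
    moreover have "map_i C (x - deg_a C) ` Iord C \<tau> (x - deg_a C) \<subseteq> Iord C \<tau> x" for x
      using sub[of "x - deg_a C"] by (auto simp: Iord_succ[OF s, of C x])
    ultimately show ?thesis using sub IH1[OF r] by blast
  next
    case l
    have sub: "Iord C \<tau> x \<subseteq> Iord C \<upsilon> x" if "\<upsilon> \<in> underS ords \<tau>" for \<upsilon> x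
      using that by (auto simp: Iord_limit[OF l])
    have "Iord C \<tau> x \<subseteq> Iord C \<upsilon> x" if "(\<upsilon>, \<tau>) \<in> ords" for \<upsilon> x
      using that sub by (cases "\<upsilon> = \<tau>") (auto simp: underS_def)
    moreover have "map_i C (x - deg_a C) ` Iord C \<tau> (x - deg_a C) \<subseteq> Iord C \<tau> x" for x
    proof -
      have "map_i C (x - deg_a C) ` Iord C \<tau> (x - deg_a C) \<subseteq> Iord C \<rho> x"
        if "\<rho> \<in> underS ords \<tau>" for \<rho>
        using IH3[OF that, of x] sub[OF that, of "x - deg_a C"] by blast
      then show ?thesis by (subst Iord_limit[OF l, of C x]) blast
    qed
    moreover obtain \<rho> where r: "\<rho> \<in> underS ords \<tau>" using l(1) by blast
    have "Iord C \<tau> x \<subseteq> carrier (obj_D C x)" for x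
      by (rule order_trans[OF sub[OF r] IH1[OF r]])
    ultimately show ?thesis by simp
  qed
qed

theorem Iord_stabilizes:
  assumes ec: "exact_couple R (C :: ('r, 'd, 'e) exact_couple)"
  shows "\<exists>\<tau>\<^sub>0. \<forall>\<tau> x. (\<tau>\<^sub>0, \<tau>) \<in> ords \<longrightarrow> Iord C \<tau> x = Iord C \<tau>\<^sub>0 x"
proof -
  have anti: "(\<rho>, \<tau>) \<in> ords \<Longrightarrow> Iord C \<tau> x \<subseteq> Iord C \<rho> x" for \<rho> \<tau> x
    using Iord_props[OF ec] by blast
  obtain s :: "'d ord \<Rightarrow> 'd ord" where s: "\<And>\<tau>. is_pred ords \<tau> (s \<tau>)"
    using ords_ex_succ by metis
  have le_s: "(\<tau>, s \<tau>) \<in> ords" "\<tau> \<noteq> s \<tau>" for \<tau> using s[of \<tau>] by (auto simp: is_pred_def underS_def)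
  have "\<exists>\<tau>. \<forall>x. Iord C (s \<tau>) x = Iord C \<tau> x"
  proof (rule ccontr)
    assume "\<not> ?thesis"
    then have "\<forall>\<tau>. \<exists>p. snd p \<in> Iord C \<tau> (fst p) \<and> snd p \<notin> Iord C (s \<tau>) (fst p)"
      using anti[OF le_s(1)] by (metis fst_conv snd_conv subsetI subset_antisym)
    then obtain p where p: "\<And>\<tau>. snd (p \<tau>) \<in> Iord C \<tau> (fst (p \<tau>))"
        "\<And>\<tau>. snd (p \<tau>) \<notin> Iord C (s \<tau>) (fst (p \<tau>))" by metis
    have neq: "p \<rho> \<noteq> p \<tau>" if "(\<rho>, \<tau>) \<in> ords" "\<rho> \<noteq> \<tau>" for \<rho> \<tau>
    proof
      assume e: "p \<rho> = p \<tau>"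
      have "(s \<rho>, \<tau>) \<in> ords"
      proof (rule ccontr)
        assume "(s \<rho>, \<tau>) \<notin> ords"
        then have "\<tau> \<in> underS ords (s \<rho>)" using ords_total ords_refl by (auto simp: underS_def)
        then have "(\<tau>, \<rho>) \<in> ords" using s[of \<rho>] by (simp add: is_pred_def)
        then show False using that ords_antisym by blast
      qed
      then have "Iord C \<tau> (fst (p \<tau>)) \<subseteq> Iord C (s \<rho>) (fst (p \<tau>))" by (rule anti)
      then show False using p(1)[of \<tau>] p(2)[of \<rho>] e by auto
    qed
    then have "inj p" using ords_total by (metis injI)
    have c: "Card_order (ords :: 'd ord rel)"
      unfolding ords_def by (rule Card_order_card_suc[OF card_of_card_order_on])
    have less: "card_of (UNIV :: (bideg \<times> 'd) set) <o (ords :: 'd ord rel)"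
      unfolding ords_def by (rule card_suc_greater[OF card_of_card_order_on])
    have "card_of (UNIV :: 'd ord set) \<le>o card_of (UNIV :: (bideg \<times> 'd) set)"
      using \<open>inj p\<close> card_of_ordLeq[of "UNIV :: 'd ord set" "UNIV :: (bideg \<times> 'd) set"] by blast
    moreover have "(ords :: 'd ord rel) =o card_of (UNIV :: 'd ord set)"
      using ordIso_symmetric[OF card_of_Field_ordIso[OF c]] by (simp add: ords_Field)
    ultimately have "(ords :: 'd ord rel) \<le>o card_of (UNIV :: (bideg \<times> 'd) set)"
      using ordIso_ordLeq_trans by blast
    then show False using less not_ordLess_ordLeq by blast
  qed
  then obtain \<tau>\<^sub>0 where t: "\<And>x. Iord C (s \<tau>\<^sub>0) x = Iord C \<tau>\<^sub>0 x" by blast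
  have "\<forall>x. (\<tau>\<^sub>0, \<tau>) \<in> ords \<longrightarrow> Iord C \<tau> x = Iord C \<tau>\<^sub>0 x" for \<tau>
  proof (induction \<tau> rule: wo_rel.well_order_induct[OF ords_wo])
    case (1 \<tau>)
    show ?case
    proof (intro allI impI)
      fix x assume le: "(\<tau>\<^sub>0, \<tau>) \<in> ords"
      show "Iord C \<tau> x = Iord C \<tau>\<^sub>0 x"
      proof (cases "\<tau> = \<tau>\<^sub>0")
        case False
        then have u: "\<tau>\<^sub>0 \<in> underS ords \<tau>" using le by (simp add: underS_def)
        have IH: "Iord C \<rho> y = Iord C \<tau>\<^sub>0 y" if "\<rho> \<in> underS ords \<tau>" "(\<tau>\<^sub>0, \<rho>) \<in> ords" for \<rho> y
          using 1 that unfolding underS_def by blast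
        show ?thesis
        proof (cases "\<exists>\<rho>. is_pred ords \<rho> \<tau>")
          case True
          then obtain \<rho> where r: "is_pred ords \<rho> \<tau>" ..
          then have "\<rho> \<in> underS ords \<tau>" "(\<tau>\<^sub>0, \<rho>) \<in> ords" using u by (auto simp: is_pred_def)
          then have "Iord C \<tau> x = Iord C (s \<tau>\<^sub>0) x"
            using IH by (simp add: Iord_succ[OF r] Iord_succ[OF s])
          then show ?thesis using t by simp
        next
          case l: False
          have "Iord C \<tau>\<^sub>0 x \<subseteq> Iord C \<rho> x" if "\<rho> \<in> underS ords \<tau>" for \<rho>
            using IH[OF that] anti ords_total by (metis order_refl)
          then have "Iord C \<tau>\<^sub>0 x \<subseteq> Iord C \<tau> x"
            using u Iord_limit[OF _ l, of C x] by blast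
          then show ?thesis using anti[OF le] by blast
        qed
      qed simp
    qed
  qed
  then show ?thesis by blast
qed

end

lemma Ibar_eventually:
  assumes "exact_couple R C"
  shows "\<exists>\<tau>\<^sub>0. \<forall>\<tau> x. (\<tau>\<^sub>0, \<tau>) \<in> ords \<longrightarrow> Iord C \<tau> x = Ibar C x"
proof -
  obtain \<tau>\<^sub>0 where t: "\<And>\<tau> x. (\<tau>\<^sub>0, \<tau>) \<in> ords \<Longrightarrow> Iord C \<tau> x = Iord C \<tau>\<^sub>0 x"
    using Iord_stabilizes[OF assms] by blast
  have "Ibar C x = Iord C \<tau>\<^sub>0 x" for x
    unfolding Ibar_def
  proof (rule the_equality)
    show "\<exists>\<tau>\<^sub>1. \<forall>\<tau>. (\<tau>\<^sub>1, \<tau>) \<in> ords \<longrightarrow> Iord C \<tau> x = Iord C \<tau>\<^sub>0 x" using t by blast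
    show "S = Iord C \<tau>\<^sub>0 x" if S: "\<exists>\<tau>\<^sub>1. \<forall>\<tau>. (\<tau>\<^sub>1, \<tau>) \<in> ords \<longrightarrow> Iord C \<tau> x = S" for S
      using S t ords_total[of \<tau>\<^sub>0] ords_refl by metis
  qed
  then show ?thesis using t by metis
qed

end

theory Submission
  imports Defs
begin

text \<open>
  Fix \<open>n\<close> and look at the part of an exact couple that runs through the points \<open>x\<close> with
  \<open>det [a x] = n\<close>. With \<open>y = x + b + c\<close> this is a \<open>\<int>\<close>-indexed family of exact sequences
  \<open>D\<^bsub>x-a\<^esub> \<rightarrow> D\<^sub>x \<rightarrow> E\<^bsub>x+b\<^esub> \<rightarrow> D\<^sub>y \<rightarrow> D\<^bsub>y+a\<^esub>\<close>, and regularity says that the points \<open>y\<close>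
  run exactly through the line of index \<open>n + \<sigma>\<close>. The locale \<open>exact_strand\<close> captures this family.

  In every strand \<open>j\<close> embeds \<open>\<epsilon>\<^sub>x\<close> into the limit page (\<open>J_boundary_iff\<close>). The cokernel is the
  image under \<open>k\<close> of the permanent cycles. If the page is stable, these images lift to the inverse
  limit, because an element of the transfinite image has a preimage in the transfinite image, hence
  a whole coherent sequence of iterated preimages (\<open>Ibar_lift\<close>). So there is a short exact sequence
  \<open>0 \<rightarrow> \<epsilon>\<^sub>x \<rightarrow> E\<^sup>\<infinity> \<rightarrow> \<epsilon>\<^sup>y \<rightarrow> 0\<close>. An isomorphism of the middle terms is
  injective on \<open>\<epsilon>\<^sub>x\<close>, surjective on \<open>\<epsilon>\<^sup>y\<close>, and the cokernel on the left is the kernel on the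
  right. Hence each of the two alternatives in (iii) implies the other one, and all graded pieces of
  both filtrations are mapped isomorphically.

  It remains to pass from graded pieces to filtered modules. The colimit is exhausted by its
  filtration, but the filtration may fail to be Hausdorff and complete; the two defects are measured
  by \<open>lim\<close> and \<open>lim\<^sup>1\<close> of the filtration and are controlled by (iv) and (v) (\<open>filtered_bij_lim\<close>).
  The limit is complete and Hausdorff for its filtration, so successive approximation works there
  without further input (\<open>fM_kernel\<close>, \<open>fM_image\<close>), but it reaches only the union of the filtration
  submodules, which is the kernel of the map from the limit to the colimit; (vi) controls the image
  of that map (\<open>fM_bij\<close>).
\<close>


section \<open>Submodules, quotients and difference\<close>

lemma submoduleD:
  assumes "left_module R M" "submodule N R M"
  shows "x \<in> N \<Longrightarrow> x \<in> carrier M" "\<zero>\<^bsub>M\<^esub> \<in> N"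
    and "x \<in> N \<Longrightarrow> y \<in> N \<Longrightarrow> x \<oplus>\<^bsub>M\<^esub> y \<in> N"
    and "x \<in> N \<Longrightarrow> y \<in> N \<Longrightarrow> x \<ominus>\<^bsub>M\<^esub> y \<in> N"
    and "a \<in> carrier R \<Longrightarrow> x \<in> N \<Longrightarrow> a \<odot>\<^bsub>M\<^esub> x \<in> N"
proof -
  interpret M: left_module R M by (rule assms)
  interpret N: submodule N R M by (rule assms)
  show "x \<in> N \<Longrightarrow> x \<in> carrier M" using N.subset by auto
  show "\<zero>\<^bsub>M\<^esub> \<in> N" using N.one_closed by simp
  show add: "x \<in> N \<Longrightarrow> y \<in> N \<Longrightarrow> x \<oplus>\<^bsub>M\<^esub> y \<in> N" for x y using N.m_closed by simp
  have "y \<in> N \<Longrightarrow> \<ominus>\<^bsub>M\<^esub> y \<in> N" for y using N.m_inv_closed by (simp add: a_inv_def)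
  then show "x \<in> N \<Longrightarrow> y \<in> N \<Longrightarrow> x \<ominus>\<^bsub>M\<^esub> y \<in> N" using add by (simp add: a_minus_def)
  show "a \<in> carrier R \<Longrightarrow> x \<in> N \<Longrightarrow> a \<odot>\<^bsub>M\<^esub> x \<in> N" by (rule N.smult_closed)
qed

lemma restrict_mod_minus:
  assumes M: "left_module R M" and N: "submodule N R M" and x: "x \<in> N" and y: "y \<in> N"
  shows "x \<ominus>\<^bsub>restrict_mod M N\<^esub> y = x \<ominus>\<^bsub>M\<^esub> y"
proof -
  have "mod_hom R (restrict_mod M N) M (\<lambda>z. z)"
    using submoduleD(1)[OF M N] by (simp add: mod_hom_def)
  from mod_hom_minus[OF submod_left_module[OF M N] M this] x y show ?thesis by simp
qed

lemma submodule_restrict: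
  assumes M: "left_module R M" and S: "submodule S R M" and N: "submodule N R M" and "N \<subseteq> S"
  shows "submodule N R (restrict_mod M S)"
  using assms(4) submoduleD[OF M N]
  by (intro submodI[OF submod_left_module[OF M S]]) (auto simp: restrict_mod_minus[OF M S] subset_iff)

lemma hom_preimage_submod:
  assumes M: "left_module R M" and M': "left_module R M'" and h: "mod_hom R M M' h"
    and N: "submodule N R M'"
  shows "submodule {x \<in> carrier M. h x \<in> N} R M"
  using submoduleD[OF M' N] left_module_a[OF M] mod_hom_zero[OF M M' h] mod_hom_minus[OF M M' h]
    mod_hom_smult[OF h]
  by (intro submodI[OF M]) auto

lemma zero_submod:
  assumes M: "left_module R M"
  shows "submodule {\<zero>\<^bsub>M\<^esub>} R M"
proof (rule submodI[OF M])
  interpret M: left_module R M by (rule M)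
  show "a \<odot>\<^bsub>M\<^esub> x \<in> {\<zero>\<^bsub>M\<^esub>}" if "a \<in> carrier R" "x \<in> {\<zero>\<^bsub>M\<^esub>}" for a x
  proof -
    have z: "\<zero>\<^bsub>M\<^esub> \<ominus>\<^bsub>M\<^esub> \<zero>\<^bsub>M\<^esub> = \<zero>\<^bsub>M\<^esub>" using left_module_minus(3)[OF M] by simp
    have "a \<odot>\<^bsub>M\<^esub> \<zero>\<^bsub>M\<^esub> = a \<odot>\<^bsub>M\<^esub> \<zero>\<^bsub>M\<^esub> \<ominus>\<^bsub>M\<^esub> a \<odot>\<^bsub>M\<^esub> \<zero>\<^bsub>M\<^esub>"
      using left_module_minus(2)[OF M that(1) M.zero_closed M.zero_closed] by (simp only: z)
    also have "\<dots> = \<zero>\<^bsub>M\<^esub>"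
      using left_module_minus(3)[OF M] M.smult_closed[OF that(1) M.zero_closed] by blast
    finally show ?thesis using that(2) by simp
  qed
qed (use left_module_minus(3)[OF M] left_module_a(2)[OF M] in auto)

lemma kernel_submod:
  assumes "left_module R M" "left_module R M'" "mod_hom R M M' h"
  shows "submodule (a_kernel M M' h) R M"
  using hom_preimage_submod[OF assms zero_submod[OF assms(2)]] by (simp add: a_kernel_def')

lemma hom_image_of_submod:
  assumes M: "left_module R M" and M': "left_module R M'" and h: "mod_hom R M M' h"
    and N: "submodule N R M"
  shows "submodule (h ` N) R M'"
  using hom_image_submod[OF submod_left_module[OF M N] M', of h] h submoduleD(1)[OF M N]
  by (simp add: mod_hom_def)

lemma hom_inj_onI:
  assumes M: "left_module R M" and M': "left_module R M'" and h: "mod_hom R M M' h"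
    and ker: "\<And>x. x \<in> carrier M \<Longrightarrow> h x = \<zero>\<^bsub>M'\<^esub> \<Longrightarrow> x = \<zero>\<^bsub>M\<^esub>"
  shows "inj_on h (carrier M)"
proof (rule inj_onI)
  fix x y assume xy: "x \<in> carrier M" "y \<in> carrier M" and "h x = h y"
  then have "h (x \<ominus>\<^bsub>M\<^esub> y) = \<zero>\<^bsub>M'\<^esub>"
    using mod_hom_minus[OF M M' h xy] left_module_minus(3)[OF M'] mod_hom_closed[OF h] by metis
  then have "x \<ominus>\<^bsub>M\<^esub> y = \<zero>\<^bsub>M\<^esub>" using ker left_module_a(4)[OF M] xy by blast
  then show "x = y" using left_module_minus(3)[OF M] xy by blast
qed

lemma left_module_minus_exchange:
  assumes M: "left_module R M" and c: "x \<in> carrier M" "y \<in> carrier M" "u \<in> carrier M" "v \<in> carrier M"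
    and e: "x \<ominus>\<^bsub>M\<^esub> y = u \<ominus>\<^bsub>M\<^esub> v"
  shows "x \<ominus>\<^bsub>M\<^esub> u = y \<ominus>\<^bsub>M\<^esub> v"
proof -
  interpret M: left_module R M by (rule M)
  have "x = (u \<ominus>\<^bsub>M\<^esub> v) \<oplus>\<^bsub>M\<^esub> y" using left_module_minus(5)[OF M c(1,2)] e by simp
  also have "\<dots> = (y \<ominus>\<^bsub>M\<^esub> v) \<oplus>\<^bsub>M\<^esub> u" using c by (simp add: M.minus_eq M.a_ac)
  finally show ?thesis using c by (simp add: M.minus_eq M.a_assoc M.r_neg)
qed

lemma left_module_minus_add:
  assumes M: "left_module R M" and c: "x \<in> carrier M" "y \<in> carrier M" "u \<in> carrier M"
  shows "x \<ominus>\<^bsub>M\<^esub> (y \<oplus>\<^bsub>M\<^esub> u) = (x \<ominus>\<^bsub>M\<^esub> y) \<ominus>\<^bsub>M\<^esub> u"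
proof -
  interpret M: left_module R M by (rule M)
  show ?thesis using c by (simp add: M.minus_eq M.minus_add M.a_ac)
qed

lemma quot_map_coset:
  assumes M: "left_module R M" and N: "submodule N R M"
    and M': "left_module R M'" and N': "submodule N' R M'"
    and h: "mod_hom R M M' h" and hN: "\<And>x. x \<in> N \<Longrightarrow> h x \<in> N'" and x: "x \<in> carrier M"
  shows "quot_map M' N' h (N +>\<^bsub>M\<^esub> x) = N' +>\<^bsub>M'\<^esub> h x"
proof -
  interpret M: left_module R M by (rule M)
  interpret M': left_module R M' by (rule M')
  have "N' +>\<^bsub>M'\<^esub> h z = N' +>\<^bsub>M'\<^esub> h x" if z: "z \<in> N +>\<^bsub>M\<^esub> x" for z
  proof -
    obtain n where n: "n \<in> N" "z = n \<oplus>\<^bsub>M\<^esub> x" using z by (auto simp: a_r_coset_def')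
    have nc: "n \<in> carrier M" using submoduleD(1)[OF M N] n by blast
    have "h z = h n \<oplus>\<^bsub>M'\<^esub> h x" using mod_hom_add[OF h nc x] n by simp
    then have "h z \<ominus>\<^bsub>M'\<^esub> h x = h n"
      using mod_hom_closed[OF h] nc x by (simp add: M'.minus_eq M'.a_assoc M'.r_neg)
    then have "h z \<ominus>\<^bsub>M'\<^esub> h x \<in> N'" using hN n by simp
    moreover have "z \<in> carrier M" using n nc x by simp
    ultimately show ?thesis using quot_eq_iff[OF M' N'] mod_hom_closed[OF h] x by blast
  qed
  moreover have "x \<in> N +>\<^bsub>M\<^esub> x"
    using submoduleD(2)[OF M N] x by (force simp: a_r_coset_def' intro: M.l_zero[symmetric])
  ultimately show ?thesis unfolding quot_map_def by blast
qed

text \<open>Maps induced on quotients are used only through representatives: the next lemmas turn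
  injectivity and surjectivity on cosets into statements about elements of the modules
  themselves.\<close>

lemma quot_map_injD:
  assumes M: "left_module R M" and N: "submodule N R M"
    and M': "left_module R M'" and N': "submodule N' R M'"
    and h: "mod_hom R M M' h" and hN: "\<And>x. x \<in> N \<Longrightarrow> h x \<in> N'"
    and inj: "inj_on (quot_map M' N' h) (carrier (quot_mod M N))"
    and x: "x \<in> carrier M" and hx: "h x \<in> N'"
  shows "x \<in> N"
proof -
  have z: "\<zero>\<^bsub>M\<^esub> \<in> carrier M" by (rule left_module_a(2)[OF M])
  have "N' +>\<^bsub>M'\<^esub> h x = N' +>\<^bsub>M'\<^esub> h \<zero>\<^bsub>M\<^esub>"
    using quot_zero_iff[OF M' N'] hx hN submoduleD(2)[OF M N] mod_hom_closed[OF h] x z by metis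
  then have "quot_map M' N' h (N +>\<^bsub>M\<^esub> x) = quot_map M' N' h (N +>\<^bsub>M\<^esub> \<zero>\<^bsub>M\<^esub>)"
    using quot_map_coset[OF assms(1-6)] x z by simp
  then have "N +>\<^bsub>M\<^esub> x = N +>\<^bsub>M\<^esub> \<zero>\<^bsub>M\<^esub>" using inj x z by (auto simp: quot_carrier inj_on_def)
  then show ?thesis using quot_zero_iff[OF M N] x z submoduleD(2)[OF M N] by metis
qed

lemma quot_map_surjD:
  assumes M: "left_module R M" and N: "submodule N R M"
    and M': "left_module R M'" and N': "submodule N' R M'"
    and h: "mod_hom R M M' h" and hN: "\<And>x. x \<in> N \<Longrightarrow> h x \<in> N'"
    and surj: "quot_map M' N' h ` carrier (quot_mod M N) = carrier (quot_mod M' N')"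
    and y: "y \<in> carrier M'"
  shows "\<exists>x\<in>carrier M. y \<ominus>\<^bsub>M'\<^esub> h x \<in> N'"
proof -
  have "N' +>\<^bsub>M'\<^esub> y \<in> quot_map M' N' h ` carrier (quot_mod M N)"
    using surj y by (simp add: quot_carrier)
  then obtain x where x: "x \<in> carrier M" "N' +>\<^bsub>M'\<^esub> y = quot_map M' N' h (N +>\<^bsub>M\<^esub> x)"
    by (auto simp: quot_carrier)
  then have "N' +>\<^bsub>M'\<^esub> y = N' +>\<^bsub>M'\<^esub> h x" using quot_map_coset[OF assms(1-6)] by simp
  then show ?thesis using quot_eq_iff[OF M' N' y] mod_hom_closed[OF h] x(1) by blast
qed

text \<open>The same for subquotients \<open>S/N\<close>; the difference is formed in the ambient module.\<close>

lemma subquot_map_injD: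
  assumes M: "left_module R M" and S: "submodule S R M" and N: "submodule N R M" and "N \<subseteq> S"
    and M': "left_module R M'" and S': "submodule S' R M'" and N': "submodule N' R M'" and "N' \<subseteq> S'"
    and h: "mod_hom R M M' h" and hS: "\<And>x. x \<in> S \<Longrightarrow> h x \<in> S'" and hN: "\<And>x. x \<in> N \<Longrightarrow> h x \<in> N'"
    and inj: "inj_on (quot_map (restrict_mod M' S') N' h) (carrier (quot_mod (restrict_mod M S) N))"
    and x: "x \<in> S" and hx: "h x \<in> N'"
  shows "x \<in> N"
proof (rule quot_map_injD[OF submod_left_module[OF M S] submodule_restrict[OF M S N]
      submod_left_module[OF M' S'] submodule_restrict[OF M' S' N']])
  show "mod_hom R (restrict_mod M S) (restrict_mod M' S') h"
    using h hS submoduleD(1)[OF M S] by (simp add: mod_hom_def)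
qed (use assms in simp_all)

lemma subquot_map_surjD:
  assumes M: "left_module R M" and S: "submodule S R M" and N: "submodule N R M" and "N \<subseteq> S"
    and M': "left_module R M'" and S': "submodule S' R M'" and N': "submodule N' R M'" and "N' \<subseteq> S'"
    and h: "mod_hom R M M' h" and hS: "\<And>x. x \<in> S \<Longrightarrow> h x \<in> S'" and hN: "\<And>x. x \<in> N \<Longrightarrow> h x \<in> N'"
    and surj: "quot_map (restrict_mod M' S') N' h ` carrier (quot_mod (restrict_mod M S) N)
      = carrier (quot_mod (restrict_mod M' S') N')"
    and y: "y \<in> S'"
  shows "\<exists>x\<in>S. y \<ominus>\<^bsub>M'\<^esub> h x \<in> N'"
proof -
  have "mod_hom R (restrict_mod M S) (restrict_mod M' S') h"
    using h hS submoduleD(1)[OF M S] by (simp add: mod_hom_def)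
  from quot_map_surjD[OF submod_left_module[OF M S] submodule_restrict[OF M S N]
      submod_left_module[OF M' S'] submodule_restrict[OF M' S' N'] this hN surj, of y]
  show ?thesis using assms restrict_mod_minus[OF M' S'] by auto
qed


section \<open>Colimits and limits as modules\<close>

lemma colim_in_shifts:
  assumes d: "diagram R A g" and x: "x \<in> carrier (A r)"
  shows "colim_in A g (r + int p) (trans_map g r p x) = colim_in A g r x"
proof (induction p)
  case (Suc p)
  show ?case
    using Suc colim_in_shift[OF d trans_map_closed[OF d x, of p]] by (simp add: ac_simps)
qed simp

lemma colim_rep:
  assumes d: "diagram R A g" and X: "X \<in> carrier (colim_mod A g)"
  shows "\<exists>r. \<forall>s\<ge>r. \<exists>x\<in>carrier (A s). X = colim_in A g s x"
proof -
  obtain r x where x: "x \<in> carrier (A r)" "X = colim_in A g r x"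
    using X by (auto simp: colim_mod_def)
  have "\<exists>x\<in>carrier (A s). X = colim_in A g s x" if "s \<ge> r" for s
    using colim_in_shifts[OF d x(1), of "nat (s - r)"] trans_map_closed[OF d x(1), of "nat (s - r)"]
      that x(2) by auto
  then show ?thesis by blast
qed

lemma colim_in_zero:
  assumes d: "diagram R A g"
  shows "colim_in A g r \<zero>\<^bsub>A r\<^esub> = \<zero>\<^bsub>colim_mod A g\<^esub>"
proof -
  have m: "left_module R (A s)" for s using d by (simp add: diagram_def)
  have t: "colim_in A g (s + int p) \<zero>\<^bsub>A (s + int p)\<^esub> = colim_in A g s \<zero>\<^bsub>A s\<^esub>" for s p
    using colim_in_shifts[OF d left_module_a(2)[OF m], of s p]
      mod_hom_zero[OF m m trans_map_hom[OF d], of s p] by simp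
  have "colim_in A g r \<zero>\<^bsub>A r\<^esub> = colim_in A g 0 \<zero>\<^bsub>A 0\<^esub>"
    using t[of 0 "nat r"] t[of r "nat (- r)"] by (cases "r \<ge> 0") auto
  then show ?thesis by (simp add: colim_mod_def)
qed

text \<open>Finitely many germs have representatives at a common index, where the module axioms hold;
  \<open>colim_in\<close> is linear and carries them over.\<close>

lemma colim_left_module:
  fixes A :: "int \<Rightarrow> ('r, 'm) module"
  assumes d: "diagram R A g"
  shows "left_module R (colim_mod A g)"
proof -
  let ?L = "colim_mod A g"
  have m: "left_module R (A s)" for s using d by (simp add: diagram_def)
  have ab: "abelian_group (A s)" for s using m by (rule left_module_abelian)
  have rg: "ring R" using m[of 0] by (simp add: left_module_def)
  note hom = colim_in_hom[OF d]
  note cl = mod_hom_closed[OF hom]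
  note add = mod_hom_add[OF hom, symmetric]
  note sm = mod_hom_smult[OF hom, symmetric]
  note zero = colim_in_zero[OF d, symmetric]
  have rep3: thesis if "X \<in> carrier ?L" "Y \<in> carrier ?L" "W \<in> carrier ?L"
    "\<And>r x y w. x \<in> carrier (A r) \<Longrightarrow> y \<in> carrier (A r) \<Longrightarrow> w \<in> carrier (A r) \<Longrightarrow>
      X = colim_in A g r x \<Longrightarrow> Y = colim_in A g r y \<Longrightarrow> W = colim_in A g r w \<Longrightarrow> thesis"
    for X Y W thesis
  proof -
    obtain r1 r2 r3 where
      "\<forall>s\<ge>r1. \<exists>x\<in>carrier (A s). X = colim_in A g s x"
      "\<forall>s\<ge>r2. \<exists>x\<in>carrier (A s). Y = colim_in A g s x"
      "\<forall>s\<ge>r3. \<exists>x\<in>carrier (A s). W = colim_in A g s x"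
      using colim_rep[OF d] \<open>X \<in> carrier ?L\<close> \<open>Y \<in> carrier ?L\<close> \<open>W \<in> carrier ?L\<close> by meson
    moreover have "r1 \<le> max r1 (max r2 r3)" "r2 \<le> max r1 (max r2 r3)" "r3 \<le> max r1 (max r2 r3)"
      by auto
    ultimately show thesis using that(4)[of _ "max r1 (max r2 r3)"] by meson
  qed
  show ?thesis
  proof (rule left_moduleI[OF rg])
    show "abelian_group ?L"
    proof (rule abelian_groupI)
      fix X assume X: "X \<in> carrier ?L"
      show "\<exists>Y\<in>carrier ?L. Y \<oplus>\<^bsub>?L\<^esub> X = \<zero>\<^bsub>?L\<^esub>"
      proof (rule rep3[OF X X X])
        fix r x assume x: "x \<in> carrier (A r)" "X = colim_in A g r x"
        interpret Ar: left_module R "A r" by (rule m)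
        show ?thesis
          using x cl by (intro bexI[of _ "colim_in A g r (\<ominus>\<^bsub>A r\<^esub> x)"])
            (simp_all add: add Ar.l_neg zero[of r])
      qed
      show "\<zero>\<^bsub>?L\<^esub> \<oplus>\<^bsub>?L\<^esub> X = X"
      proof (rule rep3[OF X X X])
        fix r x assume x: "x \<in> carrier (A r)" "X = colim_in A g r x"
        interpret Ar: left_module R "A r" by (rule m)
        show ?thesis using x by (simp add: add zero[of r])
      qed
      fix Y assume Y: "Y \<in> carrier ?L"
      show "X \<oplus>\<^bsub>?L\<^esub> Y \<in> carrier ?L"
      proof (rule rep3[OF X Y Y])
        fix r x y assume x: "x \<in> carrier (A r)" "X = colim_in A g r x"
          and y: "y \<in> carrier (A r)" "Y = colim_in A g r y"
        interpret Ar: left_module R "A r" by (rule m)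
        show ?thesis using x y cl by (simp add: add)
      qed
      show "X \<oplus>\<^bsub>?L\<^esub> Y = Y \<oplus>\<^bsub>?L\<^esub> X"
      proof (rule rep3[OF X Y Y])
        fix r x y assume x: "x \<in> carrier (A r)" "X = colim_in A g r x"
          and y: "y \<in> carrier (A r)" "Y = colim_in A g r y"
        interpret Ar: left_module R "A r" by (rule m)
        show ?thesis using x y by (simp add: add Ar.a_comm)
      qed
      fix W assume W: "W \<in> carrier ?L"
      show "X \<oplus>\<^bsub>?L\<^esub> Y \<oplus>\<^bsub>?L\<^esub> W = X \<oplus>\<^bsub>?L\<^esub> (Y \<oplus>\<^bsub>?L\<^esub> W)"
      proof (rule rep3[OF X Y W])
        fix r x y w assume x: "x \<in> carrier (A r)" "X = colim_in A g r x"
          and y: "y \<in> carrier (A r)" "Y = colim_in A g r y"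
          and w: "w \<in> carrier (A r)" "W = colim_in A g r w"
        interpret Ar: left_module R "A r" by (rule m)
        show ?thesis using x y w by (simp add: add Ar.a_assoc)
      qed
    next
      show "\<zero>\<^bsub>?L\<^esub> \<in> carrier ?L" using cl[OF left_module_a(2)[OF m, of 0]] by (simp add: zero[of 0])
    qed
  next
    fix a X assume a: "a \<in> carrier R" and X: "X \<in> carrier ?L"
    show "a \<odot>\<^bsub>?L\<^esub> X \<in> carrier ?L"
      by (rule rep3[OF X X X]) (use a cl left_module_a(5)[OF m] in \<open>simp add: sm\<close>)
    fix Y assume Y: "Y \<in> carrier ?L"
    show "a \<odot>\<^bsub>?L\<^esub> (X \<oplus>\<^bsub>?L\<^esub> Y) = a \<odot>\<^bsub>?L\<^esub> X \<oplus>\<^bsub>?L\<^esub> a \<odot>\<^bsub>?L\<^esub> Y"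
      by (rule rep3[OF X Y Y])
        (use a cl left_module_a[OF m] left_module.smult_r_distr[OF m] in \<open>simp add: sm add\<close>)
  next
    fix a b X assume a: "a \<in> carrier R" "b \<in> carrier R" and X: "X \<in> carrier ?L"
    interpret R: ring R by (rule rg)
    show "(a \<oplus>\<^bsub>R\<^esub> b) \<odot>\<^bsub>?L\<^esub> X = a \<odot>\<^bsub>?L\<^esub> X \<oplus>\<^bsub>?L\<^esub> b \<odot>\<^bsub>?L\<^esub> X"
      by (rule rep3[OF X X X])
        (use a cl left_module_a[OF m] left_module.smult_l_distr[OF m] in \<open>simp add: sm add\<close>)
    show "(a \<otimes>\<^bsub>R\<^esub> b) \<odot>\<^bsub>?L\<^esub> X = a \<odot>\<^bsub>?L\<^esub> (b \<odot>\<^bsub>?L\<^esub> X)"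
      by (rule rep3[OF X X X])
        (use a cl left_module_a[OF m] left_module.smult_assoc1[OF m] in \<open>simp add: sm add\<close>)
  next
    fix X assume X: "X \<in> carrier ?L"
    interpret R: ring R by (rule rg)
    show "\<one>\<^bsub>R\<^esub> \<odot>\<^bsub>?L\<^esub> X = X"
      by (rule rep3[OF X X X]) (use left_module.smult_one[OF m] in \<open>simp add: sm\<close>)
  qed
qed

lemma colim_in_eq_zero_iff:
  assumes d: "diagram R A g" and x: "x \<in> carrier (A r)"
  shows "colim_in A g r x = \<zero>\<^bsub>colim_mod A g\<^esub> \<longleftrightarrow> (\<exists>p. trans_map g r p x = \<zero>\<^bsub>A (r + int p)\<^esub>)"
proof -
  have m: "left_module R (A s)" for s using d by (simp add: diagram_def)
  have "colim_in A g r x = \<zero>\<^bsub>colim_mod A g\<^esub> \<longleftrightarrow>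
      (\<exists>p q. r + int p = r + int q \<and> trans_map g r p x = trans_map g r q \<zero>\<^bsub>A r\<^esub>)"
    using colim_in_eq_iff[where A = A and g = g and r = r and s = r, OF x left_module_a(2)[OF m]]
    by (simp only: colim_in_zero[OF d])
  then show ?thesis using mod_hom_zero[OF m m trans_map_hom[OF d], of r] by auto
qed

lemma trans_map_natural:
  assumes "diagram R A g" "diagram_hom R A g B h f" "x \<in> carrier (A r)"
  shows "trans_map h r p (f r x) = f (r + int p) (trans_map g r p x)"
proof (induction p)
  case (Suc p)
  have "f (r + int p + 1) (g (r + int p) (trans_map g r p x))
      = h (r + int p) (f (r + int p) (trans_map g r p x))"
    using assms trans_map_closed[OF assms(1,3)] by (simp add: diagram_hom_def)
  with Suc show ?case by (simp add: ac_simps)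
qed simp

lemma colim_map_in:
  assumes A: "diagram R A g" and B: "diagram R B h" and f: "diagram_hom R A g B h f"
    and x: "x \<in> carrier (A r)"
  shows "colim_map B h f (colim_in A g r x) = colim_in B h r (f r x)"
proof -
  have fc: "f s y \<in> carrier (B s)" if "y \<in> carrier (A s)" for s y
    using f that unfolding diagram_hom_def by (meson mod_hom_closed)
  have "colim_in B h s (f s y) = colim_in B h r (f r x)" if y: "(s, y) \<in> colim_in A g r x" for s y
  proof -
    from y obtain p q where yc: "y \<in> carrier (A s)" and pq: "r + int p = s + int q"
      and e: "trans_map g r p x = trans_map g s q y" by (auto simp: colim_in_def)
    have "trans_map h s q (f s y) = trans_map h r p (f r x)"
      unfolding trans_map_natural[OF A f yc] trans_map_natural[OF A f x] by (simp only: pq e)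
    then show ?thesis
      using pq colim_in_eq_iff[where A = B and g = h, OF fc[OF yc] fc[OF x]] by metis
  qed
  moreover have "(r, x) \<in> colim_in A g r x" using x by (rule colim_in_self)
  ultimately show ?thesis unfolding colim_map_def by blast
qed

lemma colim_map_hom:
  assumes A: "diagram R A g" and B: "diagram R B h" and f: "diagram_hom R A g B h f"
  shows "mod_hom R (colim_mod A g) (colim_mod B h) (colim_map B h f)"
  unfolding mod_hom_def
proof (intro conjI ballI)
  have fh: "mod_hom R (A s) (B s) (f s)" for s using f by (simp add: diagram_hom_def)
  have m: "left_module R (A s)" for s using A by (simp add: diagram_def)
  note hA = colim_in_hom[OF A]
  note hB = colim_in_hom[OF B]
  note cm = colim_map_in[OF A B f]
  fix X assume X: "X \<in> carrier (colim_mod A g)"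
  obtain r where r: "\<And>s. s \<ge> r \<Longrightarrow> \<exists>x\<in>carrier (A s). X = colim_in A g s x"
    using colim_rep[OF A X] by blast
  then obtain x where x: "x \<in> carrier (A r)" "X = colim_in A g r x" by blast
  show "colim_map B h f X \<in> carrier (colim_mod B h)"
    using x cm mod_hom_closed[OF hB] mod_hom_closed[OF fh] by simp
  show "colim_map B h f (a \<odot>\<^bsub>colim_mod A g\<^esub> X) = a \<odot>\<^bsub>colim_mod B h\<^esub> colim_map B h f X"
    if a: "a \<in> carrier R" for a
    using x a cm mod_hom_smult[OF hB] mod_hom_smult[OF fh] mod_hom_closed[OF fh]
      left_module_a(5)[OF m]
    by (simp add: mod_hom_smult[OF hA, symmetric])
  fix Y assume Y: "Y \<in> carrier (colim_mod A g)"
  obtain r' where r': "\<And>s. s \<ge> r' \<Longrightarrow> \<exists>x\<in>carrier (A s). Y = colim_in A g s x"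
    using colim_rep[OF A Y] by blast
  obtain x' y' where x': "x' \<in> carrier (A (max r r'))" "X = colim_in A g (max r r') x'"
    and y': "y' \<in> carrier (A (max r r'))" "Y = colim_in A g (max r r') y'"
    using r[of "max r r'"] r'[of "max r r'"] by auto
  then show "colim_map B h f (X \<oplus>\<^bsub>colim_mod A g\<^esub> Y)
      = colim_map B h f X \<oplus>\<^bsub>colim_mod B h\<^esub> colim_map B h f Y"
    using cm mod_hom_add[OF hB] mod_hom_add[OF fh] mod_hom_closed[OF fh]
      left_module_a(1)[OF m]
    by (simp add: mod_hom_add[OF hA, symmetric])
qed

lemma lim_carrier:
  "\<phi> \<in> carrier (lim_mod A g) \<longleftrightarrow> (\<forall>r. \<phi> r \<in> carrier (A r)) \<and> (\<forall>r. g r (\<phi> r) = \<phi> (r + 1))"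
  by (auto simp: lim_mod_def prod_mod_def)

lemma lim_left_module:
  assumes d: "diagram R A g"
  shows "left_module R (lim_mod A g)"
proof -
  have P: "left_module R (prod_mod A)" using d by (intro prod_mod_left_module) (simp add: diagram_def)
  show ?thesis
    using submod_left_module[OF P kernel_submod[OF P P lim_diff_hom[OF d]]] lim_mod_ker[OF d] by simp
qed

lemma lim_proj_hom: "mod_hom R (lim_mod A g) (A r) (\<lambda>\<phi>. \<phi> r)"
  by (simp add: mod_hom_def prod_mod_def lim_mod_def)

lemma lim_map_hom:
  assumes "diagram_hom R A g B h f"
  shows "mod_hom R (lim_mod A g) (lim_mod B h) (lim_map f)"
proof -
  have f: "mod_hom R (A r) (B r) (f r)" for r using assms by (simp add: diagram_hom_def)
  have c: "\<And>r x. x \<in> carrier (A r) \<Longrightarrow> f (r + 1) (g r x) = h r (f r x)"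
    using assms by (simp add: diagram_hom_def)
  have "lim_map f \<phi> \<in> carrier (lim_mod B h)" if "\<phi> \<in> carrier (lim_mod A g)" for \<phi>
    using that mod_hom_closed[OF f] unfolding lim_carrier lim_map_def by (metis c)
  then show ?thesis
    using prod_hom[OF assms] unfolding mod_hom_def by (simp add: lim_mod_def)
qed

lemma lim_zero: "\<zero>\<^bsub>lim_mod A g\<^esub> = (\<lambda>r. \<zero>\<^bsub>A r\<^esub>)"
  by (simp add: lim_mod_def prod_mod_def)

lemma lim_trans_map:
  assumes "\<phi> \<in> carrier (lim_mod A g)"
  shows "trans_map g r p (\<phi> r) = \<phi> (r + int p)"
proof (induction p)
  case (Suc p)
  then show ?case using assms by (simp add: lim_carrier ac_simps)
qed simp

text \<open>The kernel of the map from the limit to the colimit is the union of the submodules of families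
  that vanish at a given index.\<close>

lemma lim_germ_zero:
  fixes B :: "int \<Rightarrow> ('r, 'b) module"
  assumes B: "diagram R B h" and phi: "\<phi> \<in> carrier (lim_mod B h)"
    and "colim_in B h 0 (\<phi> 0) = \<zero>\<^bsub>colim_mod B h\<^esub>"
  shows "\<exists>r. \<phi> r = \<zero>\<^bsub>B r\<^esub>"
  using assms(3) colim_in_eq_zero_iff[where r = 0, OF B] phi lim_trans_map[OF phi, of 0]
  by (auto simp: lim_carrier)


section \<open>Strands of an exact couple\<close>

text \<open>The index \<open>r\<close> stands for a step along the degree of \<open>i\<close>, so that \<open>g\<close> and \<open>h\<close> are two
  instances of \<open>i\<close> on neighbouring lines of the bigraded couple.\<close>

locale exact_strand =
  fixes R :: "('r, 't) ring_scheme"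
    and A :: "int \<Rightarrow> ('r, 'a) module" and g :: "int \<Rightarrow> 'a \<Rightarrow> 'a"
    and E :: "int \<Rightarrow> ('r, 'e) module" and J :: "int \<Rightarrow> 'a \<Rightarrow> 'e" and K :: "int \<Rightarrow> 'e \<Rightarrow> 'b"
    and B :: "int \<Rightarrow> ('r, 'b) module" and h :: "int \<Rightarrow> 'b \<Rightarrow> 'b"
  assumes A: "diagram R A g" and B: "diagram R B h" and E: "left_module R (E r)"
    and J: "mod_hom R (A r) (E r) (J r)" and K: "mod_hom R (E r) (B r) (K r)"
    and exact_A: "g (r - 1) ` carrier (A (r - 1)) = a_kernel (A r) (E r) (J r)"
    and exact_E: "J r ` carrier (A r) = a_kernel (E r) (B r) (K r)"
    and exact_B: "K r ` carrier (E r) = a_kernel (B r) (B (r + 1)) (h r)"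
begin

lemma modules: "left_module R (A r)" "left_module R (B r)"
  using A B by (simp_all add: diagram_def)

lemma maps: "mod_hom R (A (r - 1)) (A r) (g (r - 1))" "mod_hom R (B r) (B (r + 1)) (h r)"
  using A B unfolding diagram_def by (metis diff_add_cancel, blast)

abbreviation germ :: "int \<Rightarrow> 'a \<Rightarrow> (int \<times> 'a) set" where
  "germ r \<equiv> colim_in A g r"

definition colim_filt :: "int \<Rightarrow> (int \<times> 'a) set set" where
  "colim_filt r = germ r ` carrier (A r)"

definition lim_filt :: "int \<Rightarrow> (int \<Rightarrow> 'b) set" where
  "lim_filt r = {\<phi> \<in> carrier (lim_mod B h). \<phi> r = \<zero>\<^bsub>B r\<^esub>}"

definition cycles :: "int \<Rightarrow> 'e set" where
  "cycles r = {e \<in> carrier (E r). \<forall>p. K r e \<in> trans_map h (r - int p) p ` carrier (B (r - int p))}"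

text \<open>This is the union over all \<open>p\<close> of the images of the kernels of the \<open>p\<close>-fold iterates of \<open>g\<close>,
  since an element has trivial germ exactly if some iterate kills it.\<close>

definition boundaries :: "int \<Rightarrow> 'e set" where
  "boundaries r = J r ` {d \<in> carrier (A r). germ r d = \<zero>\<^bsub>colim_mod A g\<^esub>}"

lemma colim_filt_submod: "submodule (colim_filt r) R (colim_mod A g)"
  unfolding colim_filt_def
  by (rule hom_image_submod[OF modules(1) colim_left_module[OF A] colim_in_hom[OF A]])

lemma colim_filt_pred: "colim_filt (r - 1) \<subseteq> colim_filt r"
proof
  fix z assume "z \<in> colim_filt (r - 1)"
  then obtain d where d: "d \<in> carrier (A (r - 1))" "z = germ (r - 1) d" by (auto simp: colim_filt_def)
  then have "z = germ r (g (r - 1) d)" using colim_in_shift[OF A d(1)] by simp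
  then show "z \<in> colim_filt r"
    using mod_hom_closed[OF maps(1) d(1)] by (simp add: colim_filt_def)
qed

lemma lim_filt_submod: "submodule (lim_filt r) R (lim_mod B h)"
  using kernel_submod[OF lim_left_module[OF B] modules(2) lim_proj_hom[of R B h r]]
  by (simp add: lim_filt_def a_kernel_def')

lemma lim_filt_Suc: "lim_filt r \<subseteq> lim_filt (r + 1)"
  using mod_hom_zero[OF modules(2) modules(2) maps(2)]
  by (auto simp: lim_filt_def lim_carrier) metis

lemma lim_filt_mono: "r \<le> s \<Longrightarrow> lim_filt r \<subseteq> lim_filt s"
  by (induction s rule: int_ge_induct) (use lim_filt_Suc in blast)+

lemma cycles_submod: "submodule (cycles r) R (E r)"
proof -
  have B': "submodule (trans_map h (r - int p) p ` carrier (B (r - int p))) R (B r)" for p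
    using hom_image_submod[OF modules(2) modules(2) trans_map_hom[OF B], of "r - int p" p] by simp
  show ?thesis
  proof (rule submodI[OF E])
    show "cycles r \<subseteq> carrier (E r)" by (auto simp: cycles_def)
    show "\<zero>\<^bsub>E r\<^esub> \<in> cycles r"
      unfolding cycles_def
      using left_module_a(2)[OF E] mod_hom_zero[OF E modules(2) K] submoduleD(2)[OF modules(2) B']
      by simp
    show "x \<ominus>\<^bsub>E r\<^esub> y \<in> cycles r" if "x \<in> cycles r" "y \<in> cycles r" for x y
      using that left_module_a(4)[OF E] submoduleD(4)[OF modules(2) B']
      by (simp add: cycles_def mod_hom_minus[OF E modules(2) K])
    show "a \<odot>\<^bsub>E r\<^esub> x \<in> cycles r" if "a \<in> carrier R" "x \<in> cycles r" for a x
      using that left_module_a(5)[OF E] submoduleD(5)[OF modules(2) B']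
      by (simp add: cycles_def mod_hom_smult[OF K])
  qed
qed

lemma boundaries_submod: "submodule (boundaries r) R (E r)"
  using hom_image_of_submod[OF modules(1) E J kernel_submod[OF modules(1) colim_left_module[OF A]
        colim_in_hom[OF A]]]
  by (simp add: boundaries_def a_kernel_def')

lemma K_J: "d \<in> carrier (A r) \<Longrightarrow> K r (J r d) = \<zero>\<^bsub>B r\<^esub>"
  using exact_E[of r] by (auto simp: a_kernel_def')

lemma K_boundaries: "e \<in> boundaries r \<Longrightarrow> K r e = \<zero>\<^bsub>B r\<^esub>"
  by (auto simp: boundaries_def K_J)

lemma K_zero_cycle: "e \<in> carrier (E r) \<Longrightarrow> K r e = \<zero>\<^bsub>B r\<^esub> \<Longrightarrow> e \<in> cycles r"
  unfolding cycles_def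
  using submoduleD(2)[OF modules(2) hom_image_submod[OF modules(2) modules(2) trans_map_hom[OF B]]]
  by (smt (verit, del_insts) diff_add_cancel mem_Collect_eq)

lemma J_cycle: "d \<in> carrier (A r) \<Longrightarrow> J r d \<in> cycles r"
  using K_zero_cycle K_J mod_hom_closed[OF J] by blast

lemma boundaries_cycles: "boundaries r \<subseteq> cycles r"
  using J_cycle by (auto simp: boundaries_def)

text \<open>Both sides say that \<open>d\<close> is the sum of an element that dies in the colimit and an element of
  the image of \<open>g\<close>, which is the kernel of \<open>J\<close>. In other words, \<open>J\<close> embeds the graded piece
  \<open>colim_filt r / colim_filt (r - 1)\<close> into the limit page \<open>cycles r / boundaries r\<close>.\<close>

lemma J_boundary_iff:
  assumes d: "d \<in> carrier (A r)"
  shows "J r d \<in> boundaries r \<longleftrightarrow> germ r d \<in> colim_filt (r - 1)"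
proof
  assume "J r d \<in> boundaries r"
  then obtain d' where d': "d' \<in> carrier (A r)" "germ r d' = \<zero>\<^bsub>colim_mod A g\<^esub>" "J r d = J r d'"
    by (auto simp: boundaries_def)
  have "J r (d \<ominus>\<^bsub>A r\<^esub> d') = \<zero>\<^bsub>E r\<^esub>"
    using mod_hom_minus[OF modules(1) E J d d'(1)] left_module_minus(3)[OF E] d'(3)
      mod_hom_closed[OF J] d'(1) by simp
  then have "d \<ominus>\<^bsub>A r\<^esub> d' \<in> g (r - 1) ` carrier (A (r - 1))"
    unfolding exact_A using left_module_a(4)[OF modules(1) d d'(1)] by (simp add: a_kernel_def')
  then obtain u where u: "u \<in> carrier (A (r - 1))" "d \<ominus>\<^bsub>A r\<^esub> d' = g (r - 1) u" by blast
  have "germ r d = germ r d \<ominus>\<^bsub>colim_mod A g\<^esub> germ r d'"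
    using d'(2) left_module_minus(6)[OF colim_left_module[OF A]]
      mod_hom_closed[OF colim_in_hom[OF A] d] by simp
  also have "\<dots> = germ r (g (r - 1) u)"
    using mod_hom_minus[OF modules(1) colim_left_module[OF A] colim_in_hom[OF A] d d'(1)] u(2) by simp
  also have "\<dots> = germ (r - 1) u" using colim_in_shift[OF A u(1)] by simp
  finally show "germ r d \<in> colim_filt (r - 1)" using u(1) by (simp add: colim_filt_def)
next
  assume "germ r d \<in> colim_filt (r - 1)"
  then obtain u where u: "u \<in> carrier (A (r - 1))" "germ r d = germ r (g (r - 1) u)"
    using colim_in_shift[OF A, of _ "r - 1"] by (auto simp: colim_filt_def)
  let ?v = "g (r - 1) u"
  have v: "?v \<in> carrier (A r)" by (rule mod_hom_closed[OF maps(1) u(1)])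
  have "J r ?v = \<zero>\<^bsub>E r\<^esub>" using exact_A[of r] u(1) by (auto simp: a_kernel_def')
  then have "J r d = J r (d \<ominus>\<^bsub>A r\<^esub> ?v)"
    using mod_hom_minus[OF modules(1) E J d v] left_module_minus(6)[OF E] mod_hom_closed[OF J d] by simp
  moreover have "germ r (d \<ominus>\<^bsub>A r\<^esub> ?v) = \<zero>\<^bsub>colim_mod A g\<^esub>"
    using mod_hom_minus[OF modules(1) colim_left_module[OF A] colim_in_hom[OF A] d v] u(2)
      left_module_minus(3)[OF colim_left_module[OF A]] mod_hom_closed[OF colim_in_hom[OF A] v] by simp
  ultimately show "J r d \<in> boundaries r"
    using left_module_a(4)[OF modules(1) d v] by (auto simp: boundaries_def)
qed

text \<open>A member of the limit supplies preimages under all iterates of \<open>h\<close>, so a lift of its entry to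
  \<open>E\<close> is a permanent cycle. Under stability, this and \<open>stable_lift\<close> below identify the graded piece
  \<open>lim_filt (r + 1) / lim_filt r\<close> with the image of the cycles under \<open>K\<close>.\<close>

lemma lim_filt_cycle:
  assumes "\<phi> \<in> lim_filt (r + 1)"
  shows "\<exists>e\<in>cycles r. K r e = \<phi> r"
proof -
  have c: "\<phi> \<in> carrier (lim_mod B h)" and z: "\<phi> (r + 1) = \<zero>\<^bsub>B (r + 1)\<^esub>"
    using assms by (auto simp: lim_filt_def)
  have "\<phi> r \<in> a_kernel (B r) (B (r + 1)) (h r)"
    using c z by (simp add: lim_carrier a_kernel_def')
  then obtain e where e: "e \<in> carrier (E r)" "\<phi> r = K r e" unfolding exact_B[symmetric] by blast
  have "K r e \<in> trans_map h (r - int p) p ` carrier (B (r - int p))" for p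
    using lim_trans_map[OF c, of "r - int p" p] c e(2)
    by (intro image_eqI[of _ _ "\<phi> (r - int p)"]) (simp_all add: lim_carrier)
  then show ?thesis using e by (auto simp: cycles_def)
qed

text \<open>For a strand of an exact couple this follows from stability of the limit page: see
  \<open>stable_strand\<close>.\<close>

definition stable :: "int \<Rightarrow> bool" where
  "stable r \<longleftrightarrow> (\<forall>e\<in>cycles r. \<exists>\<phi>\<in>carrier (lim_mod B h). \<phi> r = K r e)"

lemma stable_lift:
  assumes "stable r" and e: "e \<in> cycles r"
  shows "\<exists>\<phi>\<in>lim_filt (r + 1). \<phi> r = K r e"
proof -
  obtain \<phi> where p: "\<phi> \<in> carrier (lim_mod B h)" "\<phi> r = K r e"
    using assms unfolding stable_def by blast
  have "K r e \<in> a_kernel (B r) (B (r + 1)) (h r)"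
    unfolding exact_B[symmetric] using e by (auto simp: cycles_def)
  then have "\<phi> (r + 1) = \<zero>\<^bsub>B (r + 1)\<^esub>" using p by (simp add: lim_carrier a_kernel_def') metis
  then show ?thesis using p by (auto simp: lim_filt_def)
qed

end

locale strand_hom =
  S1: exact_strand R A1 g1 E1 J1 K1 B1 h1 + S2: exact_strand R A2 g2 E2 J2 K2 B2 h2
  for R :: "('r, 't) ring_scheme"
    and A1 :: "int \<Rightarrow> ('r, 'a1) module" and g1 and E1 :: "int \<Rightarrow> ('r, 'e1) module" and J1 and K1
    and B1 :: "int \<Rightarrow> ('r, 'b1) module" and h1
    and A2 :: "int \<Rightarrow> ('r, 'a2) module" and g2 and E2 :: "int \<Rightarrow> ('r, 'e2) module" and J2 and K2
    and B2 :: "int \<Rightarrow> ('r, 'b2) module" and h2 +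
  fixes fA :: "int \<Rightarrow> 'a1 \<Rightarrow> 'a2" and fE :: "int \<Rightarrow> 'e1 \<Rightarrow> 'e2" and fB :: "int \<Rightarrow> 'b1 \<Rightarrow> 'b2"
  assumes fA: "diagram_hom R A1 g1 A2 g2 fA" and fB: "diagram_hom R B1 h1 B2 h2 fB"
    and fE: "mod_hom R (E1 r) (E2 r) (fE r)"
    and fJ: "d \<in> carrier (A1 r) \<Longrightarrow> fE r (J1 r d) = J2 r (fA r d)"
    and fK: "e \<in> carrier (E1 r) \<Longrightarrow> fB r (K1 r e) = K2 r (fE r e)"
begin

lemma fA_hom: "mod_hom R (A1 r) (A2 r) (fA r)" and fB_hom: "mod_hom R (B1 r) (B2 r) (fB r)"
  using fA fB by (simp_all add: diagram_hom_def)

abbreviation fL :: "(int \<times> 'a1) set \<Rightarrow> (int \<times> 'a2) set" where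
  "fL \<equiv> colim_map A2 g2 fA"

abbreviation fM :: "(int \<Rightarrow> 'b1) \<Rightarrow> int \<Rightarrow> 'b2" where
  "fM \<equiv> lim_map fB"

lemmas fL_germ = colim_map_in[OF S1.A S2.A fA]
lemmas fL_hom = colim_map_hom[OF S1.A S2.A fA]
lemmas fM_hom = lim_map_hom[OF fB]

lemma fL_filt: "z \<in> S1.colim_filt r \<Longrightarrow> fL z \<in> S2.colim_filt r"
  using fL_germ mod_hom_closed[OF fA_hom] by (auto simp: S1.colim_filt_def S2.colim_filt_def)

lemma fM_filt: "\<phi> \<in> S1.lim_filt r \<Longrightarrow> fM \<phi> \<in> S2.lim_filt r"
  using mod_hom_closed[OF fM_hom] mod_hom_zero[OF S1.modules(2) S2.modules(2) fB_hom]
  by (auto simp: S1.lim_filt_def S2.lim_filt_def lim_map_def)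

lemma fE_cycles: "e \<in> S1.cycles r \<Longrightarrow> fE r e \<in> S2.cycles r"
proof -
  assume e: "e \<in> S1.cycles r"
  then have ec: "e \<in> carrier (E1 r)" by (simp add: S1.cycles_def)
  have "K2 r (fE r e) \<in> trans_map h2 (r - int p) p ` carrier (B2 (r - int p))" for p
  proof -
    obtain x where x: "x \<in> carrier (B1 (r - int p))" "K1 r e = trans_map h1 (r - int p) p x"
      using e by (auto simp: S1.cycles_def)
    have "K2 r (fE r e) = trans_map h2 (r - int p) p (fB (r - int p) x)"
      using trans_map_natural[OF S1.B fB x(1)] x(2) by (simp add: fK[OF ec, symmetric])
    then show ?thesis using mod_hom_closed[OF fB_hom x(1)] by blast
  qed
  then show ?thesis using mod_hom_closed[OF fE ec] by (simp add: S2.cycles_def)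
qed

lemma fE_boundaries:
  assumes "e \<in> S1.boundaries r"
  shows "fE r e \<in> S2.boundaries r"
proof -
  obtain d where d: "d \<in> carrier (A1 r)" "S1.germ r d = \<zero>\<^bsub>colim_mod A1 g1\<^esub>" "e = J1 r d"
    using assms by (auto simp: S1.boundaries_def)
  then have "S2.germ r (fA r d) = \<zero>\<^bsub>colim_mod A2 g2\<^esub>"
    using fL_germ[OF d(1)]
      mod_hom_zero[OF colim_left_module[OF S1.A] colim_left_module[OF S2.A] fL_hom] by simp
  then show ?thesis
    using fJ[OF d(1)] d(3) mod_hom_closed[OF fA_hom d(1)] by (auto simp: S2.boundaries_def)
qed

text \<open>Injectivity and surjectivity of the maps induced on the limit page and on the graded pieces,
  expressed on representatives.\<close>

definition page_mono :: "int \<Rightarrow> bool" where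
  "page_mono r \<longleftrightarrow> (\<forall>e\<in>S1.cycles r. fE r e \<in> S2.boundaries r \<longrightarrow> e \<in> S1.boundaries r)"

definition page_epi :: "int \<Rightarrow> bool" where
  "page_epi r \<longleftrightarrow> (\<forall>e\<in>S2.cycles r. \<exists>e'\<in>S1.cycles r. e \<ominus>\<^bsub>E2 r\<^esub> fE r e' \<in> S2.boundaries r)"

definition colim_gr_mono :: "int \<Rightarrow> bool" where
  "colim_gr_mono r \<longleftrightarrow>
     (\<forall>z\<in>S1.colim_filt r. fL z \<in> S2.colim_filt (r - 1) \<longrightarrow> z \<in> S1.colim_filt (r - 1))"

definition colim_gr_epi :: "int \<Rightarrow> bool" where
  "colim_gr_epi r \<longleftrightarrow> (\<forall>w\<in>S2.colim_filt r. \<exists>z\<in>S1.colim_filt r.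
     w \<ominus>\<^bsub>colim_mod A2 g2\<^esub> fL z \<in> S2.colim_filt (r - 1))"

definition lim_gr_mono :: "int \<Rightarrow> bool" where
  "lim_gr_mono r \<longleftrightarrow> (\<forall>\<phi>\<in>S1.lim_filt (r + 1). fM \<phi> \<in> S2.lim_filt r \<longrightarrow> \<phi> \<in> S1.lim_filt r)"

definition lim_gr_epi :: "int \<Rightarrow> bool" where
  "lim_gr_epi r \<longleftrightarrow> (\<forall>\<psi>\<in>S2.lim_filt (r + 1). \<exists>\<phi>\<in>S1.lim_filt (r + 1).
     \<psi> \<ominus>\<^bsub>lim_mod B2 h2\<^esub> fM \<phi> \<in> S2.lim_filt r)"

lemma J_minus_boundary_iff:
  assumes d: "d \<in> carrier (A2 r)" and d1: "d1 \<in> carrier (A1 r)"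
  shows "J2 r d \<ominus>\<^bsub>E2 r\<^esub> fE r (J1 r d1) \<in> S2.boundaries r \<longleftrightarrow>
    S2.germ r d \<ominus>\<^bsub>colim_mod A2 g2\<^esub> fL (S1.germ r d1) \<in> S2.colim_filt (r - 1)"
proof -
  have f: "fA r d1 \<in> carrier (A2 r)" by (rule mod_hom_closed[OF fA_hom d1])
  show ?thesis
    using S2.J_boundary_iff[OF left_module_a(4)[OF S2.modules(1) d f]]
      mod_hom_minus[OF S2.modules(1) S2.E S2.J d f]
      mod_hom_minus[OF S2.modules(1) colim_left_module[OF S2.A] colim_in_hom[OF S2.A] d f]
      fJ[OF d1] fL_germ[OF d1] by simp
qed

text \<open>The following lemmas are the diagram chases for the map of short exact sequences
  \<open>0 \<rightarrow> \<epsilon>\<^sub>x \<rightarrow> E\<^sup>\<infinity> \<rightarrow> \<epsilon>\<^sup>y \<rightarrow> 0\<close>: a monomorphism in the middle restricts to one on the left,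
  an epimorphism in the middle induces one on the right.\<close>

lemma page_mono_colim_gr_mono:
  assumes "page_mono r"
  shows "colim_gr_mono r"
  unfolding colim_gr_mono_def
proof (intro ballI impI)
  fix z assume "z \<in> S1.colim_filt r" and fz: "fL z \<in> S2.colim_filt (r - 1)"
  then obtain d where d: "d \<in> carrier (A1 r)" "z = S1.germ r d" by (auto simp: S1.colim_filt_def)
  have "fE r (J1 r d) \<in> S2.boundaries r"
    using fz S2.J_boundary_iff[OF mod_hom_closed[OF fA_hom d(1)]] fL_germ[OF d(1)] fJ[OF d(1)] d(2)
    by simp
  then have "J1 r d \<in> S1.boundaries r"
    using assms S1.J_cycle[OF d(1)] by (simp add: page_mono_def)
  then show "z \<in> S1.colim_filt (r - 1)" using S1.J_boundary_iff[OF d(1)] d(2) by simp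
qed

lemma K_page_eq:
  assumes e: "e \<in> carrier (E2 r)" and e': "e' \<in> carrier (E1 r)"
    and "e \<ominus>\<^bsub>E2 r\<^esub> fE r e' \<in> S2.boundaries r"
  shows "fB r (K1 r e') = K2 r e"
proof -
  have f: "fE r e' \<in> carrier (E2 r)" by (rule mod_hom_closed[OF fE e'])
  have "K2 r e \<ominus>\<^bsub>B2 r\<^esub> K2 r (fE r e') = \<zero>\<^bsub>B2 r\<^esub>"
    using S2.K_boundaries[OF assms(3)] mod_hom_minus[OF S2.E S2.modules(2) S2.K e f] by simp
  then show ?thesis
    using left_module_minus(3)[OF S2.modules(2)] mod_hom_closed[OF S2.K] e f fK[OF e'] by simp
qed

lemma page_epi_lim_gr_epi:
  assumes "page_epi r" and "S1.stable r"
  shows "lim_gr_epi r"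
  unfolding lim_gr_epi_def
proof
  fix \<psi> assume psi: "\<psi> \<in> S2.lim_filt (r + 1)"
  obtain e where e: "e \<in> S2.cycles r" "K2 r e = \<psi> r" using S2.lim_filt_cycle[OF psi] by blast
  then obtain e' where e': "e' \<in> S1.cycles r" "e \<ominus>\<^bsub>E2 r\<^esub> fE r e' \<in> S2.boundaries r"
    using assms(1) by (auto simp: page_epi_def)
  obtain \<phi> where phi: "\<phi> \<in> S1.lim_filt (r + 1)" "\<phi> r = K1 r e'"
    using S1.stable_lift[OF assms(2) e'(1)] by blast
  have eq: "fM \<phi> r = \<psi> r"
    using K_page_eq[OF _ _ e'(2)] e e'(1) phi(2)
    by (simp add: lim_map_def S1.cycles_def S2.cycles_def)
  have c: "\<psi> \<in> carrier (lim_mod B2 h2)" "fM \<phi> \<in> carrier (lim_mod B2 h2)"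
    using psi fM_filt[OF phi(1)] by (simp_all add: S2.lim_filt_def)
  have "(\<psi> \<ominus>\<^bsub>lim_mod B2 h2\<^esub> fM \<phi>) r = \<psi> r \<ominus>\<^bsub>B2 r\<^esub> fM \<phi> r"
    by (rule mod_hom_minus[OF lim_left_module[OF S2.B] S2.modules(2) lim_proj_hom c])
  then have "\<psi> \<ominus>\<^bsub>lim_mod B2 h2\<^esub> fM \<phi> \<in> S2.lim_filt r"
    using eq left_module_minus(3)[OF S2.modules(2)] c left_module_a(4)[OF lim_left_module[OF S2.B] c]
    by (simp add: S2.lim_filt_def lim_carrier)
  then show "\<exists>\<phi>\<in>S1.lim_filt (r + 1). \<psi> \<ominus>\<^bsub>lim_mod B2 h2\<^esub> fM \<phi> \<in> S2.lim_filt r"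
    using phi(1) by blast
qed

text \<open>If the middle map is an isomorphism, the snake lemma identifies the cokernel on the left with the
  kernel on the right. This and the next lemma are the two halves of that statement.\<close>

lemma colim_gr_epi_lim_gr_mono:
  assumes "page_mono r" and "colim_gr_epi r"
  shows "lim_gr_mono r"
  unfolding lim_gr_mono_def
proof (intro ballI impI)
  fix \<phi> assume phi: "\<phi> \<in> S1.lim_filt (r + 1)" and "fM \<phi> \<in> S2.lim_filt r"
  then have f0: "fB r (\<phi> r) = \<zero>\<^bsub>B2 r\<^esub>" by (simp add: S2.lim_filt_def lim_map_def)
  obtain e where e: "e \<in> S1.cycles r" "K1 r e = \<phi> r" using S1.lim_filt_cycle[OF phi] by blast
  have ec: "e \<in> carrier (E1 r)" using e(1) by (simp add: S1.cycles_def)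
  have "fE r e \<in> a_kernel (E2 r) (B2 r) (K2 r)"
    using fK[OF ec] f0 e(2) mod_hom_closed[OF fE ec] by (simp add: a_kernel_def')
  then obtain d where d: "d \<in> carrier (A2 r)" "fE r e = J2 r d" unfolding S2.exact_E[symmetric] by blast
  have "S2.germ r d \<in> S2.colim_filt r" using d(1) by (simp add: S2.colim_filt_def)
  then obtain z where "z \<in> S1.colim_filt r"
    "S2.germ r d \<ominus>\<^bsub>colim_mod A2 g2\<^esub> fL z \<in> S2.colim_filt (r - 1)"
    using assms(2) unfolding colim_gr_epi_def by blast
  then obtain d1 where d1: "d1 \<in> carrier (A1 r)"
    and "S2.germ r d \<ominus>\<^bsub>colim_mod A2 g2\<^esub> fL (S1.germ r d1) \<in> S2.colim_filt (r - 1)"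
    by (auto simp: S1.colim_filt_def)
  then have b: "fE r e \<ominus>\<^bsub>E2 r\<^esub> fE r (J1 r d1) \<in> S2.boundaries r"
    using J_minus_boundary_iff[OF d(1) d1] d(2) by simp
  have j: "J1 r d1 \<in> carrier (E1 r)" by (rule mod_hom_closed[OF S1.J d1])
  have "e \<ominus>\<^bsub>E1 r\<^esub> J1 r d1 \<in> S1.boundaries r"
    using assms(1) b mod_hom_minus[OF S1.E S2.E fE ec j]
      submoduleD(4)[OF S1.E S1.cycles_submod e(1) S1.J_cycle[OF d1]] by (simp add: page_mono_def)
  then have "K1 r e \<ominus>\<^bsub>B1 r\<^esub> K1 r (J1 r d1) = \<zero>\<^bsub>B1 r\<^esub>"
    using S1.K_boundaries mod_hom_minus[OF S1.E S1.modules(2) S1.K ec j] by simp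
  then have "\<phi> r = \<zero>\<^bsub>B1 r\<^esub>"
    using e(2) S1.K_J[OF d1] left_module_minus(6)[OF S1.modules(2)] mod_hom_closed[OF S1.K ec] by simp
  then show "\<phi> \<in> S1.lim_filt r" using phi by (simp add: S1.lim_filt_def)
qed

lemma lim_gr_mono_colim_gr_epi:
  assumes "page_epi r" and "S1.stable r" and "lim_gr_mono r"
  shows "colim_gr_epi r"
  unfolding colim_gr_epi_def
proof
  fix w assume "w \<in> S2.colim_filt r"
  then obtain d where d: "d \<in> carrier (A2 r)" "w = S2.germ r d" by (auto simp: S2.colim_filt_def)
  obtain e where e: "e \<in> S1.cycles r" and b: "J2 r d \<ominus>\<^bsub>E2 r\<^esub> fE r e \<in> S2.boundaries r"
    using assms(1) S2.J_cycle[OF d(1)] by (auto simp: page_epi_def)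
  have ec: "e \<in> carrier (E1 r)" using e by (simp add: S1.cycles_def)
  obtain \<phi> where phi: "\<phi> \<in> S1.lim_filt (r + 1)" "\<phi> r = K1 r e"
    using S1.stable_lift[OF assms(2) e] by blast
  have "fM \<phi> r = \<zero>\<^bsub>B2 r\<^esub>"
    using K_page_eq[OF mod_hom_closed[OF S2.J d(1)] ec b] S2.K_J[OF d(1)] phi(2)
    by (simp add: lim_map_def)
  then have "fM \<phi> \<in> S2.lim_filt r" using fM_filt[OF phi(1)] by (simp add: S2.lim_filt_def)
  then have "\<phi> \<in> S1.lim_filt r" using assms(3) phi(1) by (simp add: lim_gr_mono_def)
  then have "e \<in> a_kernel (E1 r) (B1 r) (K1 r)" using phi(2) ec by (simp add: a_kernel_def' S1.lim_filt_def)
  then obtain d1 where d1: "d1 \<in> carrier (A1 r)" "e = J1 r d1" unfolding S1.exact_E[symmetric] by blast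
  then have "w \<ominus>\<^bsub>colim_mod A2 g2\<^esub> fL (S1.germ r d1) \<in> S2.colim_filt (r - 1)"
    using J_minus_boundary_iff[OF d(1) d1(1)] b d(2) by simp
  then show "\<exists>z\<in>S1.colim_filt r. w \<ominus>\<^bsub>colim_mod A2 g2\<^esub> fL z \<in> S2.colim_filt (r - 1)"
    using d1(1) by (auto simp: S1.colim_filt_def)
qed

end


section \<open>Comparison of filtered modules\<close>

text \<open>Injectivity: an element of the kernel slides down the filtration, so it lies in the intersection.

  Surjectivity: subtracting lifts of leading terms from \<open>v\<close> again and again produces remainders
  \<open>w s \<in> F' s\<close> and corrections \<open>z s \<in> F s\<close> with \<open>f (z s) = w s - w (s - 1)\<close>. The infinite sum of the
  corrections need not exist in \<open>M\<close>; its obstruction is the class of \<open>z\<close> in \<open>lim\<^sup>1\<close>, which maps to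
  zero. So \<open>z s = u s - u (s - 1)\<close> by assumption, and then \<open>w s - f (u s)\<close> is independent of \<open>s\<close> and lies in the
  intersection of the filtration.\<close>

lemma filtered_bij:
  fixes M :: "('r, 'm) module" and M' :: "('r, 'n) module"
    and F :: "int \<Rightarrow> 'm set" and F' :: "int \<Rightarrow> 'n set"
  assumes M: "left_module R M" and M': "left_module R M'" and f: "mod_hom R M M' f"
    and F: "\<And>r. submodule (F r) R M" and F': "\<And>r. submodule (F' r) R M'"
    and F_pred: "\<And>r. F (r - 1) \<subseteq> F r" and F'_pred: "\<And>r. F' (r - 1) \<subseteq> F' r"
    and fF: "\<And>r z. z \<in> F r \<Longrightarrow> f z \<in> F' r"
    and exh: "carrier M = (\<Union>r. F r)" and exh': "carrier M' = (\<Union>r. F' r)"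
    and gr_mono: "\<And>r z. z \<in> F r \<Longrightarrow> f z \<in> F' (r - 1) \<Longrightarrow> z \<in> F (r - 1)"
    and gr_epi: "\<And>r w. w \<in> F' r \<Longrightarrow> \<exists>z\<in>F r. w \<ominus>\<^bsub>M'\<^esub> f z \<in> F' (r - 1)"
    and Int_mono: "\<And>z. z \<in> (\<Inter>r. F r) \<Longrightarrow> f z = \<zero>\<^bsub>M'\<^esub> \<Longrightarrow> z = \<zero>\<^bsub>M\<^esub>"
    and Int_epi: "\<And>w. w \<in> (\<Inter>r. F' r) \<Longrightarrow> \<exists>z\<in>carrier M. f z = w"
    and lim1_mono: "\<And>z w. (\<And>r. z r \<in> F r) \<Longrightarrow> (\<And>r. w r \<in> F' r) \<Longrightarrow>
      (\<And>r. f (z r) = w r \<ominus>\<^bsub>M'\<^esub> w (r - 1)) \<Longrightarrow>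
      \<exists>u. (\<forall>r. u r \<in> F r) \<and> (\<forall>r. z r = u r \<ominus>\<^bsub>M\<^esub> u (r - 1))"
  shows "bij_betw f (carrier M) (carrier M')"
proof -
  have F_mono: "F r \<subseteq> F s" if "r \<le> s" for r s
    using that by (induction s rule: int_ge_induct) (use F_pred[of "_ + 1"] in auto)
  have F'_mono: "F' r \<subseteq> F' s" if "r \<le> s" for r s
    using that by (induction s rule: int_ge_induct) (use F'_pred[of "_ + 1"] in auto)
  have c: "z \<in> F r \<Longrightarrow> z \<in> carrier M" for z r by (rule submoduleD(1)[OF M F])
  have c': "w \<in> F' r \<Longrightarrow> w \<in> carrier M'" for w r by (rule submoduleD(1)[OF M' F'])
  have "z = \<zero>\<^bsub>M\<^esub>" if z: "z \<in> carrier M" and fz: "f z = \<zero>\<^bsub>M'\<^esub>" for z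
  proof (rule Int_mono[OF _ fz])
    obtain r where r: "z \<in> F r" using z exh by blast
    have "z \<in> F s" if "s \<le> r" for s
      using that
    proof (induction s rule: int_le_induct)
      case (step s)
      then show ?case using gr_mono[of z s] fz submoduleD(2)[OF M' F'] by simp
    qed (rule r)
    then show "z \<in> (\<Inter>r. F r)" using F_mono[of r] r by (metis INT_I linear subsetD)
  qed
  then have inj: "inj_on f (carrier M)" by (rule hom_inj_onI[OF M M' f])
  have "\<exists>z\<in>carrier M. f z = v" if v: "v \<in> carrier M'" for v
  proof -
    obtain r where r: "v \<in> F' r" using v exh' by blast
    have "\<forall>s w. \<exists>z. w \<in> F' s \<longrightarrow> z \<in> F s \<and> w \<ominus>\<^bsub>M'\<^esub> f z \<in> F' (s - 1)"
      using gr_epi by blast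
    then obtain lift where lift: "\<And>s w. w \<in> F' s \<Longrightarrow> lift s w \<in> F s"
      "\<And>s w. w \<in> F' s \<Longrightarrow> w \<ominus>\<^bsub>M'\<^esub> f (lift s w) \<in> F' (s - 1)"
      by metis
    \<comment> \<open>\<open>W k\<close> is the error left after \<open>k\<close> corrections; it lies in \<open>F' (r - k)\<close>.\<close>
    define W where "W = rec_nat v (\<lambda>k w. w \<ominus>\<^bsub>M'\<^esub> f (lift (r - int k) w))"
    have W0: "W 0 = v" and WS: "W (Suc k) = W k \<ominus>\<^bsub>M'\<^esub> f (lift (r - int k) (W k))" for k
      by (simp_all add: W_def)
    have WF: "W k \<in> F' (r - int k)" for k
    proof (induction k)
      case (Suc k)
      have "r - int k - 1 = r - int (Suc k)" by simp
      then show ?case using lift(2)[OF Suc] by (simp only: WS)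
    qed (simp add: W0 r)
    \<comment> \<open>Above the index \<open>r\<close> nothing is corrected: there \<open>w s = v\<close>, by the truncation in \<open>nat\<close>.\<close>
    define w where "w s = W (nat (r - s))" for s
    define z where "z s = (if s \<le> r then lift s (w s) else \<zero>\<^bsub>M\<^esub>)" for s
    have wF: "w s \<in> F' s" for s
    proof (cases "s \<le> r")
      case True
      then show ?thesis using WF[of "nat (r - s)"] by (simp add: w_def)
    next
      case False
      then show ?thesis using r F'_mono[of r s] by (auto simp: w_def W0)
    qed
    have zF: "z s \<in> F s" for s
      using lift(1)[OF wF] submoduleD(2)[OF M F] by (simp add: z_def)
    have "f (z s) = w s \<ominus>\<^bsub>M'\<^esub> w (s - 1)" for s
    proof (cases "s \<le> r")
      case True
      then have "w (s - 1) = w s \<ominus>\<^bsub>M'\<^esub> f (z s)"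
        using WS[of "nat (r - s)"] by (simp add: w_def z_def nat_diff_distrib Suc_nat_eq_nat_zadd1 algebra_simps)
      then show ?thesis
        using left_module_minus(4)[OF M'] c'[OF wF] mod_hom_closed[OF f c[OF zF]] by simp
    next
      case False
      then show ?thesis
        using mod_hom_zero[OF M M' f] left_module_minus(3)[OF M' v v] by (simp add: z_def w_def W0)
    qed
    from lim1_mono[of z w, OF zF wF this]
    obtain u where u: "\<And>s. u s \<in> F s" "\<And>s. z s = u s \<ominus>\<^bsub>M\<^esub> u (s - 1)" by blast
    have fu: "f (u s) \<in> F' s" for s by (rule fF[OF u(1)])
    have step: "w s \<ominus>\<^bsub>M'\<^esub> f (u s) = w (s - 1) \<ominus>\<^bsub>M'\<^esub> f (u (s - 1))" for s
    proof (rule left_module_minus_exchange[OF M' c'[OF wF] c'[OF wF] c'[OF fu] c'[OF fu]])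
      show "w s \<ominus>\<^bsub>M'\<^esub> w (s - 1) = f (u s) \<ominus>\<^bsub>M'\<^esub> f (u (s - 1))"
        using \<open>f (z s) = w s \<ominus>\<^bsub>M'\<^esub> w (s - 1)\<close> u(2)[of s] mod_hom_minus[OF M M' f c[OF u(1)] c[OF u(1)]]
        by metis
    qed
    have const: "w s \<ominus>\<^bsub>M'\<^esub> f (u s) = w r \<ominus>\<^bsub>M'\<^esub> f (u r)" for s
      by (induction s rule: int_induct[where k = r]) (use step step[of "_ + 1"] in auto)
    have "w r \<ominus>\<^bsub>M'\<^esub> f (u r) \<in> F' s" for s
      using submoduleD(4)[OF M' F' wF fu, of s] const[of s] by simp
    then obtain y where y: "y \<in> carrier M" "f y = w r \<ominus>\<^bsub>M'\<^esub> f (u r)" using Int_epi by blast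
    have "f (y \<oplus>\<^bsub>M\<^esub> u r) = v"
      using mod_hom_add[OF f y(1) c[OF u(1)]] y(2) left_module_minus(5)[OF M' c'[OF wF[of r]] c'[OF fu[of r]]]
      by (simp add: w_def W0)
    then show ?thesis using left_module_a(1)[OF M y(1) c[OF u(1)]] by blast
  qed
  then have "f ` carrier M = carrier M'" using mod_hom_closed[OF f] by blast
  with inj show ?thesis by (simp add: bij_betw_def)
qed

text \<open>For a diagram of inclusions the limit consists of the constant families, that is, it is the
  intersection; a class in \<open>lim\<^sup>1\<close> vanishes exactly if the family consists of successive differences.\<close>

lemma filtered_bij_lim:
  fixes M :: "('r, 'm) module" and M' :: "('r, 'n) module"
    and F :: "int \<Rightarrow> 'm set" and F' :: "int \<Rightarrow> 'n set"
  assumes M: "left_module R M" and M': "left_module R M'" and f: "mod_hom R M M' f"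
    and F: "\<And>r. submodule (F r) R M" and F': "\<And>r. submodule (F' r) R M'"
    and F_pred: "\<And>r. F (r - 1) \<subseteq> F r" and F'_pred: "\<And>r. F' (r - 1) \<subseteq> F' r"
    and fF: "\<And>r z. z \<in> F r \<Longrightarrow> f z \<in> F' r"
    and exh: "carrier M = (\<Union>r. F r)" and exh': "carrier M' = (\<Union>r. F' r)"
    and gr_mono: "\<And>r z. z \<in> F r \<Longrightarrow> f z \<in> F' (r - 1) \<Longrightarrow> z \<in> F (r - 1)"
    and gr_epi: "\<And>r w. w \<in> F' r \<Longrightarrow> \<exists>z\<in>F r. w \<ominus>\<^bsub>M'\<^esub> f z \<in> F' (r - 1)"
    and lim_iso: "bij_betw (lim_map (\<lambda>r. f))
      (carrier (lim_mod (\<lambda>r. restrict_mod M (F r)) (\<lambda>r z. z)))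
      (carrier (lim_mod (\<lambda>r. restrict_mod M' (F' r)) (\<lambda>r z. z)))"
    and lim1_mono: "inj_on (lim1_map (\<lambda>r. restrict_mod M' (F' r)) (\<lambda>r z. z) (\<lambda>r. f))
      (carrier (lim1_mod (\<lambda>r. restrict_mod M (F r)) (\<lambda>r z. z)))"
  shows "bij_betw f (carrier M) (carrier M')"
proof (rule filtered_bij[OF M M' f F F' F_pred F'_pred fF exh exh' gr_mono gr_epi])
  let ?A = "\<lambda>r. restrict_mod M (F r)" and ?A' = "\<lambda>r. restrict_mod M' (F' r)"
  have const: "(\<lambda>r. z) \<in> carrier (lim_mod ?A (\<lambda>r z. z))" if "z \<in> (\<Inter>r. F r)" for z
    using that by (simp add: lim_carrier)
  show "z = \<zero>\<^bsub>M\<^esub>" if z: "z \<in> (\<Inter>r. F r)" and fz: "f z = \<zero>\<^bsub>M'\<^esub>" for z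
  proof -
    have 0: "\<zero>\<^bsub>M\<^esub> \<in> (\<Inter>r. F r)" using submoduleD(2)[OF M F] by blast
    have "lim_map (\<lambda>r. f) (\<lambda>r. z) = lim_map (\<lambda>r. f) (\<lambda>r. \<zero>\<^bsub>M\<^esub>)"
      using fz mod_hom_zero[OF M M' f] by (simp add: lim_map_def)
    then have "(\<lambda>r::int. z) = (\<lambda>r. \<zero>\<^bsub>M\<^esub>)"
      using inj_onD[OF bij_betw_imp_inj_on[OF lim_iso]] const[OF z] const[OF 0] by blast
    then show ?thesis by (rule fun_cong)
  qed
  show "\<exists>z\<in>carrier M. f z = w" if w: "w \<in> (\<Inter>r. F' r)" for w
  proof -
    have "(\<lambda>r. w) \<in> carrier (lim_mod ?A' (\<lambda>r z. z))" using w by (simp add: lim_carrier)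
    then obtain \<phi> where phi: "\<phi> \<in> carrier (lim_mod ?A (\<lambda>r z. z))"
      "(\<lambda>r. w) = lim_map (\<lambda>r. f) \<phi>"
      unfolding bij_betw_imp_surj_on[OF lim_iso, symmetric] by blast
    have "f (\<phi> 0) = w" using fun_cong[OF phi(2), of 0] by (simp add: lim_map_def)
    moreover have "\<phi> 0 \<in> carrier M" using phi(1) submoduleD(1)[OF M F] by (auto simp: lim_carrier)
    ultimately show ?thesis by blast
  qed
  have dA: "diagram R ?A (\<lambda>r z. z)"
    using submod_left_module[OF M F] F_pred[of "_ + 1"]
    by (auto simp: diagram_def mod_hom_def)
  have dA': "diagram R ?A' (\<lambda>r z. z)"
    using submod_left_module[OF M' F'] F'_pred[of "_ + 1"]
    by (auto simp: diagram_def mod_hom_def)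
  have df: "diagram_hom R ?A (\<lambda>r z. z) ?A' (\<lambda>r z. z) (\<lambda>r. f)"
    using f fF submoduleD(1)[OF M F] by (auto simp: diagram_hom_def mod_hom_def)
  have P: "left_module R (prod_mod ?A)" "left_module R (prod_mod ?A')"
    using submod_left_module[OF M F] submod_left_module[OF M' F'] by (auto intro: prod_mod_left_module)
  have bd: "submodule (lim_bound ?A (\<lambda>r z. z)) R (prod_mod ?A)"
    "submodule (lim_bound ?A' (\<lambda>r z. z)) R (prod_mod ?A')"
    unfolding lim_bound_def using P lim_diff_hom[OF dA] lim_diff_hom[OF dA']
    by (auto intro: hom_image_submod)
  have diff: "lim_diff ?A (\<lambda>r z. z) u r = u r \<ominus>\<^bsub>M\<^esub> u (r - 1)" if "\<And>r. u r \<in> F r" for u r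
    using that[of "r - 1"] F_pred[of r] restrict_mod_minus[OF M F that] by (auto simp: lim_diff_def)
  have diff': "lim_diff ?A' (\<lambda>r z. z) u r = u r \<ominus>\<^bsub>M'\<^esub> u (r - 1)" if "\<And>r. u r \<in> F' r" for u r
    using that[of "r - 1"] F'_pred[of r] restrict_mod_minus[OF M' F' that] by (auto simp: lim_diff_def)
  show "\<exists>u. (\<forall>r. u r \<in> F r) \<and> (\<forall>r. z r = u r \<ominus>\<^bsub>M\<^esub> u (r - 1))"
    if z: "\<And>r. z r \<in> F r" and w: "\<And>r. w r \<in> F' r"
      and e: "\<And>r. f (z r) = w r \<ominus>\<^bsub>M'\<^esub> w (r - 1)" for z w
  proof -
    have "z \<in> lim_bound ?A (\<lambda>r z. z)"
    proof (rule quot_map_injD[OF P(1) bd(1) P(2) bd(2) prod_hom[OF df]])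
      show "lim_map (\<lambda>r. f) x \<in> lim_bound ?A' (\<lambda>r z. z)" if "x \<in> lim_bound ?A (\<lambda>r z. z)" for x
        using that lim_diff_natural[OF dA dA' df] mod_hom_closed[OF prod_hom[OF df]]
        by (auto simp: lim_bound_def)
      show "inj_on (quot_map (prod_mod ?A') (lim_bound ?A' (\<lambda>r z. z)) (lim_map (\<lambda>r. f)))
          (carrier (quot_mod (prod_mod ?A) (lim_bound ?A (\<lambda>r z. z))))"
        using lim1_mono by (simp add: lim1_map_def lim1_mod_def)
      show "z \<in> carrier (prod_mod ?A)" using z by (simp add: prod_mod_def)
      have "lim_map (\<lambda>r. f) z = lim_diff ?A' (\<lambda>r z. z) w"
        using e by (simp add: fun_eq_iff lim_map_def diff'[OF w])
      moreover have "w \<in> carrier (prod_mod ?A')" using w by (simp add: prod_mod_def)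
      ultimately show "lim_map (\<lambda>r. f) z \<in> lim_bound ?A' (\<lambda>r z. z)" by (simp add: lim_bound_def)
    qed
    then obtain u where "u \<in> carrier (prod_mod ?A)" and zu: "z = lim_diff ?A (\<lambda>r z. z) u"
      by (auto simp: lim_bound_def)
    then have u: "\<And>r. u r \<in> F r" by (simp add: prod_mod_def)
    show ?thesis using u diff[OF u] unfolding zu by blast
  qed
qed

section \<open>Comparison of the limits\<close>

context strand_hom
begin

text \<open>An element of the kernel slides down the filtration, and the filtration of the limit is
  Hausdorff: a family that vanishes at all indices is zero.\<close>

lemma fM_kernel:
  assumes gr: "\<And>r. lim_gr_mono r" and phi: "\<phi> \<in> S1.lim_filt r" and f0: "fM \<phi> = \<zero>\<^bsub>lim_mod B2 h2\<^esub>"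
  shows "\<phi> = \<zero>\<^bsub>lim_mod B1 h1\<^esub>"
proof -
  have "\<phi> \<in> S1.lim_filt s" if "s \<le> r" for s
    using that
  proof (induction s rule: int_le_induct)
    case (step s)
    have "fM \<phi> \<in> S2.lim_filt (s - 1)"
      unfolding f0 by (rule submoduleD(2)[OF lim_left_module[OF S2.B] S2.lim_filt_submod])
    then show ?case using gr[of "s - 1"] step.IH by (simp add: lim_gr_mono_def)
  qed (rule phi)
  then have "\<phi> \<in> S1.lim_filt s" for s using S1.lim_filt_mono[of r s] phi by (cases "s \<le> r") auto
  then show ?thesis by (simp add: S1.lim_filt_def lim_zero fun_eq_iff)
qed

text \<open>The filtration of the limit is complete: the corrections found by successive approximation vanish
  at any given index from some stage on, so their infinite sum makes sense entry by entry.\<close>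

lemma fM_image:
  assumes gr: "\<And>r. lim_gr_epi r" and psi: "\<psi> \<in> S2.lim_filt r"
  shows "\<exists>\<phi>\<in>carrier (lim_mod B1 h1). fM \<phi> = \<psi>"
proof -
  let ?M1 = "lim_mod B1 h1" and ?M2 = "lim_mod B2 h2"
  note M1 = lim_left_module[OF S1.B]
  note M2 = lim_left_module[OF S2.B]
  have psic: "\<psi> \<in> carrier ?M2" using psi by (simp add: S2.lim_filt_def)
  let ?P = "\<lambda>k \<phi>. \<phi> \<in> carrier ?M1 \<and> \<psi> \<ominus>\<^bsub>?M2\<^esub> fM \<phi> \<in> S2.lim_filt (r - int k)"
  have base: "?P 0 \<zero>\<^bsub>?M1\<^esub>"
    using psi left_module_a(2)[OF M1] mod_hom_zero[OF M1 M2 fM_hom] left_module_minus(6)[OF M2 psic]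
    by simp
  have step: "\<exists>\<phi>'. ?P (Suc k) \<phi>' \<and> (\<forall>t\<ge>r - int k. \<phi>' t = \<phi> t)" if P: "?P k \<phi>" for k \<phi>
  proof -
    have "r - int k = (r - int (Suc k)) + 1" by simp
    then obtain \<chi> where chi: "\<chi> \<in> S1.lim_filt (r - int k)"
      "(\<psi> \<ominus>\<^bsub>?M2\<^esub> fM \<phi>) \<ominus>\<^bsub>?M2\<^esub> fM \<chi> \<in> S2.lim_filt (r - int (Suc k))"
      using gr[of "r - int (Suc k)"] P unfolding lim_gr_epi_def by metis
    have chic: "\<chi> \<in> carrier ?M1" using chi(1) by (simp add: S1.lim_filt_def)
    have "\<psi> \<ominus>\<^bsub>?M2\<^esub> fM (\<phi> \<oplus>\<^bsub>?M1\<^esub> \<chi>) = (\<psi> \<ominus>\<^bsub>?M2\<^esub> fM \<phi>) \<ominus>\<^bsub>?M2\<^esub> fM \<chi>"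
      using mod_hom_add[OF fM_hom] P chic mod_hom_closed[OF fM_hom] left_module_minus_add[OF M2 psic]
      by simp
    moreover have "(\<phi> \<oplus>\<^bsub>?M1\<^esub> \<chi>) t = \<phi> t" if "t \<ge> r - int k" for t
    proof -
      interpret Bt: left_module R "B1 t" by (rule S1.modules)
      have "\<chi> t = \<zero>\<^bsub>B1 t\<^esub>" using S1.lim_filt_mono[OF that] chi(1) by (auto simp: S1.lim_filt_def)
      then show ?thesis
        using P by (simp add: lim_mod_def prod_mod_def)
    qed
    ultimately show ?thesis
      using chi(2) P chic left_module_a(1)[OF M1] by (intro exI[of _ "\<phi> \<oplus>\<^bsub>?M1\<^esub> \<chi>"]) simp
  qed
  obtain \<Phi> where P: "\<And>k. ?P k (\<Phi> k)"
    and stab: "\<And>k t. t \<ge> r - int k \<Longrightarrow> \<Phi> (Suc k) t = \<Phi> k t"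
    using dependent_nat_choice[of ?P "\<lambda>k \<phi> \<phi>'. \<forall>t\<ge>r - int k. \<phi>' t = \<phi> t"] base step by blast
  \<comment> \<open>At the index \<open>t\<close> the sequence \<open>\<Phi> k t\<close> is constant from \<open>k = r - t\<close> on.\<close>
  have stab': "\<Phi> l t = \<Phi> k t" if "k \<le> l" "t \<ge> r - int k" for k l t
    using that(1) by (induction l rule: dec_induct) (use stab that(2) in auto)
  define \<phi> where "\<phi> t = \<Phi> (nat (r - t)) t" for t
  have val: "\<phi> t = \<Phi> k t" if "t \<ge> r - int k" for k t
    using stab'[of "nat (r - t)" k t] that by (simp add: \<phi>_def)
  have "\<phi> \<in> carrier ?M1"
    unfolding lim_carrier
  proof (intro conjI allI)
    show "\<phi> t \<in> carrier (B1 t)" for t using P by (simp add: \<phi>_def lim_carrier)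
    show "h1 t (\<phi> t) = \<phi> (t + 1)" for t
      using val[of "nat (r - t)" t] val[of "nat (r - t)" "t + 1"] P[of "nat (r - t)"]
      by (simp add: lim_carrier)
  qed
  moreover have "fM \<phi> t = \<psi> t" for t
  proof -
    let ?k = "nat (r - t)"
    have c: "fM (\<Phi> ?k) \<in> carrier ?M2" using P[of ?k] mod_hom_closed[OF fM_hom] by blast
    have "\<psi> \<ominus>\<^bsub>?M2\<^esub> fM (\<Phi> ?k) \<in> S2.lim_filt t"
      using P[of ?k] subsetD[OF S2.lim_filt_mono[of "r - int ?k" t]] by simp
    then have "\<psi> t \<ominus>\<^bsub>B2 t\<^esub> fM (\<Phi> ?k) t = \<zero>\<^bsub>B2 t\<^esub>"
      using mod_hom_minus[OF M2 S2.modules(2) lim_proj_hom psic c] by (simp add: S2.lim_filt_def)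
    then have "\<psi> t = fM (\<Phi> ?k) t"
      using left_module_minus(3)[OF S2.modules(2)] psic c by (simp add: lim_carrier)
    then show ?thesis by (simp add: \<phi>_def lim_map_def)
  qed
  ultimately show ?thesis by blast
qed

text \<open>The union of the filtration submodules is the kernel of the map from the limit to the colimit, and
  the two preceding lemmas give injectivity on it and preimages of its elements. The assumption is
  about the image of that map, and the five lemma does the rest.\<close>

lemma fM_bij:
  assumes mono: "\<And>r. lim_gr_mono r" and epi: "\<And>r. lim_gr_epi r"
    and img: "bij_betw (colim_map B2 h2 fB) ((\<lambda>\<phi>. colim_in B1 h1 0 (\<phi> 0)) ` carrier (lim_mod B1 h1))
      ((\<lambda>\<phi>. colim_in B2 h2 0 (\<phi> 0)) ` carrier (lim_mod B2 h2))"
  shows "bij_betw fM (carrier (lim_mod B1 h1)) (carrier (lim_mod B2 h2))"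
proof -
  let ?M1 = "lim_mod B1 h1" and ?M2 = "lim_mod B2 h2"
  let ?q1 = "\<lambda>\<phi>. colim_in B1 h1 0 (\<phi> 0)" and ?q2 = "\<lambda>\<phi>. colim_in B2 h2 0 (\<phi> 0)"
  let ?f = "colim_map B2 h2 fB"
  note M1 = lim_left_module[OF S1.B]
  note M2 = lim_left_module[OF S2.B]
  have nat: "?q2 (fM \<phi>) = ?f (?q1 \<phi>)" if "\<phi> \<in> carrier ?M1" for \<phi>
    using colim_map_in[OF S1.B S2.B fB, of "\<phi> 0" 0] that by (simp add: lim_carrier lim_map_def)
  have zero: "?q1 \<zero>\<^bsub>?M1\<^esub> = \<zero>\<^bsub>colim_mod B1 h1\<^esub>" "?q2 \<zero>\<^bsub>?M2\<^esub> = \<zero>\<^bsub>colim_mod B2 h2\<^esub>"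
    by (simp_all add: lim_zero colim_in_zero[OF S1.B] colim_in_zero[OF S2.B])
  have "\<phi> = \<zero>\<^bsub>?M1\<^esub>" if phi: "\<phi> \<in> carrier ?M1" and f0: "fM \<phi> = \<zero>\<^bsub>?M2\<^esub>" for \<phi>
  proof -
    have "?f (?q1 \<phi>) = ?f (?q1 \<zero>\<^bsub>?M1\<^esub>)"
      using nat[OF phi] nat[OF left_module_a(2)[OF M1]] f0 mod_hom_zero[OF M1 M2 fM_hom] by simp
    then have "?q1 \<phi> = ?q1 \<zero>\<^bsub>?M1\<^esub>"
      using bij_betw_imp_inj_on[OF img] phi left_module_a(2)[OF M1] by (simp add: inj_on_def)
    then obtain r where "\<phi> r = \<zero>\<^bsub>B1 r\<^esub>" using lim_germ_zero[OF S1.B phi] zero(1) by auto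
    then have "\<phi> \<in> S1.lim_filt r" using phi by (simp add: S1.lim_filt_def)
    then show ?thesis using fM_kernel[OF mono _ f0] by blast
  qed
  then have "inj_on fM (carrier ?M1)" by (rule hom_inj_onI[OF M1 M2 fM_hom])
  moreover have "\<exists>\<phi>\<in>carrier ?M1. fM \<phi> = \<psi>" if psi: "\<psi> \<in> carrier ?M2" for \<psi>
  proof -
    have "?q2 \<psi> \<in> ?f ` ?q1 ` carrier ?M1" unfolding bij_betw_imp_surj_on[OF img] using psi by blast
    then obtain \<phi> where phi: "\<phi> \<in> carrier ?M1" "?q2 \<psi> = ?q2 (fM \<phi>)" using nat by auto
    have fc: "fM \<phi> \<in> carrier ?M2" by (rule mod_hom_closed[OF fM_hom phi(1)])
    let ?\<delta> = "\<psi> \<ominus>\<^bsub>?M2\<^esub> fM \<phi>"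
    have dc: "?\<delta> \<in> carrier ?M2" by (rule left_module_a(4)[OF M2 psi fc])
    have p0: "\<psi> 0 \<in> carrier (B2 0)" "fM \<phi> 0 \<in> carrier (B2 0)" using psi fc by (simp_all add: lim_carrier)
    have "?q2 ?\<delta> = ?q2 \<psi> \<ominus>\<^bsub>colim_mod B2 h2\<^esub> ?q2 (fM \<phi>)"
      using mod_hom_minus[OF M2 S2.modules(2) lim_proj_hom psi fc, of 0]
        mod_hom_minus[OF S2.modules(2) colim_left_module[OF S2.B] colim_in_hom[OF S2.B] p0] by simp
    then have "?q2 ?\<delta> = \<zero>\<^bsub>colim_mod B2 h2\<^esub>"
      using phi(2) left_module_minus(3)[OF colim_left_module[OF S2.B]]
        mod_hom_closed[OF colim_in_hom[OF S2.B] p0(2)] by simp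
    then obtain r where "?\<delta> r = \<zero>\<^bsub>B2 r\<^esub>" using lim_germ_zero[OF S2.B dc] by blast
    then have "?\<delta> \<in> S2.lim_filt r" using dc by (simp add: S2.lim_filt_def)
    then obtain \<chi> where chi: "\<chi> \<in> carrier ?M1" "fM \<chi> = ?\<delta>" using fM_image[OF epi] by blast
    have "fM (\<chi> \<oplus>\<^bsub>?M1\<^esub> \<phi>) = \<psi>"
      using mod_hom_add[OF fM_hom chi(1) phi(1)] chi(2) left_module_minus(5)[OF M2 psi fc] by simp
    then show ?thesis using left_module_a(1)[OF M1 chi(1) phi(1)] by blast
  qed
  ultimately show ?thesis using mod_hom_closed[OF fM_hom] by (auto simp: bij_betw_def)
qed

end


section \<open>The strands of a regular exact couple\<close>

lemma grid_add: "grid C m r + zscale p (deg_a C) = grid C m (r + p)"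
  by (simp add: grid_def zscale_def algebra_simps prod_eq_iff)

lemma ipow_grid: "ipow C p (grid C m r) d = trans_map (Di C m) r p d"
  by (induction p) (simp_all add: grid_add Di_def)

text \<open>By regularity \<open>\<sigma>\<^sup>2 = 1\<close>, which makes adding \<open>b + c\<close> the same as passing
  from the line \<open>n\<close> to the line \<open>n + \<sigma>\<close>, at the same parameter \<open>r\<close>.\<close>

lemma grid_next:
  assumes "regular_couple R C"
  shows "grid C (n + sigma C) r = grid C n r + deg_b C + deg_c C"
proof -
  have s: "sigma C * sigma C = 1" using assms by (auto simp: regular_couple_def)
  have "sigma C * (n + sigma C) = sigma C * n + 1" by (simp only: distrib_left s)
  then show ?thesis by (simp add: grid_def zscale_def prod_eq_iff algebra_simps)
qed

abbreviation strand_E where "strand_E C n \<equiv> (\<lambda>r. obj_E C (grid C n r + deg_b C))"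
abbreviation strand_J where "strand_J C n \<equiv> (\<lambda>r. map_j C (grid C n r))"
abbreviation strand_K where "strand_K C n \<equiv> (\<lambda>r. map_k C (grid C n r + deg_b C))"

lemma couple_strand:
  assumes reg: "regular_couple R C"
  shows "exact_strand R (Dd C n) (Di C n) (strand_E C n) (strand_J C n) (strand_K C n)
    (Dd C (n + sigma C)) (Di C (n + sigma C))"
proof -
  have ec: "exact_couple R C" using reg by (simp add: regular_couple_def)
  note nxt = grid_next[OF reg]
  have pred: "grid C n r - deg_a C = grid C n (r - 1)" for r
    using grid_Suc[of C n "r - 1"] by (simp add: algebra_simps)
  have succ: "grid C n r + deg_a C + deg_b C + deg_c C = grid C (n + sigma C) (r + 1)" for r
    using grid_Suc[of C n r] nxt[of n "r + 1"] by simp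
  have suc': "grid C n r + deg_b C + deg_c C = grid C (n + sigma C) r" for r by (simp add: nxt)
  show ?thesis
  proof (rule exact_strand.intro)
    show "diagram R (Dd C n) (Di C n)" "diagram R (Dd C (n + sigma C)) (Di C (n + sigma C))"
      using ec by (rule diagram_D)+
    fix r
    show "left_module R (obj_E C (grid C n r + deg_b C))"
      using ec by (simp add: exact_couple_def del: split_paired_All)
    show "mod_hom R (Dd C n r) (obj_E C (grid C n r + deg_b C)) (map_j C (grid C n r))"
      using ec by (simp add: exact_couple_def Dd_def del: split_paired_All)
    show "mod_hom R (obj_E C (grid C n r + deg_b C)) (Dd C (n + sigma C) r)
        (map_k C (grid C n r + deg_b C))"
      using ec by (simp add: exact_couple_def Dd_def nxt del: split_paired_All)
    have "map_i C (grid C n r - deg_a C) ` carrier (obj_D C (grid C n r - deg_a C))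
        = a_kernel (obj_D C (grid C n r)) (obj_E C (grid C n r + deg_b C)) (map_j C (grid C n r))"
      using ec by (simp add: exact_couple_def del: split_paired_All)
    then show "Di C n (r - 1) ` carrier (Dd C n (r - 1))
        = a_kernel (Dd C n r) (obj_E C (grid C n r + deg_b C)) (map_j C (grid C n r))"
      by (simp add: Dd_def Di_def pred)
    show "map_j C (grid C n r) ` carrier (Dd C n r)
        = a_kernel (obj_E C (grid C n r + deg_b C)) (Dd C (n + sigma C) r)
            (map_k C (grid C n r + deg_b C))"
      using ec by (simp add: exact_couple_def Dd_def nxt del: split_paired_All)
    have "map_k C (grid C n r + deg_b C) ` carrier (obj_E C (grid C n r + deg_b C))
        = a_kernel (obj_D C (grid C n r + deg_b C + deg_c C))
            (obj_D C (grid C n r + deg_a C + deg_b C + deg_c C))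
            (map_i C (grid C n r + deg_b C + deg_c C))"
      using ec by (simp add: exact_couple_def del: split_paired_All)
    then show "map_k C (grid C n r + deg_b C) ` carrier (obj_E C (grid C n r + deg_b C))
        = a_kernel (Dd C (n + sigma C) r) (Dd C (n + sigma C) (r + 1)) (Di C (n + sigma C) r)"
      unfolding succ suc' Dd_def Di_def .
  qed
qed

text \<open>One more step of the transfinite recursion does not change the stable value.\<close>

lemma Ibar_image:
  assumes ec: "exact_couple R C"
  shows "Ibar C x = map_i C (x - deg_a C) ` Ibar C (x - deg_a C)"
proof -
  obtain \<tau> where t: "\<And>\<rho> y. (\<tau>, \<rho>) \<in> ords \<Longrightarrow> Iord C \<rho> y = Ibar C y"
    using Ibar_eventually[OF ec] by blast
  obtain \<tau>' where p: "is_pred ords \<tau> \<tau>'" using ords_ex_succ by blast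
  then have "(\<tau>, \<tau>') \<in> ords" by (simp add: is_pred_def underS_def)
  then show ?thesis using Iord_succ[OF p, of C x] t ords_refl by metis
qed

lemma Ibar_carrier:
  assumes ec: "exact_couple R C"
  shows "Ibar C x \<subseteq> carrier (obj_D C x)"
  using Ibar_eventually[OF ec] Iord_props[OF ec] ords_refl by metis

text \<open>Since \<open>i\<close> maps the stable images onto each other, preimages can be chosen one after the other;
  forward entries are forced.\<close>

lemma Ibar_lift:
  assumes ec: "exact_couple R C" and d: "d \<in> Ibar C (grid C m r)"
  shows "\<exists>\<phi>\<in>carrier (Lli C m). \<phi> r = d"
proof -
  have "\<exists>y'. y' \<in> Ibar C (grid C m (r - int (Suc k))) \<and> Di C m (r - int (Suc k)) y' = y"
    if "y \<in> Ibar C (grid C m (r - int k))" for k y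
  proof -
    have "grid C m (r - int k) - deg_a C = grid C m (r - int (Suc k))"
      using grid_Suc[of C m "r - int (Suc k)"] by (simp add: algebra_simps)
    then show ?thesis using that Ibar_image[OF ec, of "grid C m (r - int k)"] by (auto simp: Di_def)
  qed
  then obtain Y where Y: "Y 0 = d" "\<And>k. Y k \<in> Ibar C (grid C m (r - int k))"
    "\<And>k. Di C m (r - int (Suc k)) (Y (Suc k)) = Y k"
    using dependent_nat_choice[of "\<lambda>k y. y \<in> Ibar C (grid C m (r - int k)) \<and> (k = 0 \<longrightarrow> y = d)"
        "\<lambda>k y y'. Di C m (r - int (Suc k)) y' = y"] d by (metis diff_0_right nat.distinct(1) of_nat_0)
  have Yc: "Y k \<in> carrier (Dd C m (r - int k))" for k
    using subsetD[OF Ibar_carrier[OF ec] Y(2)] by (simp add: Dd_def)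
  define \<phi> where "\<phi> s = trans_map (Di C m) (r - int (nat (r - s))) (nat (s - r)) (Y (nat (r - s)))" for s
  have lo: "\<phi> s = Y (nat (r - s))" if "s \<le> r" for s using that by (simp add: \<phi>_def)
  have hi: "\<phi> s = trans_map (Di C m) r (nat (s - r)) d" if "s \<ge> r" for s
    using that by (simp add: \<phi>_def Y(1))
  have "\<phi> s \<in> carrier (Dd C m s)" for s
  proof (cases "s \<le> r")
    case True
    then show ?thesis using Yc[of "nat (r - s)"] by (simp add: lo)
  next
    case False
    then show ?thesis
      using trans_map_closed[OF diagram_D[OF ec], of d m r "nat (s - r)"] Yc[of 0] by (simp add: hi Y(1))
  qed
  moreover have "Di C m s (\<phi> s) = \<phi> (s + 1)" for s
  proof (cases "s < r")
    case True
    then have "nat (r - s) = Suc (nat (r - (s + 1)))" by simp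
    then show ?thesis using Y(3)[of "nat (r - (s + 1))"] True by (simp add: lo)
  next
    case False
    then have "nat (s + 1 - r) = Suc (nat (s - r))" by simp
    then show ?thesis using False by (simp add: hi)
  qed
  ultimately have "\<phi> \<in> carrier (Lli C m)" by (simp add: Lli_def lim_carrier)
  moreover have "\<phi> r = d" by (simp add: lo Y(1))
  ultimately show ?thesis by blast
qed

context
  fixes R :: "('r, 't) ring_scheme" and C :: "('r, 'd, 'e) exact_couple" and n :: int
  assumes reg: "regular_couple R C"
begin

interpretation S: exact_strand R "Dd C n" "Di C n" "strand_E C n" "strand_J C n" "strand_K C n"
    "Dd C (n + sigma C)" "Di C (n + sigma C)"
  by (rule couple_strand[OF reg])

lemma Fco_set_strand: "Fco_set C n = S.colim_filt"
  by (simp add: fun_eq_iff Fco_set_def S.colim_filt_def)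

lemma Fli_set_strand: "Fli_set C (n + sigma C) = S.lim_filt"
  by (simp add: fun_eq_iff Fli_set_def S.lim_filt_def a_kernel_def' Lli_def)

lemma Zinf_strand: "Zinf C (grid C n r + deg_b C) = S.cycles r"
proof -
  have "grid C n r + deg_b C + deg_c C - zscale (int p) (deg_a C) = grid C (n + sigma C) (r - int p)" for p
    using grid_add[of C "n + sigma C" "r - int p" "int p"] grid_next[OF reg, of n r]
    by (simp add: algebra_simps)
  then show ?thesis by (auto simp: Zinf_def Zcyc_def S.cycles_def ipow_grid Dd_def)
qed

lemma Binf_strand: "Binf C (grid C n r + deg_b C) = S.boundaries r"
proof -
  have "{d \<in> carrier (Dd C n r). S.germ r d = \<zero>\<^bsub>colim_mod (Dd C n) (Di C n)\<^esub>} =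
      (\<Union>p. {d \<in> carrier (Dd C n r). trans_map (Di C n) r p d = \<zero>\<^bsub>Dd C n (r + int p)\<^esub>})"
    using colim_in_eq_zero_iff[where r = r, OF S.A] by blast
  then show ?thesis
    by (simp add: Binf_def Bbd_def S.boundaries_def a_kernel_def' ipow_grid grid_add Dd_def image_UN)
qed

text \<open>Equality of the two quotients by the boundaries means that every permanent cycle agrees modulo
  boundaries with an element that \<open>k\<close> maps into the transfinite image. As \<open>k\<close> kills boundaries, the
  cycle itself is mapped there.\<close>

lemma stable_strand:
  assumes st: "stable_at C (grid C n r + deg_b C)"
  shows "S.stable r"
  unfolding S.stable_def
proof
  let ?y = "grid C n r + deg_b C"
  let ?Z = "{e \<in> carrier (obj_E C ?y). map_k C ?y e \<in> Ibar C (?y + deg_c C)}"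
  have ec: "exact_couple R C" using reg by (simp add: regular_couple_def)
  fix e assume e: "e \<in> S.cycles r"
  then have ec': "e \<in> carrier (obj_E C ?y)" by (simp add: S.cycles_def)
  have coset: "N +>\<^bsub>restrict_mod M X\<^esub> x = N +>\<^bsub>M\<^esub> x" for N X x and M :: "('r, 'e) module"
    by (simp add: a_r_coset_def')
  have "Binf C ?y +>\<^bsub>obj_E C ?y\<^esub> e \<in> carrier (Einf C ?y)"
    using e by (simp add: Einf_def quot_carrier Zinf_strand coset)
  then have "Binf C ?y +>\<^bsub>obj_E C ?y\<^esub> e \<in> carrier (Ebar C ?y)" using st by (simp add: stable_at_def)
  then obtain e' where e': "e' \<in> ?Z" "Binf C ?y +>\<^bsub>obj_E C ?y\<^esub> e = Binf C ?y +>\<^bsub>obj_E C ?y\<^esub> e'"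
    by (auto simp: Ebar_def quot_carrier coset)
  have ec'': "e' \<in> carrier (obj_E C ?y)" using e'(1) by simp
  have "e \<ominus>\<^bsub>obj_E C ?y\<^esub> e' \<in> S.boundaries r"
    using quot_eq_iff[OF S.E[of r] S.boundaries_submod ec' ec''] e'(2) by (simp add: Binf_strand)
  then have "map_k C ?y e \<ominus>\<^bsub>Dd C (n + sigma C) r\<^esub> map_k C ?y e' = \<zero>\<^bsub>Dd C (n + sigma C) r\<^esub>"
    using S.K_boundaries mod_hom_minus[OF S.E S.modules(2) S.K ec' ec''] by simp
  then have "map_k C ?y e = map_k C ?y e'"
    using left_module_minus(3)[OF S.modules(2)] mod_hom_closed[OF S.K ec'] mod_hom_closed[OF S.K ec'']
    by blast
  then have "map_k C ?y e \<in> Ibar C (grid C (n + sigma C) r)"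
    using e'(1) by (simp add: grid_next[OF reg])
  then show "\<exists>\<phi>\<in>carrier (lim_mod (Dd C (n + sigma C)) (Di C (n + sigma C))). \<phi> r = map_k C ?y e"
    using Ibar_lift[OF ec] by (simp add: Lli_def)
qed

end

lemma couple_strand_hom:
  assumes r1: "regular_couple R C1" and r2: "regular_couple R C2" and f: "couple_hom R C1 C2 fD fE"
  shows "strand_hom R
    (Dd C1 n) (Di C1 n) (strand_E C1 n) (strand_J C1 n) (strand_K C1 n)
    (Dd C1 (n + sigma C1)) (Di C1 (n + sigma C1))
    (Dd C2 n) (Di C2 n) (strand_E C2 n) (strand_J C2 n) (strand_K C2 n)
    (Dd C2 (n + sigma C1)) (Di C2 (n + sigma C1))
    (\<lambda>r. fD (grid C1 n r)) (\<lambda>r. fE (grid C1 n r + deg_b C1)) (\<lambda>r. fD (grid C1 (n + sigma C1) r))"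
proof -
  have deg: "deg_a C2 = deg_a C1" "deg_b C2 = deg_b C1" "deg_c C2 = deg_c C1"
    using f by (simp_all add: couple_hom_def)
  have sig: "sigma C2 = sigma C1" by (simp add: sigma_def deg)
  have grid: "grid C2 m r = grid C1 m r" for m r by (simp add: grid_def sig deg)
  have d: "diagram_hom R (Dd C1 m) (Di C1 m) (Dd C2 m) (Di C2 m) (\<lambda>r. fD (grid C1 m r))" for m
    using f unfolding couple_hom_def diagram_hom_def Dd_def Di_def grid by (metis grid_Suc)
  interpret S1: exact_strand R "Dd C1 n" "Di C1 n" "strand_E C1 n" "strand_J C1 n" "strand_K C1 n"
    "Dd C1 (n + sigma C1)" "Di C1 (n + sigma C1)" by (rule couple_strand[OF r1])
  interpret S2: exact_strand R "Dd C2 n" "Di C2 n" "strand_E C2 n" "strand_J C2 n" "strand_K C2 n"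
    "Dd C2 (n + sigma C1)" "Di C2 (n + sigma C1)" using couple_strand[OF r2, of n] by (simp add: sig)
  show ?thesis
  proof
    show "fD (grid C1 (n + sigma C1) r) (map_k C1 (grid C1 n r + deg_b C1) e)
        = map_k C2 (grid C2 n r + deg_b C2) (fE (grid C1 n r + deg_b C1) e)"
      if "e \<in> carrier (obj_E C1 (grid C1 n r + deg_b C1))" for e r
      using f that by (simp add: couple_hom_def grid deg grid_next[OF r1] del: split_paired_All)
    show "mod_hom R (strand_E C1 n r) (strand_E C2 n r) (fE (grid C1 n r + deg_b C1))" for r
      using f by (simp add: couple_hom_def grid deg del: split_paired_All)
    show "fE (grid C1 n r + deg_b C1) (map_j C1 (grid C1 n r) d) = map_j C2 (grid C2 n r) (fD (grid C1 n r) d)"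
      if "d \<in> carrier (Dd C1 n r)" for d r
      using f that by (simp add: couple_hom_def grid deg Dd_def del: split_paired_All)
  qed (rule d)+
qed

theorem lemma2p5p7:
  fixes R :: "('r, 't) ring_scheme"
    and C1 :: "('r, 'd1, 'e1) exact_couple"
    and C2 :: "('r, 'd2, 'e2) exact_couple"
    and fD :: "bideg \<Rightarrow> 'd1 \<Rightarrow> 'd2"
    and fE :: "bideg \<Rightarrow> 'e1 \<Rightarrow> 'e2"
    and a b c :: bideg
    and \<sigma> n :: int
  assumes "regular_couple R C1" and "regular_couple R C2"
    and "couple_hom R C1 C2 fD fE"
    and "a = deg_a C1" and "b = deg_b C1" and "c = deg_c C1"
    and "\<sigma> = det2 a (b + c)"
    and i: "\<forall>x. det2 a x = n \<longrightarrow> stable_at C1 (x + b) \<and> stable_at C2 (x + b)"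
    and ii: "\<forall>x. det2 a x = n \<longrightarrow>
      mod_iso R (Einf C1 (x + b)) (Einf C2 (x + b)) (Einf_map C2 fE (x + b))"
    and iii: "\<forall>r. mod_epi R (eps_co C1 n r) (eps_co C2 n r) (eps_co_map C1 C2 fD n r) \<or>
      mod_mono R (eps_li C1 (n + \<sigma>) r) (eps_li C2 (n + \<sigma>) r) (eps_li_map C1 C2 fD (n + \<sigma>) r)"
    and iv: "mod_iso R (lim_mod (Fco C1 n) Fco_incl) (lim_mod (Fco C2 n) Fco_incl)
      (lim_map (\<lambda>r. Lco_map C1 C2 fD n))"
    and v: "mod_mono R (lim1_mod (Fco C1 n) Fco_incl) (lim1_mod (Fco C2 n) Fco_incl)
      (lim1_map (Fco C2 n) Fco_incl (\<lambda>r. Lco_map C1 C2 fD n))"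
    and vi: "mod_iso R (im_li_co C1 (n + \<sigma>)) (im_li_co C2 (n + \<sigma>)) (Lco_map C1 C2 fD (n + \<sigma>))"
  shows "mod_iso R (Lco C1 n) (Lco C2 n) (Lco_map C1 C2 fD n) \<and>
    mod_iso R (Lli C1 (n + \<sigma>)) (Lli C2 (n + \<sigma>)) (Lli_map C1 fD (n + \<sigma>))"
proof -
  have sig: "\<sigma> = sigma C1" using assms(4-7) by (simp add: sigma_def)
  have deg: "deg_a C2 = a" "deg_b C2 = b" "deg_c C2 = c"
    using assms(3-6) by (simp_all add: couple_hom_def)
  have sig2: "sigma C2 = sigma C1" using assms(4-6) deg by (simp add: sigma_def)
  have grid: "grid C2 m r = grid C1 m r" for m r using assms(4-6) by (simp add: grid_def sig2 deg)
  interpret T: strand_hom R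
    "Dd C1 n" "Di C1 n" "strand_E C1 n" "strand_J C1 n" "strand_K C1 n" "Dd C1 (n + \<sigma>)" "Di C1 (n + \<sigma>)"
    "Dd C2 n" "Di C2 n" "strand_E C2 n" "strand_J C2 n" "strand_K C2 n" "Dd C2 (n + \<sigma>)" "Di C2 (n + \<sigma>)"
    "\<lambda>r. fD (grid C1 n r)" "\<lambda>r. fE (grid C1 n r + deg_b C1)" "\<lambda>r. fD (grid C1 (n + \<sigma>) r)"
    unfolding sig by (rule couple_strand_hom[OF assms(1-3)])
  note strand1 = Fco_set_strand[OF assms(1), of n] Fli_set_strand[OF assms(1), of n, folded sig]
    Zinf_strand[OF assms(1), of n, folded sig] Binf_strand[OF assms(1), of n, folded sig]
  note strand2 = Fco_set_strand[OF assms(2), of n, unfolded sig2, folded sig]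
    Fli_set_strand[OF assms(2), of n, unfolded sig2, folded sig]
    Zinf_strand[OF assms(2), of n, unfolded sig2, folded sig]
    Binf_strand[OF assms(2), of n, unfolded sig2, folded sig]
  have det: "det2 a (grid C1 n r) = n" for r using det2_grid[OF assms(1)] assms(4) by blast
  have stable: "T.S1.stable r" for r
    using stable_strand[OF assms(1), of n r, folded sig] i[rule_format, OF det[of r]] assms(5) by simp
  \<comment> \<open>Hypothesis (ii), read on representatives.\<close>
  have page: "T.page_mono r" "T.page_epi r" for r
  proof -
    let ?y = "grid C1 n r + deg_b C1" and ?y2 = "grid C2 n r + deg_b C2"
    have y: "?y2 = ?y" using grid deg(2) assms(5) by simp
    have iso: "mod_iso R (Einf C1 ?y) (Einf C2 ?y2) (Einf_map C2 fE ?y2)"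
      using ii[rule_format, OF det[of r]] y assms(5) by simp
    have quot: "mod_iso R (quot_mod (restrict_mod (strand_E C1 n r) (T.S1.cycles r)) (T.S1.boundaries r))
        (quot_mod (restrict_mod (strand_E C2 n r) (T.S2.cycles r)) (T.S2.boundaries r))
        (quot_map (restrict_mod (strand_E C2 n r) (T.S2.cycles r)) (T.S2.boundaries r) (fE ?y))"
      using iso unfolding Einf_def Einf_map_def strand1 strand2 by (simp only: y)
    show "T.page_mono r"
      unfolding T.page_mono_def
    proof (intro ballI impI)
      fix e assume e: "e \<in> T.S1.cycles r" "fE ?y e \<in> T.S2.boundaries r"
      show "e \<in> T.S1.boundaries r"
        by (rule subquot_map_injD[OF T.S1.E T.S1.cycles_submod T.S1.boundaries_submod
            T.S1.boundaries_cycles T.S2.E T.S2.cycles_submod T.S2.boundaries_submod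
            T.S2.boundaries_cycles T.fE T.fE_cycles T.fE_boundaries])
          (use quot e in \<open>simp_all add: mod_iso_def bij_betw_def\<close>)
    qed
    show "T.page_epi r"
      unfolding T.page_epi_def
    proof
      fix e assume e: "e \<in> T.S2.cycles r"
      show "\<exists>e'\<in>T.S1.cycles r. e \<ominus>\<^bsub>strand_E C2 n r\<^esub> fE ?y e' \<in> T.S2.boundaries r"
        by (rule subquot_map_surjD[OF T.S1.E T.S1.cycles_submod T.S1.boundaries_submod
            T.S1.boundaries_cycles T.S2.E T.S2.cycles_submod T.S2.boundaries_submod
            T.S2.boundaries_cycles T.fE T.fE_cycles T.fE_boundaries])
          (use quot e in \<open>simp_all add: mod_iso_def bij_betw_def\<close>)
    qed
  qed
  have Lmap: "Lco_map C1 C2 fD n = T.fL" "Lli_map C1 fD (n + \<sigma>) = T.fM"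
    "Lco_map C1 C2 fD (n + \<sigma>) = colim_map (Dd C2 (n + \<sigma>)) (Di C2 (n + \<sigma>)) (\<lambda>r. fD (grid C1 (n + \<sigma>) r))"
    by (simp_all add: Lco_map_def Lli_map_def)
  note L1 = colim_left_module[OF T.S1.A] and L2 = colim_left_module[OF T.S2.A]
  note M1 = lim_left_module[OF T.S1.B] and M2 = lim_left_module[OF T.S2.B]
  \<comment> \<open>Either alternative of (iii) implies the other one.\<close>
  have gr: "T.colim_gr_epi r" "T.lim_gr_mono r" for r
  proof -
    have "T.colim_gr_epi r"
      if "mod_epi R (eps_co C1 n r) (eps_co C2 n r) (eps_co_map C1 C2 fD n r)"
      unfolding T.colim_gr_epi_def
    proof
      fix w assume w: "w \<in> T.S2.colim_filt r"
      show "\<exists>z\<in>T.S1.colim_filt r.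
          w \<ominus>\<^bsub>colim_mod (Dd C2 n) (Di C2 n)\<^esub> T.fL z \<in> T.S2.colim_filt (r - 1)"
        by (rule subquot_map_surjD[OF L1 T.S1.colim_filt_submod T.S1.colim_filt_submod
            T.S1.colim_filt_pred L2 T.S2.colim_filt_submod T.S2.colim_filt_submod
            T.S2.colim_filt_pred T.fL_hom T.fL_filt T.fL_filt])
          (use that w in \<open>simp_all add: mod_epi_def eps_co_def eps_co_map_def Fco_def Lco_def Lmap strand1 strand2\<close>)
    qed
    moreover have "T.lim_gr_mono r"
      if "mod_mono R (eps_li C1 (n + \<sigma>) r) (eps_li C2 (n + \<sigma>) r) (eps_li_map C1 C2 fD (n + \<sigma>) r)"
      unfolding T.lim_gr_mono_def
    proof (intro ballI impI)
      fix \<phi> assume phi: "\<phi> \<in> T.S1.lim_filt (r + 1)" "T.fM \<phi> \<in> T.S2.lim_filt r"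
      show "\<phi> \<in> T.S1.lim_filt r"
        by (rule subquot_map_injD[OF M1 T.S1.lim_filt_submod T.S1.lim_filt_submod
            T.S1.lim_filt_Suc M2 T.S2.lim_filt_submod T.S2.lim_filt_submod
            T.S2.lim_filt_Suc T.fM_hom T.fM_filt T.fM_filt])
          (use that phi in \<open>simp_all add: mod_mono_def eps_li_def eps_li_map_def Fli_def Lli_def Lmap strand1 strand2\<close>)
    qed
    ultimately show "T.colim_gr_epi r" "T.lim_gr_mono r"
      using iii T.colim_gr_epi_lim_gr_mono[OF page(1)]
        T.lim_gr_mono_colim_gr_epi[OF page(2) stable] by blast+
  qed
  have incl: "Fco_incl = (\<lambda>r z. z)" by (intro ext) (simp add: Fco_incl_def)
  have Fco1: "Fco C1 n = (\<lambda>r. restrict_mod (colim_mod (Dd C1 n) (Di C1 n)) (T.S1.colim_filt r))"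
    and Fco2: "Fco C2 n = (\<lambda>r. restrict_mod (colim_mod (Dd C2 n) (Di C2 n)) (T.S2.colim_filt r))"
    by (simp_all add: fun_eq_iff Fco_def Lco_def strand1 strand2)
  have exh: "carrier (colim_mod (Dd C1 n) (Di C1 n)) = (\<Union>r. T.S1.colim_filt r)"
    "carrier (colim_mod (Dd C2 n) (Di C2 n)) = (\<Union>r. T.S2.colim_filt r)"
    by (simp_all add: colim_mod_def T.S1.colim_filt_def T.S2.colim_filt_def)
  have "bij_betw T.fL (carrier (colim_mod (Dd C1 n) (Di C1 n))) (carrier (colim_mod (Dd C2 n) (Di C2 n)))"
  proof (rule filtered_bij_lim[OF L1 L2 T.fL_hom T.S1.colim_filt_submod T.S2.colim_filt_submod
        T.S1.colim_filt_pred T.S2.colim_filt_pred T.fL_filt exh])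
    show "z \<in> T.S1.colim_filt (r - 1)"
      if "z \<in> T.S1.colim_filt r" "T.fL z \<in> T.S2.colim_filt (r - 1)" for r z
      using that T.page_mono_colim_gr_mono[OF page(1)] by (simp add: T.colim_gr_mono_def)
    show "\<exists>z\<in>T.S1.colim_filt r. w \<ominus>\<^bsub>colim_mod (Dd C2 n) (Di C2 n)\<^esub> T.fL z \<in> T.S2.colim_filt (r - 1)"
      if "w \<in> T.S2.colim_filt r" for r w
      using that gr(1) by (simp add: T.colim_gr_epi_def)
  qed (use iv v in \<open>simp_all add: mod_iso_def mod_mono_def incl Fco1 Fco2 Lmap\<close>)
  moreover have "bij_betw T.fM (carrier (lim_mod (Dd C1 (n + \<sigma>)) (Di C1 (n + \<sigma>))))
      (carrier (lim_mod (Dd C2 (n + \<sigma>)) (Di C2 (n + \<sigma>))))"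
  proof (rule T.fM_bij[OF gr(2) T.page_epi_lim_gr_epi[OF page(2) stable]])
    show "bij_betw (colim_map (Dd C2 (n + \<sigma>)) (Di C2 (n + \<sigma>)) (\<lambda>r. fD (grid C1 (n + \<sigma>) r)))
      ((\<lambda>\<phi>. colim_in (Dd C1 (n + \<sigma>)) (Di C1 (n + \<sigma>)) 0 (\<phi> 0)) `
        carrier (lim_mod (Dd C1 (n + \<sigma>)) (Di C1 (n + \<sigma>))))
      ((\<lambda>\<phi>. colim_in (Dd C2 (n + \<sigma>)) (Di C2 (n + \<sigma>)) 0 (\<phi> 0)) `
        carrier (lim_mod (Dd C2 (n + \<sigma>)) (Di C2 (n + \<sigma>))))"
      using vi by (simp add: mod_iso_def im_li_co_def li_to_co_def[abs_def] Lli_def Lmap)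
  qed
  ultimately show ?thesis
    using T.fL_hom T.fM_hom by (simp add: mod_iso_def Lco_def Lli_def Lmap)
qed

end
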